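(* In the setting described in the context (data model and diffusion GTD recursion), there exist small enough step-sizes, say $0<\mu<\mu^o$ (with $\mu^o>0$ the constant given in the context), such that the matrix $\mathcal{C}^\top(I_{2MN}-\mu\mathcal{R})$ is stable, i.e. its spectral radius is strictly less than one. Therefore the mean-error recursion $$\mathbb{E}\tilde{\boldsymbol\alpha}_{i+1}=\mathcal{C}^\top(I_{2MN}-\mu\mathcal{R})\,\mathbb{E}\tilde{\boldsymbol\alpha}_{i}+\mu\,\mathcal{C}^\top(\mathcal{G}\alpha^o+g)$$ is stable for every agent $k=1,\dots,N$ and converges to the bias value $$\tilde\alpha_\infty:=\lim_{i\to\infty}\mathbb{E}\tilde{\boldsymbol\alpha}_i=\Big(I_{2MN}-\mathcal{C}^\top(I_{2MN}-\mu\mathcal{R})\Big)^{-1}\mu\,\mathcal{C}^\top(\mathcal{G}\alpha^o+g).$$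
   Context: **MDP and features.** $\mathbb{S}=\{1,\dots,S\}$ is a finite state set, $\mathbb{A}$ a finite action set, $\mathcal{P}(s'|s,a)$ a transition kernel, $r(s,a,s')\in\mathbb{R}$ a reward function, $\gamma\in(0,1)$. $\pi(a|s)$ is a target policy, whose induced Markov chain is irreducible and aperiodic. $P^\pi$ is the $S\times S$ matrix with entries $p^\pi_{ss'}=\sum_a\mathcal{P}(s'|s,a)\pi(a|s)$, and $r^\pi\in\mathbb{R}^S$ has entries $r^\pi(s)=\sum_a\pi(a|s)\sum_{s'}\mathcal{P}(s'|s,a)r(s,a,s')$. Each state $s$ has a feature vector $x_s\in\mathbb{R}^M$ ($M\ll S$); $X\in\mathbb{R}^{S\times M}$ has rows $x_s^\top$ and is full rank (linearly independent columns). $X$ and $r^\pi$ are bounded from below and from above. **Agents.** There are $N$ agents operating in independent MDPs with the same $\mathbb{S},\mathbb{A},\mathcal{P}$; agents do not influence each other's transitions. Agent $k$ follows a behavior policy $\phi_k(a|s)$ with stationary state-visitation distribution $d^{\phi_k}$ (some entries of an individual $d^{\phi_k}$ may be zero); $D^{\phi_k}=\mathrm{diag}\{d^{\phi_k}\}$. The state transitions $(\boldsymbol s_k(i),\boldsymbol s_k(i+1))$ used by agent $k$ at the times $i$ are modelled as i.i.d. samples with initial state $\boldsymbol s_k(i)\sim d^{\phi_k}$, action $\boldsymbol a_k(i)\sim\phi_k(\cdot|\boldsymbol s_k(i))$ and destination $\boldsymbol s'\sim\mathcal{P}(\cdot|\boldsymbol s_k(i),\boldsymbol a_k(i))$, so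 that the data used in the update at time $i+1$ are independent of the current estimates. Write $\boldsymbol x_{k,i}=x_{\boldsymbol s_k(i)}$, $\boldsymbol\delta_{k,i+1}=x_{\boldsymbol s_k(i)}-\gamma x_{\boldsymbol s'}$, $\boldsymbol\xi_k(i)=\pi(\boldsymbol a_k(i)|\boldsymbol s_k(i))/\phi_k(\boldsymbol a_k(i)|\boldsymbol s_k(i))$ (importance weight), $\boldsymbol r_k(i+1)=r(\boldsymbol s_k(i),\boldsymbol a_k(i),\boldsymbol s')$. **Network.** The agents form a connected graph; $\mathcal N_k$ is the neighborhood of agent $k$, including $k$. The fixed combination matrix $C=[c_{lk}]$ ($N\times N$) satisfies $c_{lk}\ge0$, $\sum_{l\in\mathcal N_k}c_{lk}=1$, $c_{lk}=0$ if $l\notin\mathcal N_k$, and $c_{kk}>0$ for at least one $k$; thus $C$ is left-stochastic, and it is primitive. Let $p$ be its Perron eigenvector: $Cp=p$, $p^\top\mathbb{1}_N=1$, all $p_k>0$. **Global problem and its solution.** $\tau=(\tau_1,\dots,\tau_N)^\top$ is a vector of non-negative weights with $\sum_k\tau_k=1$, and $D^{\overline\phi}=\sum_k\tau_kD^{\phi_k}$ is positive definite (every state is visited with positive probability by at least one agent). $\alpha^o=\mathrm{col}\{\theta^o,w^o\}$ is the saddle-point (min over $\theta$, max over $w$) of $L(\theta,w)=\sum_k\tau_k\,\theta^\top X^\top D^{\phi_k}\big(\tfrac12X\theta+(I_S-\gamma P^\pi)Xw-r^\pi\big)$, namely $\theta^o=0_M$ and $w^o=\big(X^\top D^{\overline\phi}(I_S-\gamma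 P^\pi)X\big)^{-1}X^\top D^{\overline\phi}r^\pi$. **Algorithm (diffusion GTD).** Fix $\eta>0$ and a constant step-size $\mu>0$. With $$\boldsymbol G_{k,i+1}=\begin{bmatrix}\eta\boldsymbol x_{k,i}\boldsymbol x_{k,i}^\top\boldsymbol\xi_k(i)&\eta\boldsymbol x_{k,i}\boldsymbol\delta_{k,i+1}^\top\boldsymbol\xi_k(i)\\-\boldsymbol\delta_{k,i+1}\boldsymbol x_{k,i}^\top\boldsymbol\xi_k(i)&0_{M\times M}\end{bmatrix},\quad \boldsymbol g_{k,i+1}=\begin{bmatrix}-\eta\boldsymbol x_{k,i}\boldsymbol\xi_k(i)\boldsymbol r_k(i+1)\\0_M\end{bmatrix},$$ each agent updates $\boldsymbol\alpha_{k,i}\in\mathbb{R}^{2M}$ by $\boldsymbol\psi_{k,i+1}=\boldsymbol\alpha_{k,i}-\mu(\boldsymbol G_{k,i+1}\boldsymbol\alpha_{k,i}+\boldsymbol g_{k,i+1})$, $\boldsymbol\alpha_{k,i+1}=\sum_{l\in\mathcal N_k} c_{lk}\boldsymbol\psi_{l,i+1}$. Errors: $\tilde{\boldsymbol\alpha}_{k,i}=\alpha^o-\boldsymbol\alpha_{k,i}$, $\tilde{\boldsymbol\alpha}_i=\mathrm{col}\{\tilde{\boldsymbol\alpha}_{1,i},\dots,\tilde{\boldsymbol\alpha}_{N,i}\}\in\mathbb{R}^{2MN}$. **Mean quantities.** $$G_k=\mathbb{E}\boldsymbol G_{k,i}=\begin{bmatrix}\eta X^\top D^{\phi_k}X&\eta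 X^\top D^{\phi_k}(I_S-\gamma P^\pi)X\\-X^\top(I_S-\gamma P^\pi)^\top D^{\phi_k}X&0\end{bmatrix},\quad g_k=\mathbb{E}\boldsymbol g_{k,i}=\begin{bmatrix}-\eta X^\top D^{\phi_k}r^\pi\\0_M\end{bmatrix},$$ $\mathcal{C}=C\otimes I_{2M}$, $\mathcal{R}=\mathrm{diag}\{G_1,\dots,G_N\}$ (block diagonal), $\mathcal{G}=\mathrm{col}\{G_1,\dots,G_N\}$, $g=\mathrm{col}\{g_1,\dots,g_N\}$. **The constant $\mu^o$.** Let $C^\top=Y_CJ_CY_C^{-1}$ be a Jordan decomposition (upper triangular) with $J_C=\mathrm{diag}\{1,J_C^0\}$, $Y_C=[\mathbb{1}_N\ \ Y_C^r]$, $Y_C^{-1}=\mathrm{col}\{p^\top,Y_C^l\}$; $\lambda_{k+1}(C)$, $1\le k\le N-1$, are the diagonal entries of $J_C^0$ (all of modulus $<1$). Let $L=2M(N-1)$, $\bar G=\sum_kp_kG_k$ with Jordan decomposition $\bar G=Y_{\bar G}J_{\bar G}Y_{\bar G}^{-1}$ and eigenvalues $\lambda_m(\bar G)$, $1\le m\le 2M$ (the $m$-th diagonal entry of $J_{\bar G}$), whose real parts are shown to be positive in the proof of the theorem. Let $\mathcal{E}_{12}=(p^\top\otimes I_{2M})\mathcal{R}(Y_C^r\otimes I_{2M})$, $\mathcal{E}_{21}=(Y_C^l\otimes I_{2M})\mathcal{R}(\mathbb{1}_N\otimes I_{2M})$, $\mathcal{E}_{22}=(Y_C^l\otimes I_{2M})\mathcal{R}(Y_C^r\otimes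 I_{2M})$, and $\Omega_n^\epsilon=\mathrm{diag}\{\epsilon,\epsilon^2,\dots,\epsilon^n\}$. For parameters $\epsilon,\beta>0$ put $$\mathcal{S}_{12}=(\Omega_{2M}^\epsilon)^{-1}Y_{\bar G}^{-1}\mathcal{E}_{12}(\Omega_{N-1}^\beta\otimes I_{2M}),\quad \mathcal{S}_{21}=\big(((\Omega_{N-1}^\beta)^{-1}J_C^0)\otimes I_{2M}\big)\mathcal{E}_{21}Y_{\bar G}\Omega_{2M}^\epsilon,$$ $$\mathcal{S}_{22}=\big(((\Omega_{N-1}^\beta)^{-1}J_C^0)\otimes I_{2M}\big)\mathcal{E}_{22}(\Omega_{N-1}^\beta\otimes I_{2M}),$$ and $\chi_{(12),m}=\sum_{q=1}^L|[\mathcal{S}_{12}]_{mq}|$, $\chi_{(21),j}=\sum_{q=1}^{2M}|[\mathcal{S}_{21}]_{jq}|$, $\chi_{(22),j}=\sum_{q\ne j}|[\mathcal{S}_{22}]_{jq}|$. Choose $0<\epsilon<\min_m\mathrm{Re}\,\lambda_m(\bar G)$, $0<\beta<1-|\lambda_{k+1}(C)|$ for all $k$, and $0<\sigma<1/\chi_{(21),j}$ for all $j$. Then $\mu^o$ is the minimum over $1\le k\le N-1$, $1\le j\le L$, $1\le m\le 2M$ of $$\big(1-|\lambda_{k+1}(C)|-\beta\big)^2,\quad \left(\frac{1-\sigma\chi_{(21),j}}{\chi_{(22),j}+|[\mathcal{S}_{22}]_{jj}|}\right)^2,\quad \left(\frac{-\frac{\chi_{(12),m}}{\sigma}+\sqrt{\big(\frac{\chi_{(12),m}}{\sigma}\big)^2+2|\lambda_m(\bar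 G)|^2(\mathrm{Re}\,\lambda_m(\bar G)-\epsilon)}}{|\lambda_m(\bar G)|^2}\right)^2.$$
   Formalization: Positivity of Re λ_m(Ḡ), hence existence of μ^o, is proved when X^T(Σ p_k D^{φ_k})(I−γP^π)X is invertible (else 0 is an eigenvalue, μ^o undefined); also assumed: the inverse in w^o exists, and φ_k(a|s)>0 where d^{φ_k}(s)π(a|s)>0. *)

theory Defs
  imports
    "HOL-Probability.Probability"
    "Jordan_Normal_Form.DL_Rank"
    "Jordan_Normal_Form.Gauss_Jordan_Elimination"
    "Jordan_Normal_Form.Spectral_Radius"
begin

unbundle no vec_syntax and no inner_syntax
hide_const (open) Finite_Cartesian_Product.vec Finite_Cartesian_Product.row
  Determinants.det Cartesian_Space.vector Finite_Cartesian_Product.mat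
  Finite_Cartesian_Product.transpose

section \<open>Matrices and vectors\<close>

abbreviation cmat :: "real mat \<Rightarrow> complex mat" where
  "cmat A \<equiv> map_mat complex_of_real A"

text \<open>Only meaningful for invertible square matrices.\<close>

definition mat_inv :: "'a::field mat \<Rightarrow> 'a mat" where
  "mat_inv A = the (mat_inverse A)"

definition kron :: "'a::times mat \<Rightarrow> 'a mat \<Rightarrow> 'a mat" (infixl "\<otimes>\<^sub>k" 72) where
  "A \<otimes>\<^sub>k B = mat (dim_row A * dim_row B) (dim_col A * dim_col B)
     (\<lambda>(i, j). A $$ (i div dim_row B, j div dim_col B) * B $$ (i mod dim_row B, j mod dim_col B))"

text \<open>Vertical stacking of \<open>N\<close> blocks with \<open>n\<close> rows each.\<close>

definition col_vec_stack :: "nat \<Rightarrow> nat \<Rightarrow> (nat \<Rightarrow> 'a vec) \<Rightarrow> 'a vec" where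
  "col_vec_stack N n v = vec (N * n) (\<lambda>i. v (i div n) $ (i mod n))"

definition col_mat_stack :: "nat \<Rightarrow> nat \<Rightarrow> nat \<Rightarrow> (nat \<Rightarrow> 'a mat) \<Rightarrow> 'a mat" where
  "col_mat_stack N n m A = mat (N * n) m (\<lambda>(i, j). A (i div n) $$ (i mod n, j))"

definition outer :: "real vec \<Rightarrow> real vec \<Rightarrow> real mat" where
  "outer u v = mat (dim_vec u) (dim_vec v) (\<lambda>(i, j). u $ i * v $ j)"

definition pos_def :: "real mat \<Rightarrow> bool" where
  "pos_def A \<longleftrightarrow> square_mat A \<and>
     (\<forall>v \<in> carrier_vec (dim_row A). v \<noteq> 0\<^sub>v (dim_row A) \<longrightarrow> 0 < v \<bullet> (A *\<^sub>v v))"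

definition irreducible_chain :: "real mat \<Rightarrow> bool" where
  "irreducible_chain P \<longleftrightarrow> (\<forall>i < dim_row P. \<forall>j < dim_row P. \<exists>n. 0 < (P ^\<^sub>m n) $$ (i, j))"

definition aperiodic_chain :: "real mat \<Rightarrow> bool" where
  "aperiodic_chain P \<longleftrightarrow> (\<forall>i < dim_row P. Gcd {n. 0 < n \<and> 0 < (P ^\<^sub>m n) $$ (i, i)} = 1)"

definition primitive :: "real mat \<Rightarrow> bool" where
  "primitive C \<longleftrightarrow> (\<exists>n > 0. \<forall>i < dim_row C. \<forall>j < dim_row C. 0 < (C ^\<^sub>m n) $$ (i, j))"

section \<open>Problem data\<close>

text \<open>
  States, features and agents are numbered from \<open>0\<close>; actions are the elements of a finite type.
  \<open>trans_prob g s a s'\<close> is the probability of moving from \<open>s\<close> to \<open>s'\<close> under action \<open>a\<close>, and policies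
  \<open>\<pi>(a|s)\<close> are written \<open>pol s a\<close>. The rows of \<open>feat\<close> are the feature vectors;
  \<open>comb g $$ (l, k)\<close> is the weight that agent \<open>k\<close> gives to agent \<open>l\<close>.
\<close>

record 'a gtd =
  nstates :: nat
  nfeats :: nat
  nagents :: nat
  trans_prob :: "nat \<Rightarrow> 'a \<Rightarrow> nat \<Rightarrow> real"
  reward :: "nat \<Rightarrow> 'a \<Rightarrow> nat \<Rightarrow> real"
  discount :: real
  target :: "nat \<Rightarrow> 'a \<Rightarrow> real"
  feat :: "real mat"
  behavior :: "nat \<Rightarrow> nat \<Rightarrow> 'a \<Rightarrow> real"
  visit :: "nat \<Rightarrow> real vec"
  nbhd :: "nat \<Rightarrow> nat set"
  comb :: "real mat"
  weight :: "real vec"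
  eta :: real

definition is_policy :: "'a::finite gtd \<Rightarrow> (nat \<Rightarrow> 'a \<Rightarrow> real) \<Rightarrow> bool" where
  "is_policy g pol \<longleftrightarrow> (\<forall>s < nstates g. (\<forall>a. 0 \<le> pol s a) \<and> (\<Sum>a\<in>UNIV. pol s a) = 1)"

definition chain_mat :: "'a::finite gtd \<Rightarrow> (nat \<Rightarrow> 'a \<Rightarrow> real) \<Rightarrow> real mat" where
  "chain_mat g pol = mat (nstates g) (nstates g)
     (\<lambda>(s, s'). \<Sum>a\<in>UNIV. trans_prob g s a s' * pol s a)"

definition reward_vec :: "'a::finite gtd \<Rightarrow> real vec" where
  "reward_vec g = vec (nstates g)
     (\<lambda>s. \<Sum>a\<in>UNIV. target g s a * (\<Sum>s' < nstates g. trans_prob g s a s' * reward g s a s'))"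

definition visit_mat :: "'a gtd \<Rightarrow> nat \<Rightarrow> real mat" where
  "visit_mat g k = mat_diag (nstates g) (\<lambda>s. visit g k $ s)"

text \<open>The weighted sum of the matrices \<open>visit_mat g k\<close>.\<close>

definition mix_visit_mat :: "'a gtd \<Rightarrow> real vec \<Rightarrow> real mat" where
  "mix_visit_mat g q = mat_diag (nstates g) (\<lambda>s. \<Sum>k < nagents g. q $ k * visit g k $ s)"

definition bellman_mat :: "'a::finite gtd \<Rightarrow> real mat" where
  "bellman_mat g = 1\<^sub>m (nstates g) - discount g \<cdot>\<^sub>m chain_mat g (target g)"

text \<open>\<open>X\<^sup>T D (I - \<gamma> P) X\<close> for the visitation distributions mixed with weights \<open>q\<close>.\<close>

definition key_mat :: "'a::finite gtd \<Rightarrow> real vec \<Rightarrow> real mat" where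
  "key_mat g q = (feat g)\<^sup>T * mix_visit_mat g q * bellman_mat g * feat g"

definition mdp_setting :: "'a::finite gtd \<Rightarrow> bool" where
  "mdp_setting g \<longleftrightarrow>
     0 < nstates g \<and> 0 < nfeats g \<and>
     (\<forall>s < nstates g. \<forall>a. (\<forall>s' < nstates g. 0 \<le> trans_prob g s a s') \<and>
        (\<Sum>s' < nstates g. trans_prob g s a s') = 1) \<and>
     0 < discount g \<and> discount g < 1 \<and>
     is_policy g (target g) \<and>
     irreducible_chain (chain_mat g (target g)) \<and>
     aperiodic_chain (chain_mat g (target g)) \<and>
     feat g \<in> carrier_mat (nstates g) (nfeats g) \<and>
     vec_space.rank (nstates g) (feat g) = nfeats g"

text \<open>
  The last condition of the next definition (coverage) is what makes the importance weights
  \<open>\<pi>(a|s) / \<phi>\<^sub>k(a|s)\<close> reproduce expectations under the target policy.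
\<close>

definition agents_setting :: "'a::finite gtd \<Rightarrow> bool" where
  "agents_setting g \<longleftrightarrow>
     0 < nagents g \<and>
     (\<forall>k < nagents g.
        is_policy g (behavior g k) \<and>
        visit g k \<in> carrier_vec (nstates g) \<and>
        (\<forall>s < nstates g. 0 \<le> visit g k $ s) \<and>
        (\<Sum>s < nstates g. visit g k $ s) = 1 \<and>
        (chain_mat g (behavior g k))\<^sup>T *\<^sub>v visit g k = visit g k \<and>
        (\<forall>s < nstates g. \<forall>a. 0 < visit g k $ s \<and> 0 < target g s a \<longrightarrow> 0 < behavior g k s a))"

definition network_setting :: "'a gtd \<Rightarrow> bool" where
  "network_setting g \<longleftrightarrow>
     (\<forall>k < nagents g. k \<in> nbhd g k \<and> nbhd g k \<subseteq> {..<nagents g}) \<and>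
     (\<forall>k < nagents g. \<forall>l < nagents g. l \<in> nbhd g k \<longleftrightarrow> k \<in> nbhd g l) \<and>
     (\<forall>k < nagents g. \<forall>l < nagents g.
        (k, l) \<in> {(i, j). i < nagents g \<and> j \<in> nbhd g i}\<^sup>*) \<and>
     comb g \<in> carrier_mat (nagents g) (nagents g) \<and>
     (\<forall>k < nagents g.
        (\<forall>l < nagents g. 0 \<le> comb g $$ (l, k)) \<and>
        (\<Sum>l \<in> nbhd g k. comb g $$ (l, k)) = 1 \<and>
        (\<forall>l < nagents g. l \<notin> nbhd g k \<longrightarrow> comb g $$ (l, k) = 0)) \<and>
     (\<exists>k < nagents g. 0 < comb g $$ (k, k)) \<and>
     primitive (comb g)"

text \<open>The last condition says that the formula \<open>w_opt\<close> below is meaningful.\<close>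

definition global_setting :: "'a::finite gtd \<Rightarrow> bool" where
  "global_setting g \<longleftrightarrow>
     0 < eta g \<and>
     weight g \<in> carrier_vec (nagents g) \<and>
     (\<forall>k < nagents g. 0 \<le> weight g $ k) \<and>
     (\<Sum>k < nagents g. weight g $ k) = 1 \<and>
     pos_def (mix_visit_mat g (weight g)) \<and>
     invertible_mat (key_mat g (weight g))"

definition gtd_setting :: "'a::finite gtd \<Rightarrow> bool" where
  "gtd_setting g \<longleftrightarrow> mdp_setting g \<and> agents_setting g \<and> network_setting g \<and> global_setting g"

section \<open>The saddle point\<close>

definition lagrangian :: "'a::finite gtd \<Rightarrow> real vec \<Rightarrow> real vec \<Rightarrow> real" where
  "lagrangian g \<theta> w = (\<Sum>k < nagents g. weight g $ k *
     (\<theta> \<bullet> ((feat g)\<^sup>T *\<^sub>v (visit_mat g k *\<^sub>v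
        ((1 / 2) \<cdot>\<^sub>v (feat g *\<^sub>v \<theta>) + bellman_mat g *\<^sub>v (feat g *\<^sub>v w) - reward_vec g)))))"

definition saddle_point :: "'a::finite gtd \<Rightarrow> real vec \<Rightarrow> real vec \<Rightarrow> bool" where
  "saddle_point g \<theta>' w' \<longleftrightarrow>
     \<theta>' \<in> carrier_vec (nfeats g) \<and> w' \<in> carrier_vec (nfeats g) \<and>
     (\<forall>w \<in> carrier_vec (nfeats g). lagrangian g \<theta>' w \<le> lagrangian g \<theta>' w') \<and>
     (\<forall>\<theta> \<in> carrier_vec (nfeats g). lagrangian g \<theta>' w' \<le> lagrangian g \<theta> w')"

definition w_opt :: "'a::finite gtd \<Rightarrow> real vec" where
  "w_opt g = mat_inv (key_mat g (weight g)) *\<^sub>v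
     ((feat g)\<^sup>T *\<^sub>v (mix_visit_mat g (weight g) *\<^sub>v reward_vec g))"

definition alpha_opt :: "'a::finite gtd \<Rightarrow> real vec" where
  "alpha_opt g = 0\<^sub>v (nfeats g) @\<^sub>v w_opt g"

lemma setting_carriers:
  assumes "gtd_setting g"
  shows "feat g \<in> carrier_mat (nstates g) (nfeats g)"
    and "mix_visit_mat g q \<in> carrier_mat (nstates g) (nstates g)"
    and "visit_mat g k \<in> carrier_mat (nstates g) (nstates g)"
    and "bellman_mat g \<in> carrier_mat (nstates g) (nstates g)"
    and "reward_vec g \<in> carrier_vec (nstates g)"
    and "key_mat g q \<in> carrier_mat (nfeats g) (nfeats g)"
proof -
  show X: "feat g \<in> carrier_mat (nstates g) (nfeats g)"
    using assms by (auto simp: gtd_setting_def mdp_setting_def)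
  show "mix_visit_mat g q \<in> carrier_mat (nstates g) (nstates g)"
    by (simp add: mix_visit_mat_def)
  show "visit_mat g k \<in> carrier_mat (nstates g) (nstates g)"
    by (simp add: visit_mat_def)
  show "bellman_mat g \<in> carrier_mat (nstates g) (nstates g)"
    unfolding bellman_mat_def chain_mat_def
    by (intro minus_carrier_mat smult_carrier_mat mat_carrier)
  show "reward_vec g \<in> carrier_vec (nstates g)"
    by (simp add: reward_vec_def)
  show "key_mat g q \<in> carrier_mat (nfeats g) (nfeats g)"
    unfolding key_mat_def using X by auto
qed

context
  notes mult_mat_vec_carrier[intro]
begin

lemma scalar_prod_self_le_0:
  fixes v :: "real vec"
  assumes v: "v \<in> carrier_vec n" and "v \<bullet> v \<le> 0"
  shows "v = 0\<^sub>v n"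
proof (rule eq_vecI)
  have "(\<Sum>i = 0..<n. v $ i * v $ i) = 0"
    using assms sum_nonneg[of "{0..<n}" "\<lambda>i. v $ i * v $ i"] by (simp add: scalar_prod_def)
  then show "v $ i = 0\<^sub>v n $ i" if "i < dim_vec (0\<^sub>v n)" for i
    using that by (subst (asm) sum_nonneg_eq_0_iff) auto
qed (use v in simp)

lemma sum_visit_mat_mult:
  assumes "u \<in> carrier_vec (nstates g)" "v \<in> carrier_vec (nstates g)"
  shows "(\<Sum>k < nagents g. q $ k * (u \<bullet> (visit_mat g k *\<^sub>v v))) = u \<bullet> (mix_visit_mat g q *\<^sub>v v)"
proof -
  have diag: "(mat_diag (nstates g) f *\<^sub>v v) $ s = f s * v $ s" if "s < nstates g" for f s
  proof -
    have "(mat_diag (nstates g) f *\<^sub>v v) $ s =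
        (\<Sum>i = 0..<nstates g. (if s = i then f i else 0) * v $ i)"
      using that assms by (simp add: mat_diag_def scalar_prod_def)
    also have "\<dots> = (\<Sum>i = 0..<nstates g. if s = i then f i * v $ i else 0)"
      by (intro sum.cong) auto
    finally show ?thesis using that by simp
  qed
  have dot: "u \<bullet> (mat_diag (nstates g) f *\<^sub>v v) = (\<Sum>s < nstates g. u $ s * (f s * v $ s))" for f
    by (simp add: scalar_prod_def diag lessThan_atLeast0 mat_diag_def del: index_mult_mat_vec)
       (intro sum.cong refl, simp flip: mat_diag_def add: diag del: index_mult_mat_vec)
  show ?thesis
    unfolding visit_mat_def mix_visit_mat_def dot sum_distrib_left
    by (subst sum.swap) (simp add: sum_distrib_left sum_distrib_right mult_ac)
qed

lemma lagrangian_eq: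
  assumes g: "gtd_setting g" and \<theta>: "\<theta> \<in> carrier_vec (nfeats g)" and w: "w \<in> carrier_vec (nfeats g)"
  shows "lagrangian g \<theta> w =
    (feat g *\<^sub>v \<theta>) \<bullet> (mix_visit_mat g (weight g) *\<^sub>v (feat g *\<^sub>v \<theta>)) / 2 +
    \<theta> \<bullet> (key_mat g (weight g) *\<^sub>v w -
      (feat g)\<^sup>T *\<^sub>v (mix_visit_mat g (weight g) *\<^sub>v reward_vec g))"
proof -
  note c = setting_carriers[OF g]
  let ?X = "feat g" and ?D = "mix_visit_mat g (weight g)" and ?r = "reward_vec g"
    and ?B = "bellman_mat g"
  define v where "v = (1 / 2) \<cdot>\<^sub>v (?X *\<^sub>v \<theta>) + ?B *\<^sub>v (?X *\<^sub>v w) - ?r"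
  have X\<theta>: "?X *\<^sub>v \<theta> \<in> carrier_vec (nstates g)" and Xw: "?X *\<^sub>v w \<in> carrier_vec (nstates g)"
    and BXw: "?B *\<^sub>v (?X *\<^sub>v w) \<in> carrier_vec (nstates g)"
    using c \<theta> w by auto
  have v: "v \<in> carrier_vec (nstates g)"
    unfolding v_def using X\<theta> BXw c by auto
  have adj: "\<theta> \<bullet> (?X\<^sup>T *\<^sub>v u) = (?X *\<^sub>v \<theta>) \<bullet> u" if "u \<in> carrier_vec (nstates g)" for u
  proof -
    have "\<theta> \<bullet> (?X\<^sup>T *\<^sub>v u) = (?X\<^sup>T *\<^sub>v u) \<bullet> \<theta>"
      using c(1) \<theta> that by (intro comm_scalar_prod[where n = "nfeats g"]) auto
    also have "\<dots> = u \<bullet> (?X *\<^sub>v \<theta>)"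
      by (rule transpose_vec_mult_scalar[OF c(1) \<theta> that])
    also have "\<dots> = (?X *\<^sub>v \<theta>) \<bullet> u"
      using X\<theta> that by (rule comm_scalar_prod[rotated])
    finally show ?thesis .
  qed
  have "lagrangian g \<theta> w =
      (\<Sum>k < nagents g. weight g $ k * ((?X *\<^sub>v \<theta>) \<bullet> (visit_mat g k *\<^sub>v v)))"
    unfolding lagrangian_def v_def[symmetric]
  proof (intro sum.cong refl)
    fix k
    have "visit_mat g k *\<^sub>v v \<in> carrier_vec (nstates g)" using c(3) v by auto
    from adj[OF this]
    show "weight g $ k * (\<theta> \<bullet> (?X\<^sup>T *\<^sub>v (visit_mat g k *\<^sub>v v))) =
        weight g $ k * ((?X *\<^sub>v \<theta>) \<bullet> (visit_mat g k *\<^sub>v v))" by simp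
  qed
  also have "\<dots> = (?X *\<^sub>v \<theta>) \<bullet> (?D *\<^sub>v v)"
    by (rule sum_visit_mat_mult[OF X\<theta> v])
  also have "?D *\<^sub>v v = (1 / 2) \<cdot>\<^sub>v (?D *\<^sub>v (?X *\<^sub>v \<theta>)) + ?D *\<^sub>v (?B *\<^sub>v (?X *\<^sub>v w)) - ?D *\<^sub>v ?r"
  proof -
    have "?D *\<^sub>v v = ?D *\<^sub>v ((1 / 2) \<cdot>\<^sub>v (?X *\<^sub>v \<theta>) + ?B *\<^sub>v (?X *\<^sub>v w)) - ?D *\<^sub>v ?r"
      unfolding v_def by (rule mult_minus_distrib_mat_vec[OF c(2) _ c(5)]) (use X\<theta> BXw in auto)
    also have "?D *\<^sub>v ((1 / 2) \<cdot>\<^sub>v (?X *\<^sub>v \<theta>) + ?B *\<^sub>v (?X *\<^sub>v w)) =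
        ?D *\<^sub>v ((1 / 2) \<cdot>\<^sub>v (?X *\<^sub>v \<theta>)) + ?D *\<^sub>v (?B *\<^sub>v (?X *\<^sub>v w))"
      by (rule mult_add_distrib_mat_vec[OF c(2) _ BXw]) (use X\<theta> in auto)
    also have "?D *\<^sub>v ((1 / 2) \<cdot>\<^sub>v (?X *\<^sub>v \<theta>)) = (1 / 2) \<cdot>\<^sub>v (?D *\<^sub>v (?X *\<^sub>v \<theta>))"
      by (rule mult_mat_vec[OF c(2) X\<theta>])
    finally show ?thesis .
  qed
  also have "(?X *\<^sub>v \<theta>) \<bullet> \<dots> =
     (?X *\<^sub>v \<theta>) \<bullet> (?D *\<^sub>v (?X *\<^sub>v \<theta>)) / 2 +
     (?X *\<^sub>v \<theta>) \<bullet> (?D *\<^sub>v (?B *\<^sub>v (?X *\<^sub>v w))) - (?X *\<^sub>v \<theta>) \<bullet> (?D *\<^sub>v ?r)"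
  proof -
    have 1: "?D *\<^sub>v (?X *\<^sub>v \<theta>) \<in> carrier_vec (nstates g)"
      "?D *\<^sub>v (?B *\<^sub>v (?X *\<^sub>v w)) \<in> carrier_vec (nstates g)"
      "?D *\<^sub>v ?r \<in> carrier_vec (nstates g)"
      using c(2,5) X\<theta> BXw by auto
    show ?thesis
      by (subst scalar_prod_minus_distrib[OF X\<theta> _ 1(3)], use 1 in simp)
         (subst scalar_prod_add_distrib[OF X\<theta> _ 1(2)], use 1 X\<theta> in auto)
  qed
  also have "(?X *\<^sub>v \<theta>) \<bullet> (?D *\<^sub>v (?B *\<^sub>v (?X *\<^sub>v w))) = \<theta> \<bullet> (key_mat g (weight g) *\<^sub>v w)"
  proof -
    have "key_mat g (weight g) *\<^sub>v w = ?X\<^sup>T *\<^sub>v (?D *\<^sub>v (?B *\<^sub>v (?X *\<^sub>v w)))"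
    proof -
      have 1: "?X\<^sup>T \<in> carrier_mat (nfeats g) (nstates g)" using c(1) by simp
      have 2: "?X\<^sup>T * ?D \<in> carrier_mat (nfeats g) (nstates g)"
        by (rule mult_carrier_mat[OF 1 c(2)])
      have 3: "?X\<^sup>T * ?D * ?B \<in> carrier_mat (nfeats g) (nstates g)"
        by (rule mult_carrier_mat[OF 2 c(4)])
      show ?thesis
        unfolding key_mat_def assoc_mult_mat_vec[OF 3 c(1) w] assoc_mult_mat_vec[OF 2 c(4) Xw]
          assoc_mult_mat_vec[OF 1 c(2) BXw] ..
    qed
    then show ?thesis using adj[OF mult_mat_vec_carrier[OF c(2) BXw]] by simp
  qed
  also have "(?X *\<^sub>v \<theta>) \<bullet> (?D *\<^sub>v ?r) = \<theta> \<bullet> (?X\<^sup>T *\<^sub>v (?D *\<^sub>v ?r))"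
    using adj[OF mult_mat_vec_carrier[OF c(2,5)]] by simp
  finally have L: "lagrangian g \<theta> w = (?X *\<^sub>v \<theta>) \<bullet> (?D *\<^sub>v (?X *\<^sub>v \<theta>)) / 2 +
     \<theta> \<bullet> (key_mat g (weight g) *\<^sub>v w) - \<theta> \<bullet> (?X\<^sup>T *\<^sub>v (?D *\<^sub>v ?r))" .
  have "?X\<^sup>T *\<^sub>v (?D *\<^sub>v ?r) \<in> carrier_vec (nfeats g)"
    by (rule mult_mat_vec_carrier[OF transpose_carrier_mat[THEN iffD2, OF c(1)]
          mult_mat_vec_carrier[OF c(2,5)]])
  moreover have "key_mat g (weight g) *\<^sub>v w \<in> carrier_vec (nfeats g)"
    by (rule mult_mat_vec_carrier[OF c(6) w])
  ultimately show ?thesis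
    unfolding L using scalar_prod_minus_distrib[OF \<theta>] by simp
qed

lemma saddle_point_iff:
  assumes g: "gtd_setting g"
  shows "saddle_point g \<theta>' w' \<longleftrightarrow> \<theta>' = 0\<^sub>v (nfeats g) \<and> w' = w_opt g"
proof -
  note c = setting_carriers[OF g]
  let ?n = "nfeats g" and ?X = "feat g" and ?D = "mix_visit_mat g (weight g)"
  define K where "K = key_mat g (weight g)"
  define Ki where "Ki = mat_inv K"
  define b where "b = ?X\<^sup>T *\<^sub>v (?D *\<^sub>v reward_vec g)"
  define q where "q \<theta> = (?X *\<^sub>v \<theta>) \<bullet> (?D *\<^sub>v (?X *\<^sub>v \<theta>))" for \<theta>
  have K: "K \<in> carrier_mat ?n ?n" unfolding K_def by (rule c)
  have b: "b \<in> carrier_vec ?n" unfolding b_def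
    by (rule mult_mat_vec_carrier[OF transpose_carrier_mat[THEN iffD2, OF c(1)]
          mult_mat_vec_carrier[OF c(2,5)]])
  have "invertible_mat K" using g by (simp add: gtd_setting_def global_setting_def K_def)
  then obtain B where B: "K * B = 1\<^sub>m ?n" "B * K = 1\<^sub>m (dim_row B)"
    using K by (auto simp: invertible_mat_def inverts_mat_def)
  have "dim_row B = ?n"
    using B K by (metis carrier_matD(2) index_mult_mat(3) index_one_mat(3))
  moreover have "dim_col B = ?n"
    using B(1) by (metis index_mult_mat(3) index_one_mat(3))
  ultimately have B': "B \<in> carrier_mat ?n ?n" and "B * K = 1\<^sub>m ?n" using B by auto
  have Ki: "K * Ki = 1\<^sub>m ?n" "Ki * K = 1\<^sub>m ?n" "Ki \<in> carrier_mat ?n ?n"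
  proof -
    have "K \<in> Units (ring_mat TYPE(real) ?n ())"
      using K B' B(1) \<open>B * K = 1\<^sub>m ?n\<close> by (auto simp: Units_def ring_mat_def)
    then obtain C where "mat_inverse K = Some C"
      using mat_inverse(1)[OF K, where b = "()"] by (cases "mat_inverse K") auto
    then show "K * Ki = 1\<^sub>m ?n" "Ki * K = 1\<^sub>m ?n" "Ki \<in> carrier_mat ?n ?n"
      using mat_inverse(2)[OF K, of C] by (auto simp: Ki_def mat_inv_def)
  qed
  have wo: "w_opt g = Ki *\<^sub>v b" by (simp add: w_opt_def Ki_def K_def b_def)
  have KKi: "K *\<^sub>v (Ki *\<^sub>v v) = v" if "v \<in> carrier_vec ?n" for v
    using assoc_mult_mat_vec[OF K Ki(3) that] Ki(1) that by simp
  have KiK: "Ki *\<^sub>v (K *\<^sub>v v) = v" if "v \<in> carrier_vec ?n" for v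
    using assoc_mult_mat_vec[OF Ki(3) K that] Ki(2) that by simp
  have L: "lagrangian g \<theta> w = q \<theta> / 2 + \<theta> \<bullet> (K *\<^sub>v w - b)"
    if "\<theta> \<in> carrier_vec ?n" "w \<in> carrier_vec ?n" for \<theta> w
    using lagrangian_eq[OF g that] by (simp add: q_def K_def b_def)
  have q0: "q (0\<^sub>v ?n) = 0"
  proof -
    have "?X *\<^sub>v 0\<^sub>v ?n = 0\<^sub>v (nstates g)"
      using c(1) by (intro eq_vecI) auto
    moreover have "?D *\<^sub>v 0\<^sub>v (nstates g) \<in> carrier_vec (nstates g)"
      using c(2) by (rule mult_mat_vec_carrier) simp
    ultimately show ?thesis by (simp add: q_def)
  qed
  have q_nonneg: "0 \<le> q \<theta>" if "\<theta> \<in> carrier_vec ?n" for \<theta>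
  proof -
    have "pos_def ?D" using g by (simp add: gtd_setting_def global_setting_def)
    moreover have X: "?X *\<^sub>v \<theta> \<in> carrier_vec (nstates g)" using c(1) that by auto
    ultimately have "?X *\<^sub>v \<theta> \<noteq> 0\<^sub>v (nstates g) \<Longrightarrow> 0 < q \<theta>"
      using c(2)[of "weight g"] unfolding pos_def_def q_def by auto
    moreover have "q \<theta> = 0" if "?X *\<^sub>v \<theta> = 0\<^sub>v (nstates g)"
      unfolding q_def that using c(2)[of "weight g"] by simp
    ultimately show ?thesis by fastforce
  qed
  have L0: "lagrangian g (0\<^sub>v ?n) w = 0" if w: "w \<in> carrier_vec ?n" for w
  proof -
    have "K *\<^sub>v w - b \<in> carrier_vec ?n" using K b w by auto
    then show ?thesis using L[OF _ w] q0 by simp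
  qed
  show ?thesis
  proof
    assume "\<theta>' = 0\<^sub>v ?n \<and> w' = w_opt g"
    then have \<theta>': "\<theta>' = 0\<^sub>v ?n" and w': "w' = Ki *\<^sub>v b" by (auto simp: wo)
    have w'c: "w' \<in> carrier_vec ?n" unfolding w' using Ki b by auto
    have "K *\<^sub>v w' - b = 0\<^sub>v ?n" unfolding w' KKi[OF b] using b by simp
    then have Lq: "lagrangian g \<theta> w' = q \<theta> / 2" if "\<theta> \<in> carrier_vec ?n" for \<theta>
      using L[OF that w'c] that by simp
    have "0 \<le> lagrangian g \<theta> w'" if "\<theta> \<in> carrier_vec ?n" for \<theta>
      using q_nonneg[OF that] Lq[OF that] by simp
    then show "saddle_point g \<theta>' w'"
      using w'c L0 by (simp add: saddle_point_def \<theta>')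
  next
    assume s: "saddle_point g \<theta>' w'"
    then have \<theta>': "\<theta>' \<in> carrier_vec ?n" and w': "w' \<in> carrier_vec ?n"
      by (auto simp: saddle_point_def)
    have "\<theta>' \<bullet> \<theta>' \<le> 0"
    proof -
      define w where "w = w' + Ki *\<^sub>v \<theta>'"
      have Ki\<theta>: "Ki *\<^sub>v \<theta>' \<in> carrier_vec ?n" using Ki \<theta>' by auto
      have w: "w \<in> carrier_vec ?n" unfolding w_def using w' Ki\<theta> by auto
      have "K *\<^sub>v w - b = (K *\<^sub>v w' - b) + \<theta>'"
        unfolding w_def mult_add_distrib_mat_vec[OF K w' Ki\<theta>] KKi[OF \<theta>'] using K b \<theta>' w'
        by (intro eq_vecI) auto
      moreover have "K *\<^sub>v w' - b \<in> carrier_vec ?n" using K b w' by auto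
      ultimately have "lagrangian g \<theta>' w = lagrangian g \<theta>' w' + \<theta>' \<bullet> \<theta>'"
        using L[OF \<theta>' w] L[OF \<theta>' w'] scalar_prod_add_distrib[OF \<theta>' _ \<theta>'] by simp
      then show ?thesis using s w by (auto simp: saddle_point_def)
    qed
    then have \<theta>0: "\<theta>' = 0\<^sub>v ?n"
      by (rule scalar_prod_self_le_0[OF \<theta>'])
    define v where "v = K *\<^sub>v w' - b"
    have v: "v \<in> carrier_vec ?n" unfolding v_def using K b w' by auto
    have vt: "v \<bullet> v \<le> t * (q v / 2)" if t: "0 < t" for t
    proof -
      have tv: "(- t) \<cdot>\<^sub>v v \<in> carrier_vec ?n" using v by auto
      have "0 \<le> lagrangian g ((- t) \<cdot>\<^sub>v v) w'"
        using s tv L0[OF w'] by (auto simp: saddle_point_def \<theta>0)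
      also have "\<dots> = q ((- t) \<cdot>\<^sub>v v) / 2 - t * (v \<bullet> v)"
        using L[OF tv w'] v by (simp flip: v_def)
      also have "q ((- t) \<cdot>\<^sub>v v) = t * t * q v"
      proof -
        have "?X *\<^sub>v v \<in> carrier_vec (nstates g)" using c(1) v by auto
        from mult_mat_vec[OF c(1) v, where k = "- t"] mult_mat_vec[OF c(2) this, where k = "- t"]
          mult_mat_vec_carrier[OF c(2) this] this
        show ?thesis by (simp add: q_def)
      qed
      finally have "t * (v \<bullet> v) \<le> t * (t * (q v / 2))" by (simp add: mult_ac)
      with t show ?thesis by simp
    qed
    have "v \<bullet> v \<le> 0"
    proof (rule ccontr)
      assume "\<not> v \<bullet> v \<le> 0"
      then have pos: "0 < v \<bullet> v" by simp
      with vt[of 1] have q: "0 < q v" by simp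
      with pos have "v \<bullet> v \<le> (v \<bullet> v / q v) * (q v / 2)"
        by (intro vt divide_pos_pos)
      with pos q show False by simp
    qed
    then have "v = 0\<^sub>v ?n"
      by (rule scalar_prod_self_le_0[OF v])
    have "K *\<^sub>v w' = b"
    proof (rule eq_vecI)
      show "(K *\<^sub>v w') $ i = b $ i" if "i < dim_vec b" for i
      proof -
        have "v $ i = (K *\<^sub>v w') $ i - b $ i"
          unfolding v_def using that by (rule index_minus_vec)
        then show ?thesis using \<open>v = 0\<^sub>v ?n\<close> that b by simp
      qed
    qed (use K b in auto)
    then have "w' = Ki *\<^sub>v b" using KiK[OF w'] by simp
    then show "\<theta>' = 0\<^sub>v ?n \<and> w' = w_opt g" using \<theta>0 wo by simp
  qed
qed

end

section \<open>Mean quantities\<close>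

definition mean_G :: "'a::finite gtd \<Rightarrow> nat \<Rightarrow> real mat" where
  "mean_G g k = four_block_mat
     (eta g \<cdot>\<^sub>m ((feat g)\<^sup>T * visit_mat g k * feat g))
     (eta g \<cdot>\<^sub>m ((feat g)\<^sup>T * visit_mat g k * bellman_mat g * feat g))
     (- ((feat g)\<^sup>T * (bellman_mat g)\<^sup>T * visit_mat g k * feat g))
     (0\<^sub>m (nfeats g) (nfeats g))"

definition mean_g :: "'a::finite gtd \<Rightarrow> nat \<Rightarrow> real vec" where
  "mean_g g k = (- eta g) \<cdot>\<^sub>v ((feat g)\<^sup>T *\<^sub>v (visit_mat g k *\<^sub>v reward_vec g)) @\<^sub>v 0\<^sub>v (nfeats g)"

definition big_C :: "'a gtd \<Rightarrow> real mat" where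
  "big_C g = comb g \<otimes>\<^sub>k 1\<^sub>m (2 * nfeats g)"

definition big_R :: "'a::finite gtd \<Rightarrow> real mat" where
  "big_R g = diag_block_mat (map (mean_G g) [0..<nagents g])"

definition big_G :: "'a::finite gtd \<Rightarrow> real mat" where
  "big_G g = col_mat_stack (nagents g) (2 * nfeats g) (2 * nfeats g) (mean_G g)"

definition big_g :: "'a::finite gtd \<Rightarrow> real vec" where
  "big_g g = col_vec_stack (nagents g) (2 * nfeats g) (mean_g g)"

definition big_dim :: "'a gtd \<Rightarrow> nat" where
  "big_dim g = nagents g * (2 * nfeats g)"

definition error_mat :: "'a::finite gtd \<Rightarrow> real \<Rightarrow> real mat" where
  "error_mat g \<mu> = (big_C g)\<^sup>T * (1\<^sub>m (big_dim g) - \<mu> \<cdot>\<^sub>m big_R g)"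

definition drift_vec :: "'a::finite gtd \<Rightarrow> real \<Rightarrow> real vec" where
  "drift_vec g \<mu> = \<mu> \<cdot>\<^sub>v ((big_C g)\<^sup>T *\<^sub>v (big_G g *\<^sub>v alpha_opt g + big_g g))"

definition bias_vec :: "'a::finite gtd \<Rightarrow> real \<Rightarrow> real vec" where
  "bias_vec g \<mu> = mat_inv (1\<^sub>m (big_dim g) - error_mat g \<mu>) *\<^sub>v drift_vec g \<mu>"

section \<open>The step-size bound\<close>

text \<open>
  The Perron vector of \<open>C\<close> together with Jordan decompositions \<open>C\<^sup>T = Y J Y\<^sup>-\<^sup>1\<close> (where
  \<open>J = diag(1, J0)\<close>, and \<open>blocksC\<close> lists sizes and eigenvalues of the blocks of \<open>J0\<close>) and
  of the \<open>p\<close>-weighted sum of the \<open>G\<^sub>k\<close>; the fields \<open>YCi\<close> and \<open>YGi\<close> hold the inverses.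
\<close>

record jordan_data =
  perron :: "real vec"
  YC :: "complex mat"
  YCi :: "complex mat"
  blocksC :: "(nat \<times> complex) list"
  YG :: "complex mat"
  YGi :: "complex mat"
  blocksG :: "(nat \<times> complex) list"

definition G_bar :: "'a::finite gtd \<Rightarrow> jordan_data \<Rightarrow> real mat" where
  "G_bar g J = mat (2 * nfeats g) (2 * nfeats g)
     (\<lambda>ij. \<Sum>k < nagents g. perron J $ k * mean_G g k $$ ij)"

definition jordan_setting :: "'a::finite gtd \<Rightarrow> jordan_data \<Rightarrow> bool" where
  "jordan_setting g J \<longleftrightarrow>
     perron J \<in> carrier_vec (nagents g) \<and>
     comb g *\<^sub>v perron J = perron J \<and>
     (\<Sum>k < nagents g. perron J $ k) = 1 \<and>
     (\<forall>k < nagents g. 0 < perron J $ k) \<and>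
     0 \<notin> fst ` set (blocksC J) \<and>
     similar_mat_wit (cmat (comb g)\<^sup>T) (jordan_matrix ((1, 1) # blocksC J)) (YC J) (YCi J) \<and>
     col (YC J) 0 = vec (nagents g) (\<lambda>_. 1) \<and>
     row (YCi J) 0 = map_vec complex_of_real (perron J) \<and>
     0 \<notin> fst ` set (blocksG J) \<and>
     similar_mat_wit (cmat (G_bar g J)) (jordan_matrix (blocksG J)) (YG J) (YGi J)"

definition J0 :: "jordan_data \<Rightarrow> complex mat" where
  "J0 J = jordan_matrix (blocksC J)"

text \<open>\<open>lamC J k\<close> for \<open>k = 0, \<dots>, N - 2\<close> are \<open>\<lambda>\<^sub>2(C), \<dots>, \<lambda>\<^sub>N(C)\<close>.\<close>

definition lamC :: "jordan_data \<Rightarrow> nat \<Rightarrow> complex" where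
  "lamC J k = J0 J $$ (k, k)"

definition lamG :: "jordan_data \<Rightarrow> nat \<Rightarrow> complex" where
  "lamG J m = jordan_matrix (blocksG J) $$ (m, m)"

definition YCr :: "'a gtd \<Rightarrow> jordan_data \<Rightarrow> complex mat" where
  "YCr g J = mat (nagents g) (nagents g - 1) (\<lambda>(i, j). YC J $$ (i, j + 1))"

definition YCl :: "'a gtd \<Rightarrow> jordan_data \<Rightarrow> complex mat" where
  "YCl g J = mat (nagents g - 1) (nagents g) (\<lambda>(i, j). YCi J $$ (i + 1, j))"

definition E12 :: "'a::finite gtd \<Rightarrow> jordan_data \<Rightarrow> complex mat" where
  "E12 g J = (cmat (mat_of_rows (nagents g) [perron J]) \<otimes>\<^sub>k 1\<^sub>m (2 * nfeats g)) * cmat (big_R g) *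
     (YCr g J \<otimes>\<^sub>k 1\<^sub>m (2 * nfeats g))"

definition E21 :: "'a::finite gtd \<Rightarrow> jordan_data \<Rightarrow> complex mat" where
  "E21 g J = (YCl g J \<otimes>\<^sub>k 1\<^sub>m (2 * nfeats g)) * cmat (big_R g) *
     (mat_of_cols (nagents g) [vec (nagents g) (\<lambda>_. 1)] \<otimes>\<^sub>k 1\<^sub>m (2 * nfeats g))"

definition E22 :: "'a::finite gtd \<Rightarrow> jordan_data \<Rightarrow> complex mat" where
  "E22 g J = (YCl g J \<otimes>\<^sub>k 1\<^sub>m (2 * nfeats g)) * cmat (big_R g) *
     (YCr g J \<otimes>\<^sub>k 1\<^sub>m (2 * nfeats g))"

definition Omega :: "nat \<Rightarrow> real \<Rightarrow> complex mat" where
  "Omega n \<epsilon> = mat_diag n (\<lambda>i. complex_of_real (\<epsilon> ^ (i + 1)))"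

definition S12 :: "'a::finite gtd \<Rightarrow> jordan_data \<Rightarrow> real \<Rightarrow> real \<Rightarrow> complex mat" where
  "S12 g J \<epsilon> \<beta> = mat_inv (Omega (2 * nfeats g) \<epsilon>) * YGi J * E12 g J *
     (Omega (nagents g - 1) \<beta> \<otimes>\<^sub>k 1\<^sub>m (2 * nfeats g))"

definition S21 :: "'a::finite gtd \<Rightarrow> jordan_data \<Rightarrow> real \<Rightarrow> real \<Rightarrow> complex mat" where
  "S21 g J \<epsilon> \<beta> = ((mat_inv (Omega (nagents g - 1) \<beta>) * J0 J) \<otimes>\<^sub>k 1\<^sub>m (2 * nfeats g)) *
     E21 g J * YG J * Omega (2 * nfeats g) \<epsilon>"

definition S22 :: "'a::finite gtd \<Rightarrow> jordan_data \<Rightarrow> real \<Rightarrow> complex mat" where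
  "S22 g J \<beta> = ((mat_inv (Omega (nagents g - 1) \<beta>) * J0 J) \<otimes>\<^sub>k 1\<^sub>m (2 * nfeats g)) *
     E22 g J * (Omega (nagents g - 1) \<beta> \<otimes>\<^sub>k 1\<^sub>m (2 * nfeats g))"

definition Ldim :: "'a gtd \<Rightarrow> nat" where
  "Ldim g = 2 * nfeats g * (nagents g - 1)"

definition chi12 :: "'a::finite gtd \<Rightarrow> jordan_data \<Rightarrow> real \<Rightarrow> real \<Rightarrow> nat \<Rightarrow> real" where
  "chi12 g J \<epsilon> \<beta> m = (\<Sum>q < Ldim g. cmod (S12 g J \<epsilon> \<beta> $$ (m, q)))"

definition chi21 :: "'a::finite gtd \<Rightarrow> jordan_data \<Rightarrow> real \<Rightarrow> real \<Rightarrow> nat \<Rightarrow> real" where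
  "chi21 g J \<epsilon> \<beta> j = (\<Sum>q < 2 * nfeats g. cmod (S21 g J \<epsilon> \<beta> $$ (j, q)))"

definition chi22 :: "'a::finite gtd \<Rightarrow> jordan_data \<Rightarrow> real \<Rightarrow> nat \<Rightarrow> real" where
  "chi22 g J \<beta> j = (\<Sum>q \<in> {..<Ldim g} - {j}. cmod (S22 g J \<beta> $$ (j, q)))"

text \<open>
  The condition on \<open>\<sigma>\<close> is \<open>\<sigma> < 1 / chi21\<close>, with \<open>1 / 0\<close> read as infinity.
\<close>

definition admissible ::
  "'a::finite gtd \<Rightarrow> jordan_data \<Rightarrow> real \<Rightarrow> real \<Rightarrow> real \<Rightarrow> bool" where
  "admissible g J \<epsilon> \<beta> \<sigma> \<longleftrightarrow>
     0 < \<epsilon> \<and> (\<forall>m < 2 * nfeats g. \<epsilon> < Re (lamG J m)) \<and>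
     0 < \<beta> \<and> (\<forall>k < nagents g - 1. \<beta> < 1 - cmod (lamC J k)) \<and>
     0 < \<sigma> \<and> (\<forall>j < Ldim g. \<sigma> * chi21 g J \<epsilon> \<beta> j < 1)"

text \<open>
  Indices \<open>j\<close> for which the denominator \<open>chi22 + cmod S22(j,j)\<close> vanishes contribute infinity,
  that is, no constraint; such indices exist, for instance, for \<open>C = p 1\<^sup>T\<close>, where \<open>J0 = 0\<close>.
\<close>

definition mu_bound ::
  "'a::finite gtd \<Rightarrow> jordan_data \<Rightarrow> real \<Rightarrow> real \<Rightarrow> real \<Rightarrow> real" where
  "mu_bound g J \<epsilon> \<beta> \<sigma> = Min (
     {(1 - cmod (lamC J k) - \<beta>)\<^sup>2 | k. k < nagents g - 1} \<union>
     {((1 - \<sigma> * chi21 g J \<epsilon> \<beta> j) / (chi22 g J \<beta> j + cmod (S22 g J \<beta> $$ (j, j))))\<^sup>2 | j.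
        j < Ldim g \<and> chi22 g J \<beta> j + cmod (S22 g J \<beta> $$ (j, j)) \<noteq> 0} \<union>
     {((- (chi12 g J \<epsilon> \<beta> m / \<sigma>) +
         sqrt ((chi12 g J \<epsilon> \<beta> m / \<sigma>)\<^sup>2 + 2 * (cmod (lamG J m))\<^sup>2 * (Re (lamG J m) - \<epsilon>)))
        / (cmod (lamG J m))\<^sup>2)\<^sup>2 | m. m < 2 * nfeats g})"

section \<open>Diffusion GTD\<close>

text \<open>
  A sample \<open>(s, a, s')\<close> consists of the state, the action and the destination; in the next two
  definitions, the ratio of the policies is the importance weight.
\<close>

fun sample_G :: "'a gtd \<Rightarrow> nat \<Rightarrow> nat \<times> 'a \<times> nat \<Rightarrow> real mat" where
  "sample_G g k (s, a, s') = (
     let x = row (feat g) s;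
         \<delta> = row (feat g) s - discount g \<cdot>\<^sub>v row (feat g) s';
         \<xi> = target g s a / behavior g k s a
     in four_block_mat ((eta g * \<xi>) \<cdot>\<^sub>m outer x x) ((eta g * \<xi>) \<cdot>\<^sub>m outer x \<delta>)
          ((- \<xi>) \<cdot>\<^sub>m outer \<delta> x) (0\<^sub>m (nfeats g) (nfeats g)))"

fun sample_g :: "'a gtd \<Rightarrow> nat \<Rightarrow> nat \<times> 'a \<times> nat \<Rightarrow> real vec" where
  "sample_g g k (s, a, s') = (
     let x = row (feat g) s;
         \<xi> = target g s a / behavior g k s a
     in (- (eta g * \<xi> * reward g s a s')) \<cdot>\<^sub>v x @\<^sub>v 0\<^sub>v (nfeats g))"

text \<open>
  \<open>data k i\<close> is the triple \<open>(s\<^sub>k(i), a\<^sub>k(i), s')\<close> that agent \<open>k\<close> uses to compute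
  \<open>est k (i + 1)\<close>. The initial estimates may be random, but are independent of all the data.
\<close>

definition data_model ::
  "'a::finite gtd \<Rightarrow> 'w measure \<Rightarrow> (nat \<Rightarrow> nat \<Rightarrow> 'w \<Rightarrow> nat \<times> 'a \<times> nat) \<Rightarrow> bool" where
  "data_model g \<Omega> data \<longleftrightarrow>
     prob_space \<Omega> \<and>
     prob_space.indep_vars \<Omega> (\<lambda>_. count_space UNIV) (\<lambda>(k, i). data k i) ({..<nagents g} \<times> UNIV) \<and>
     (\<forall>k < nagents g. \<forall>i. \<forall>s < nstates g. \<forall>a. \<forall>s' < nstates g.
        measure \<Omega> {\<omega> \<in> space \<Omega>. data k i \<omega> = (s, a, s')} =
          visit g k $ s * behavior g k s a * trans_prob g s a s')"

definition initial_model ::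
  "'a::finite gtd \<Rightarrow> 'w measure \<Rightarrow> (nat \<Rightarrow> nat \<Rightarrow> 'w \<Rightarrow> nat \<times> 'a \<times> nat) \<Rightarrow>
     (nat \<Rightarrow> 'w \<Rightarrow> real vec) \<Rightarrow> bool" where
  "initial_model g \<Omega> data est0 \<longleftrightarrow>
     (\<forall>k < nagents g. \<forall>\<omega> \<in> space \<Omega>. est0 k \<omega> \<in> carrier_vec (2 * nfeats g)) \<and>
     (\<forall>k < nagents g. \<forall>j < 2 * nfeats g. integrable \<Omega> (\<lambda>\<omega>. est0 k \<omega> $ j)) \<and>
     prob_space.indep_set \<Omega>
       (sets (vimage_algebra (space \<Omega>)
         (\<lambda>\<omega>. \<lambda>(k, j) \<in> {..<nagents g} \<times> {..<2 * nfeats g}. est0 k \<omega> $ j)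
         (\<Pi>\<^sub>M kj \<in> {..<nagents g} \<times> {..<2 * nfeats g}. borel)))
       (sets (vimage_algebra (space \<Omega>)
         (\<lambda>\<omega>. \<lambda>(k, i) \<in> {..<nagents g} \<times> UNIV. data k i \<omega>)
         (\<Pi>\<^sub>M ki \<in> {..<nagents g} \<times> UNIV. count_space UNIV)))"

definition adapt_step ::
  "'a::finite gtd \<Rightarrow> real \<Rightarrow> nat \<Rightarrow> nat \<times> 'a \<times> nat \<Rightarrow> real vec \<Rightarrow> real vec" where
  "adapt_step g \<mu> k z \<alpha> = \<alpha> - \<mu> \<cdot>\<^sub>v (sample_G g k z *\<^sub>v \<alpha> + sample_g g k z)"

definition diffusion_gtd ::
  "'a::finite gtd \<Rightarrow> real \<Rightarrow> 'w measure \<Rightarrow> (nat \<Rightarrow> nat \<Rightarrow> 'w \<Rightarrow> nat \<times> 'a \<times> nat) \<Rightarrow>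
     (nat \<Rightarrow> nat \<Rightarrow> 'w \<Rightarrow> real vec) \<Rightarrow> bool" where
  "diffusion_gtd g \<mu> \<Omega> data est \<longleftrightarrow>
     data_model g \<Omega> data \<and>
     initial_model g \<Omega> data (\<lambda>k. est k 0) \<and>
     (\<forall>k < nagents g. \<forall>i. \<forall>\<omega> \<in> space \<Omega>. est k (Suc i) \<omega> =
        vec (2 * nfeats g) (\<lambda>j. \<Sum>l \<in> nbhd g k.
          comb g $$ (l, k) * adapt_step g \<mu> l (data l i \<omega>) (est l i \<omega>) $ j))"

definition network_error ::
  "'a::finite gtd \<Rightarrow> (nat \<Rightarrow> nat \<Rightarrow> 'w \<Rightarrow> real vec) \<Rightarrow> nat \<Rightarrow> 'w \<Rightarrow> real vec" where
  "network_error g est i \<omega> =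
     col_vec_stack (nagents g) (2 * nfeats g) (\<lambda>k. alpha_opt g - est k i \<omega>)"

definition mean_error ::
  "'a::finite gtd \<Rightarrow> 'w measure \<Rightarrow> (nat \<Rightarrow> nat \<Rightarrow> 'w \<Rightarrow> real vec) \<Rightarrow> nat \<Rightarrow> real vec" where
  "mean_error g \<Omega> est i = vec (big_dim g) (\<lambda>j. \<integral>\<omega>. network_error g est i \<omega> $ j \<partial>\<Omega>)"

end

theory Submission
  imports Defs
begin

text \<open>
  Conjugating \<open>(C\<^sup>T \<otimes> I) (I - \<mu> R)\<close> by the Jordan bases of \<open>C\<^sup>T\<close> and of the Perron average
  \<open>\<Sum>\<^sub>k p\<^sub>k G\<^sub>k\<close> splits it into a block \<open>I - \<mu> J\<close> for the network average, a block \<open>J\<^sub>0 \<otimes> I + O(\<mu>)\<close>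
  for the disagreement, and couplings of order \<open>\<mu>\<close>. After weighting the average by
  \<open>\<sigma> / sqrt \<mu>\<close> one compares absolute row sums as in the theorem of Gershgorin: since
  \<open>\<bar>1 - \<mu> \<lambda>\<bar> \<le> 1 - \<mu> Re \<lambda> + \<mu>\<^sup>2 \<bar>\<lambda>\<bar>\<^sup>2 / 2\<close>, the three families in the step-size bound are exactly what
  makes every absolute row sum less than \<open>1\<close>.

  If \<open>(u, v)\<close> is an eigenvector of the Perron average for \<open>\<lambda>\<close>, then the skew structure of its
  off-diagonal blocks gives \<open>Re \<lambda> (\<bar>u\<bar>\<^sup>2 + \<eta> \<bar>v\<bar>\<^sup>2) = \<eta> (X u)\<^sup>* D (X u)\<close>, which is positive.

  The mean recursion holds because the estimates at time \<open>i\<close> are uncorrelated with all events about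
  the data used from time \<open>i\<close> on, a property that the algorithm propagates.
\<close>


section \<open>Block matrices and diagonal dominance\<close>

text \<open>The average block of the conjugated matrix leaves its rows only order \<mu> of slack,
  and the coupling \<open>S12\<close> costs order \<mu> as well, so an unweighted row-sum test can
  fail however small \<mu> is. The weight \<sigma> / sqrt \<mu> lowers this coupling to order
  \<mu>^(3/2), relative to the row, and raises the opposite one to order sqrt \<mu>, which the fixed
  gap of the disagreement rows absorbs. This is the origin of the squares in the step-size bound:
  each family bounds sqrt \<mu>. The first sets aside sqrt \<mu> of the gap 1 - |\<lambda>| -
  \<beta>, the second makes both perturbations of a disagreement row fit into it, the third keeps
  sqrt \<mu> below the positive root of a quadratic. A further obstacle is that the saddle point
  uses the weights \<tau>, the averaged matrix the Perron weights p. Positivity of the mixed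
  visitation frequencies carries over from \<tau> to p; invertibility of \<open>key_mat\<close> at p
  enters as a premise where real parts are shown to be positive.\<close>

lemma kron_dim [simp]:
  "dim_row (A \<otimes>\<^sub>k B) = dim_row A * dim_row B" "dim_col (A \<otimes>\<^sub>k B) = dim_col A * dim_col B"
  by (auto simp: kron_def)

lemma kron_carrier [intro]:
  "A \<in> carrier_mat m n \<Longrightarrow> B \<in> carrier_mat p q \<Longrightarrow> A \<otimes>\<^sub>k B \<in> carrier_mat (m * p) (n * q)"
  by (auto simp: kron_def)

lemma block_index_less: "k < N \<Longrightarrow> j < n \<Longrightarrow> k * n + j < N * (n::nat)"
proof -
  assume "k < N" "j < n"
  then have "k * n + j < Suc k * n" by simp
  also have "\<dots> \<le> N * n" using \<open>k < N\<close> by (intro mult_le_mono1) simp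
  finally show ?thesis .
qed

lemma block_index_cases:
  assumes "q < N * (n::nat)"
  obtains k j where "k < N" "j < n" "q = k * n + j"
proof
  have "0 < n" using assms by (cases n) auto
  then show "q mod n < n" by simp
  show "q div n < N" using assms by (simp add: less_mult_imp_div_less)
  show "q = q div n * n + q mod n" by simp
qed

lemma block_index_eq_iff:
  assumes "i < n" "j < n"
  shows "k * n + i = l * n + (j::nat) \<longleftrightarrow> k = l \<and> i = j"
proof
  assume eq: "k * n + i = l * n + j"
  have "(k * n + i) div n = k" "(l * n + j) div n = l" using assms by simp_all
  with eq have "k = l" by simp
  with eq show "k = l \<and> i = j" by simp
qed simp

lemma sum_blocks: "(\<Sum>q<N * (n::nat). f q) = (\<Sum>k<N. \<Sum>j<n. f (k * n + j))"
  by (simp add: sum_mult_product add.commute)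

lemma index_kron_block:
  assumes "k < dim_row A" "i < dim_row B" "l < dim_col A" "j < dim_col B"
  shows "(A \<otimes>\<^sub>k B) $$ (k * dim_row B + i, l * dim_col B + j) = A $$ (k, l) * B $$ (i, j)"
  using assms by (simp add: kron_def block_index_less)

lemma index_kron_one:
  assumes "k < dim_row A" "i < n" "l < dim_col A" "j < n"
  shows "(A \<otimes>\<^sub>k 1\<^sub>m n) $$ (k * n + i, l * n + j) = (if i = j then A $$ (k, l) else (0::'a::semiring_1))"
  using index_kron_block[of k A i "1\<^sub>m n" l j] assms by auto

lemma kron_eqI:
  assumes "A \<in> carrier_mat (m * p) (n * q)" "B \<in> carrier_mat (m * p) (n * q)"
    and "\<And>k i l j. k < m \<Longrightarrow> i < p \<Longrightarrow> l < n \<Longrightarrow> j < q \<Longrightarrow>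
      A $$ (k * p + i, l * q + j) = B $$ (k * p + i, l * q + j)"
  shows "A = B"
proof (rule eq_matI)
  fix r c assume "r < dim_row B" "c < dim_col B"
  then show "A $$ (r, c) = B $$ (r, c)"
    using assms by (metis block_index_cases carrier_matD)
qed (use assms in auto)

text \<open>Mixed-product rule: splitting the flat inner index by \<open>sum_blocks\<close> turns
  the sum into a product of two independent sums.\<close>

lemma kron_mult:
  fixes A :: "'a::comm_semiring_1 mat"
  assumes A: "A \<in> carrier_mat m n" and C: "C \<in> carrier_mat n l"
    and B: "B \<in> carrier_mat p q" and D: "D \<in> carrier_mat q r"
  shows "(A \<otimes>\<^sub>k B) * (C \<otimes>\<^sub>k D) = (A * C) \<otimes>\<^sub>k (B * D)"
proof (rule kron_eqI[of _ m p l r])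
  show "(A \<otimes>\<^sub>k B) * (C \<otimes>\<^sub>k D) \<in> carrier_mat (m * p) (l * r)"
    using kron_carrier[OF A B] kron_carrier[OF C D] by (rule mult_carrier_mat)
  show "(A * C) \<otimes>\<^sub>k (B * D) \<in> carrier_mat (m * p) (l * r)"
    using A B C D by (intro mult_carrier_mat kron_carrier)
  fix k i k' j assume k: "k < m" "i < p" "k' < l" "j < r"
  note d = carrier_matD[OF A] carrier_matD[OF B] carrier_matD[OF C] carrier_matD[OF D]
  have AB: "(A \<otimes>\<^sub>k B) $$ (k * p + i, s * q + t) = A $$ (k, s) * B $$ (i, t)" if "s < n" "t < q" for s t
    using index_kron_block[of k A i B s t] k that by (simp add: d)
  have CD: "(C \<otimes>\<^sub>k D) $$ (s * q + t, k' * r + j) = C $$ (s, k') * D $$ (t, j)" if "s < n" "t < q" for s t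
    using index_kron_block[of s C t D k' j] k that by (simp add: d)
  have "((A \<otimes>\<^sub>k B) * (C \<otimes>\<^sub>k D)) $$ (k * p + i, k' * r + j) =
      (\<Sum>x<n * q. (A \<otimes>\<^sub>k B) $$ (k * p + i, x) * (C \<otimes>\<^sub>k D) $$ (x, k' * r + j))"
    using k by (simp add: scalar_prod_def d block_index_less atLeast0LessThan)
  also have "\<dots> = (\<Sum>s<n. \<Sum>t<q. (A $$ (k, s) * B $$ (i, t)) * (C $$ (s, k') * D $$ (t, j)))"
    unfolding sum_blocks by (intro sum.cong refl) (simp add: AB CD)
  also have "\<dots> = (A * C) $$ (k, k') * (B * D) $$ (i, j)"
    using k by (simp add: scalar_prod_def d atLeast0LessThan sum_product mult_ac)
  also have "\<dots> = ((A * C) \<otimes>\<^sub>k (B * D)) $$ (k * p + i, k' * r + j)"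
    using index_kron_block[of k "A * C" i "B * D" k' j] k by (simp add: d)
  finally show "((A \<otimes>\<^sub>k B) * (C \<otimes>\<^sub>k D)) $$ (k * p + i, k' * r + j) = \<dots>" .
qed

lemma kron_mult_one:
  fixes A :: "'a::comm_semiring_1 mat"
  assumes "A \<in> carrier_mat m n" "C \<in> carrier_mat n l"
  shows "(A \<otimes>\<^sub>k 1\<^sub>m p) * (C \<otimes>\<^sub>k 1\<^sub>m p) = (A * C) \<otimes>\<^sub>k 1\<^sub>m p"
  using kron_mult[OF assms, of "1\<^sub>m p" p p "1\<^sub>m p" p] by simp

lemma kron_add_one:
  fixes A :: "'a::comm_semiring_1 mat"
  assumes A: "A \<in> carrier_mat m n" and B: "B \<in> carrier_mat m n"
  shows "(A + B) \<otimes>\<^sub>k 1\<^sub>m p = A \<otimes>\<^sub>k 1\<^sub>m p + B \<otimes>\<^sub>k 1\<^sub>m p"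
proof (rule kron_eqI[of _ m p n p])
  fix k i l j assume k: "k < m" "i < p" "l < n" "j < p"
  note d = carrier_matD[OF A] carrier_matD[OF B]
  show "((A + B) \<otimes>\<^sub>k 1\<^sub>m p) $$ (k * p + i, l * p + j) = (A \<otimes>\<^sub>k 1\<^sub>m p + B \<otimes>\<^sub>k 1\<^sub>m p) $$ (k * p + i, l * p + j)"
    using k by (simp add: index_kron_one block_index_less d)
qed (use A B in auto)

lemma kron_one_one: "(1\<^sub>m m \<otimes>\<^sub>k 1\<^sub>m p :: 'a::semiring_1 mat) = 1\<^sub>m (m * p)"
proof (rule kron_eqI[of _ m p m p])
  fix k i l j assume k: "k < m" "i < p" "l < m" "j < p"
  have "k * p + i = l * p + j \<longleftrightarrow> k = l \<and> i = j"
    using k by (intro block_index_eq_iff)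
  then show "(1\<^sub>m m \<otimes>\<^sub>k 1\<^sub>m p) $$ (k * p + i, l * p + j) = (1\<^sub>m (m * p) :: 'a mat) $$ (k * p + i, l * p + j)"
    using k by (simp add: index_kron_one block_index_less)
qed auto

lemma kron_one_mult_vec:
  fixes A :: "'a::comm_semiring_1 mat"
  assumes A: "A \<in> carrier_mat m n" and v: "v \<in> carrier_vec (n * p)" and k: "k < m" "i < p"
  shows "((A \<otimes>\<^sub>k 1\<^sub>m p) *\<^sub>v v) $ (k * p + i) = (\<Sum>l<n. A $$ (k, l) * v $ (l * p + i))"
proof -
  note d = carrier_matD[OF A] carrier_vecD[OF v]
  have kp: "k * p + i < m * p" using k by (rule block_index_less)
  have "((A \<otimes>\<^sub>k 1\<^sub>m p) *\<^sub>v v) $ (k * p + i) = row (A \<otimes>\<^sub>k 1\<^sub>m p) (k * p + i) \<bullet> v"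
    using kp by (intro index_mult_mat_vec) (simp add: d)
  also have "\<dots> = (\<Sum>x<n * p. (A \<otimes>\<^sub>k 1\<^sub>m p) $$ (k * p + i, x) * v $ x)"
    unfolding scalar_prod_def using kp by (intro sum.cong) (auto simp: d)
  also have "\<dots> = (\<Sum>l<n. \<Sum>j<p. if i = j then A $$ (k, l) * v $ (l * p + j) else 0)"
    unfolding sum_blocks using k by (intro sum.cong refl) (simp add: index_kron_one d)
  also have "\<dots> = (\<Sum>l<n. A $$ (k, l) * v $ (l * p + i))"
    using k by (intro sum.cong refl) simp
  finally show ?thesis .
qed

section \<open>Block diagonal matrices and Jordan matrices\<close>

lemma diag_block_carrier:
  "(\<And>k. k < N \<Longrightarrow> F k \<in> carrier_mat n n) \<Longrightarrow> diag_block_mat (map F [0..<N]) \<in> carrier_mat (N * n) (N * n)"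
proof (induction N)
  case (Suc N)
  have D: "diag_block_mat (map F [0..<N]) \<in> carrier_mat (N * n) (N * n)" and F: "F N \<in> carrier_mat n n"
    using Suc by auto
  have "diag_block_mat (map F [0..<Suc N]) =
      four_block_mat (diag_block_mat (map F [0..<N])) (0\<^sub>m (N * n) n) (0\<^sub>m n (N * n)) (F N)"
    using carrier_matD[OF D] carrier_matD[OF F] by (simp add: diag_block_mat_last Let_def)
  moreover have "Suc N * n = N * n + n" by simp
  ultimately show ?case
    using four_block_carrier_mat[OF D F] by metis
qed auto

lemma index_diag_block:
  fixes F :: "nat \<Rightarrow> 'a::zero mat"
  assumes "\<And>k. k < N \<Longrightarrow> F k \<in> carrier_mat n n" and "k < N" "l < N" "i < n" "j < n"
  shows "diag_block_mat (map F [0..<N]) $$ (k * n + i, l * n + j) = (if k = l then F k $$ (i, j) else 0)"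
  using assms
proof (induction N)
  case (Suc N)
  let ?D = "diag_block_mat (map F [0..<N])"
  have D: "?D \<in> carrier_mat (N * n) (N * n)" using Suc.prems by (intro diag_block_carrier) auto
  have F: "F N \<in> carrier_mat n n" using Suc.prems by auto
  \<comment> \<open>Locates a flat index relative to the border \<open>N * n\<close>, which decides
    the quadrant of the four-block matrix.\<close>
  have *: "k' < Suc N \<Longrightarrow> i' < n \<Longrightarrow> (k' * n + i' < N * n \<longleftrightarrow> k' < N) \<and> k' * n + i' < N * n + n" for k' i'
    using block_index_less[of k' "Suc N" i' n] block_index_less[of k' N i' n]
    by (cases "k' = N") (auto simp: add.commute)
  have "diag_block_mat (map F [0..<Suc N]) = four_block_mat ?D (0\<^sub>m (N * n) n) (0\<^sub>m n (N * n)) (F N)"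
    using D F by (simp add: diag_block_mat_last Let_def)
  then have E: "diag_block_mat (map F [0..<Suc N]) $$ (k * n + i, l * n + j) =
      (if k * n + i < N * n
       then if l * n + j < N * n then ?D $$ (k * n + i, l * n + j) else 0
       else if l * n + j < N * n then 0 else F N $$ (k * n + i - N * n, l * n + j - N * n))"
    using carrier_matD[OF D] carrier_matD[OF F] *[OF Suc.prems(2,4)] *[OF Suc.prems(3,5)] by auto
  have IH: "k < N \<Longrightarrow> l < N \<Longrightarrow> ?D $$ (k * n + i, l * n + j) = (if k = l then F k $$ (i, j) else 0)"
    using Suc.prems by (intro Suc.IH) auto
  have kl: "k = N \<or> k < N" "l = N \<or> l < N" using Suc.prems by auto
  have k': "k * n + i < N * n \<longleftrightarrow> k < N" and l': "l * n + j < N * n \<longleftrightarrow> l < N"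
    using *[OF Suc.prems(2,4)] *[OF Suc.prems(3,5)] by blast+
  show ?case unfolding E k' l' using IH kl by auto
qed simp

lemma jordan_matrix_index_0:
  assumes "i < sum_list (map fst nas)" "j < sum_list (map fst nas)" "j \<noteq> i" "j \<noteq> Suc i"
  shows "jordan_matrix nas $$ (i, j) = 0"
  using assms
proof (induction nas arbitrary: i j)
  case (Cons na nas)
  obtain n a where na: "na = (n, a)" by force
  show ?case using Cons.prems
    by (auto simp: na jordan_matrix_Cons intro!: Cons.IH)
qed simp

lemma jordan_matrix_superdiag_le:
  assumes "Suc i < sum_list (map fst nas)"
  shows "cmod (jordan_matrix nas $$ (i, Suc i)) \<le> 1"
  using assms
proof (induction nas arbitrary: i)
  case (Cons na nas)
  obtain n a where na: "na = (n, a)" by force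
  show ?case using Cons.prems Cons.IH[of "i - n"]
    by (auto simp: na jordan_matrix_Cons Suc_diff_le)
qed simp

text \<open>The diagonal entries of an upper triangular matrix are the roots of its characteristic
  polynomial, so each is an eigenvalue wherever it stands inside a block.\<close>

lemma jordan_matrix_eigenvector:
  fixes nas :: "(nat \<times> complex) list"
  assumes "i < sum_list (map fst nas)"
  obtains y where "y \<in> carrier_vec (sum_list (map fst nas))" "y \<noteq> 0\<^sub>v (sum_list (map fst nas))"
    "jordan_matrix nas *\<^sub>v y = jordan_matrix nas $$ (i, i) \<cdot>\<^sub>v y"
proof -
  let ?A = "jordan_matrix nas" and ?n = "sum_list (map fst nas)"
  have A: "?A \<in> carrier_mat ?n ?n" by simp
  have "upper_triangular ?A"
    by (auto simp: jordan_matrix_upper_triangular intro!: upper_triangularI)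
  moreover have "?A $$ (i, i) \<in> set (diag_mat ?A)"
    using assms by (auto simp: diag_mat_def)
  ultimately have "poly (char_poly ?A) (?A $$ (i, i)) = 0"
    by (auto simp: char_poly_upper_triangular[OF A] poly_prod_list prod_list_zero_iff image_iff)
  then have "eigenvalue ?A (?A $$ (i, i))"
    using eigenvalue_root_char_poly[OF A] by simp
  then show ?thesis
    using that by (auto simp: eigenvalue_def eigenvector_def)
qed

lemma full_rank_kernel:
  fixes A :: "'a::field mat"
  assumes A: "A \<in> carrier_mat n nc" and r: "vec_space.rank n A = nc"
    and v: "v \<in> carrier_vec nc" "A *\<^sub>v v = 0\<^sub>v n"
  shows "v = 0\<^sub>v nc"
proof (rule ccontr)
  interpret vec_space "TYPE('a)" n .
  assume "v \<noteq> 0\<^sub>v nc"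
  \<comment> \<open>\<open>lin_depI\<close> reads dependence off the set of columns, so repetitions
    have to be excluded: they would leave fewer than \<open>nc\<close> vectors and hence a smaller
    rank.\<close>
  have "distinct (cols A)"
  proof (rule ccontr)
    assume nd: "\<not> distinct (cols A)"
    obtain S where S: "maximal S (\<lambda>T. T \<subseteq> set (cols A) \<and> lin_indpt T)"
      using maximal_exists[of "(\<lambda>T. T \<subseteq> set (cols A) \<and> lin_indpt T)" "card (set (cols A))" "{}"]
      by (meson List.finite_set card_mono empty_iff empty_subsetI finite_lin_indpt2 rev_finite_subset)
    then have "card S \<le> card (set (cols A))" by (simp add: card_mono maximal_def)
    moreover have "card (set (cols A)) < nc"
      using nd A by (metis card_distinct card_length carrier_matD(2) cols_length nat_less_le)
    ultimately show False using rank_card_indpt[OF A S] r by simp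
  qed
  from lin_depI[OF A v(1) \<open>v \<noteq> 0\<^sub>v nc\<close> v(2) this] full_rank_lin_indpt[OF A r this]
  show False by simp
qed

text \<open>Gershgorin in scaled form: at an index where cmod (x i) / w i is maximal, the eigenvalue
  equation bounds cmod z times cmod (x i) by that maximum times the weighted row sum.\<close>

lemma weighted_diag_dominant:
  fixes x :: "'i \<Rightarrow> complex" and A :: "'i \<Rightarrow> 'i \<Rightarrow> complex"
  assumes I: "finite I" and x: "\<exists>i\<in>I. x i \<noteq> 0"
    and w: "\<And>i. i \<in> I \<Longrightarrow> 0 < w i"
    and eq: "\<And>i. i \<in> I \<Longrightarrow> z * x i = (\<Sum>j\<in>I. A i j * x j)"
    and dom: "\<And>i. i \<in> I \<Longrightarrow> (\<Sum>j\<in>I. cmod (A i j) * w j) < w i"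
  shows "cmod z < 1"
proof -
  have "I \<noteq> {}" using x by auto
  define B where "B = Max ((\<lambda>i. cmod (x i) / w i) ` I)"
  have B: "cmod (x i) \<le> B * w i" if "i \<in> I" for i
  proof -
    have "cmod (x i) / w i \<le> B" unfolding B_def using I that by auto
    then show ?thesis using w[OF that] by (simp add: pos_divide_le_eq)
  qed
  obtain i where i: "i \<in> I" "B = cmod (x i) / w i"
  proof -
    have "B \<in> (\<lambda>i. cmod (x i) / w i) ` I"
      unfolding B_def using I \<open>I \<noteq> {}\<close> by (intro Max_in) auto
    then show ?thesis using that by auto
  qed
  have "0 < B"
  proof -
    obtain j where j: "j \<in> I" "x j \<noteq> 0" using x by auto
    then have "0 < B * w j" using B[OF j(1)] by (metis order_less_le_trans zero_less_norm_iff)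
    then show ?thesis using w[OF j(1)] by (simp add: zero_less_mult_iff)
  qed
  have "cmod z * cmod (x i) = cmod (\<Sum>j\<in>I. A i j * x j)"
    using eq[OF i(1)] by (metis norm_mult)
  also have "\<dots> \<le> (\<Sum>j\<in>I. cmod (A i j) * (B * w j))"
    by (intro sum_norm_le) (auto simp: norm_mult intro!: mult_left_mono B)
  also have "\<dots> = B * (\<Sum>j\<in>I. cmod (A i j) * w j)"
    by (simp add: sum_distrib_left mult_ac)
  also have "\<dots> < B * w i" using dom[OF i(1)] \<open>0 < B\<close> by simp
  also have "\<dots> = cmod (x i)" using i w[OF i(1)] by simp
  finally show ?thesis
    by (metis mult.left_neutral mult_right_less_imp_less norm_ge_zero)
qed

text \<open>Two index ranges, coded as a disjoint sum, with the constant weights s and 1. Since s is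
  free, it may later depend on the step size.\<close>

lemma block_diag_dominant:
  fixes a b :: "nat \<Rightarrow> complex"
  assumes nz: "(\<exists>i<n. a i \<noteq> 0) \<or> (\<exists>j<m. b j \<noteq> 0)" and s: "0 < s"
    and a: "\<And>i. i < n \<Longrightarrow> z * a i = (\<Sum>j<n. A i j * a j) + (\<Sum>j<m. B i j * b j)"
    and b: "\<And>i. i < m \<Longrightarrow> z * b i = (\<Sum>j<n. C i j * a j) + (\<Sum>j<m. D i j * b j)"
    and ra: "\<And>i. i < n \<Longrightarrow> s * (\<Sum>j<n. cmod (A i j)) + (\<Sum>j<m. cmod (B i j)) < s"
    and rb: "\<And>i. i < m \<Longrightarrow> s * (\<Sum>j<n. cmod (C i j)) + (\<Sum>j<m. cmod (D i j)) < 1"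
  shows "cmod z < 1"
proof -
  define I :: "(nat + nat) set" where "I = {..<n} <+> {..<m}"
  define x where "x = case_sum a b"
  define w where "w = case_sum (\<lambda>_::nat. s) (\<lambda>_::nat. 1)"
  define M where "M = case_sum (\<lambda>i. case_sum (A i) (B i)) (\<lambda>i. case_sum (C i) (D i))"
  have sum_I: "(\<Sum>j\<in>I. f j) = (\<Sum>j<n. f (Inl j)) + (\<Sum>j<m. f (Inr j))" for f :: "_ \<Rightarrow> 'x::comm_monoid_add"
    unfolding I_def by (subst sum.Plus) (simp_all add: comp_def)
  show ?thesis
  proof (rule weighted_diag_dominant[of I x w z M])
    show "\<exists>i\<in>I. x i \<noteq> 0" using nz by (force simp: I_def x_def)
    fix i assume i: "i \<in> I"
    show "0 < w i" using s by (cases i) (auto simp: w_def)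
    show "z * x i = (\<Sum>j\<in>I. M i j * x j)"
      using i a b unfolding sum_I by (cases i) (auto simp: x_def M_def I_def)
    show "(\<Sum>j\<in>I. cmod (M i j) * w j) < w i"
      using i ra rb unfolding sum_I by (cases i) (auto simp: w_def M_def I_def sum_distrib_left mult.commute)
  qed (simp add: I_def)
qed

section \<open>Decay of matrix powers\<close>

lemma smult_mat_mult_vec:
  fixes A :: "'a::comm_semiring_1 mat"
  assumes "A \<in> carrier_mat m n" "v \<in> carrier_vec n"
  shows "(c \<cdot>\<^sub>m A) *\<^sub>v v = c \<cdot>\<^sub>v (A *\<^sub>v v)"
  using assms by (intro eq_vecI) (auto simp: scalar_prod_def sum_distrib_left mult.assoc)

lemma one_smult_mat: "(1::'a::comm_semiring_1) \<cdot>\<^sub>m A = A"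
  by (intro eq_matI) simp_all

lemma pow_smult_mat:
  fixes A :: "'a::comm_semiring_1 mat"
  assumes A: "A \<in> carrier_mat n n"
  shows "(c \<cdot>\<^sub>m A) ^\<^sub>m k = c ^ k \<cdot>\<^sub>m A ^\<^sub>m k"
proof (induction k)
  case (Suc k)
  have Ak: "A ^\<^sub>m k \<in> carrier_mat n n" using A by simp
  have "(c \<cdot>\<^sub>m A) ^\<^sub>m Suc k = (c ^ k \<cdot>\<^sub>m A ^\<^sub>m k) * (c \<cdot>\<^sub>m A)" using Suc by simp
  also have "\<dots> = c ^ k \<cdot>\<^sub>m (A ^\<^sub>m k * (c \<cdot>\<^sub>m A))"
    using mult_smult_assoc_mat[OF Ak, of "c \<cdot>\<^sub>m A" n] A by simp
  also have "\<dots> = c ^ k \<cdot>\<^sub>m (c \<cdot>\<^sub>m A ^\<^sub>m Suc k)"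
    using mult_smult_distrib[OF Ak A] by simp
  also have "\<dots> = c ^ Suc k \<cdot>\<^sub>m A ^\<^sub>m Suc k"
    by (intro eq_matI) (auto simp: mult_ac)
  finally show ?case .
qed (simp add: one_smult_mat)

text \<open>Divide by some r strictly between the spectral radius and 1: the scaled matrix still has
  spectral radius below 1, hence bounded powers, and the factor r^k that was split off gives the
  decay.\<close>

lemma spectral_radius_less_1_pow_tendsto_0:
  fixes A :: "complex mat"
  assumes A: "A \<in> carrier_mat n n" and n: "0 < n" and sr: "spectral_radius A < 1"
    and ij: "i < n" "j < n"
  shows "(\<lambda>k. (A ^\<^sub>m k) $$ (i, j)) \<longlonglongrightarrow> 0"
proof -
  have "0 \<le> spectral_radius A" using spectral_radius_mem_max(1)[OF A n] by (metis imageE norm_ge_zero)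
  then obtain r where r: "spectral_radius A < r" "r < 1" "0 < r"
    using sr that[of "(1 + spectral_radius A) / 2"] by simp
  define B where "B = complex_of_real (1 / r) \<cdot>\<^sub>m A"
  have B: "B \<in> carrier_mat n n" using A by (simp add: B_def)
  have AB: "A = complex_of_real r \<cdot>\<^sub>m B" using r A by (intro eq_matI) (auto simp: B_def)
  have "cmod z < 1" if z: "eigenvalue B z" for z
  proof -
    obtain v where v: "v \<in> carrier_vec n" "v \<noteq> 0\<^sub>v n" "B *\<^sub>v v = z \<cdot>\<^sub>v v"
      using z B by (auto simp: eigenvalue_def eigenvector_def)
    have "A *\<^sub>v v = (complex_of_real r * z) \<cdot>\<^sub>v v"
      unfolding AB using smult_mat_mult_vec[OF B v(1)] v by (simp add: smult_smult_assoc)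
    then have "eigenvalue A (complex_of_real r * z)"
      using A v unfolding eigenvalue_def eigenvector_def by auto
    then have "cmod (complex_of_real r * z) \<le> spectral_radius A"
      by (intro spectral_radius_mem_max(2)[OF A n]) (auto simp: spectrum_def)
    then have "r * cmod z \<le> spectral_radius A" using r(3) by (simp add: norm_mult)
    also have "\<dots> < r * 1" using r(1) by simp
    finally show ?thesis using r(3) by (simp only: mult_less_cancel_left_pos)
  qed
  then have "spectral_radius B < 1"
    using spectral_radius_mem_max(1)[OF B n] by (metis imageE spectrum_def mem_Collect_eq)
  from spectral_radius_jnf_norm_bound_less_1_upper_triangular[OF B this]
  obtain c where c: "\<And>k. norm_bound (B ^\<^sub>m k) c" by auto
  have Ak: "A ^\<^sub>m k = complex_of_real r ^ k \<cdot>\<^sub>m B ^\<^sub>m k" for k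
    unfolding AB using pow_smult_mat[OF B] by simp
  have bd: "cmod ((A ^\<^sub>m k) $$ (i, j)) \<le> c * r ^ k" for k
  proof -
    have "cmod ((B ^\<^sub>m k) $$ (i, j)) \<le> c"
      using c[of k] ij B unfolding norm_bound_def by (simp add: pow_mat_dim_square[OF B])
    then show ?thesis unfolding Ak using ij B r
      by (simp add: pow_mat_dim_square[OF B] norm_mult norm_power mult.commute)
  qed
  have lim: "(\<lambda>k. c * r ^ k) \<longlonglongrightarrow> 0"
    using r by (intro tendsto_mult_right_zero LIMSEQ_realpow_zero) auto
  show ?thesis by (rule Lim_null_comparison[OF always_eventually lim]) (intro allI bd)
qed


section \<open>The averaged matrix\<close>

lemma sum_double: "(\<Sum>j<2 * m. f j) = (\<Sum>j<m. f j) + (\<Sum>j<m. f (m + (j::nat)))"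
  using sum_blocks[of f 2 m] by (simp add: numeral_2_eq_2)

lemma index_trans_diag_mult:
  fixes X :: "'a::comm_semiring_1 mat"
  assumes X: "X \<in> carrier_mat S m" and Y: "Y \<in> carrier_mat S n" and "i < m" "j < n"
  shows "(X\<^sup>T * mat_diag S f * Y) $$ (i, j) = (\<Sum>s<S. X $$ (s, i) * f s * Y $$ (s, j))"
proof -
  have "X\<^sup>T * mat_diag S f = mat m S (\<lambda>(i, s). X $$ (s, i) * f s)"
    using mat_diag_mult_right[of "X\<^sup>T" m S f] X by (intro eq_matI) auto
  then show ?thesis
    using assms by (simp add: scalar_prod_def atLeast0LessThan)
qed

text \<open>Real and imaginary parts of a complex kernel vector are real kernel vectors. This makes
  the kernel facts about the real matrices \<open>feat\<close> and \<open>key_mat\<close> available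
  for complex eigenvectors.\<close>

lemma real_kernel_complex:
  fixes A :: "real mat" and u :: "nat \<Rightarrow> complex"
  assumes A: "A \<in> carrier_mat m n"
    and ker: "\<And>v. v \<in> carrier_vec n \<Longrightarrow> A *\<^sub>v v = 0\<^sub>v m \<Longrightarrow> v = 0\<^sub>v n"
    and u: "\<And>i. i < m \<Longrightarrow> (\<Sum>j<n. complex_of_real (A $$ (i, j)) * u j) = 0" and j: "j < n"
  shows "u j = 0"
proof -
  have *: "h (u j) = 0" if h: "h = Re \<or> h = Im" for h
  proof -
    have "A *\<^sub>v vec n (\<lambda>j. h (u j)) = 0\<^sub>v m"
    proof (rule eq_vecI)
      fix i assume "i < dim_vec (0\<^sub>v m :: real vec)"
      then have "i < m" by simp
      from arg_cong[OF u[OF this], of h] this show "(A *\<^sub>v vec n (\<lambda>j. h (u j))) $ i = 0\<^sub>v m $ i"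
        using A h by (auto simp: scalar_prod_def atLeast0LessThan)
    qed (use A in simp)
    from arg_cong[OF ker[OF _ this], of "\<lambda>v. v $ j"] j show ?thesis by simp
  qed
  show ?thesis using *[of Re] *[of Im] by (simp add: complex_eq_iff)
qed

section \<open>Invertible matrices and the value of \<open>mat_inv\<close>\<close>

lemma invertible_mat_obtain_inverse:
  fixes A :: "'a::field mat"
  assumes A: "A \<in> carrier_mat n n" and inv: "invertible_mat A"
  obtains B where "B \<in> carrier_mat n n" "A * B = 1\<^sub>m n" "B * A = 1\<^sub>m n"
proof -
  obtain B where B: "A * B = 1\<^sub>m n" "B * A = 1\<^sub>m (dim_row B)"
    using A inv by (auto simp: invertible_mat_def inverts_mat_def)
  have "dim_row B = n"
    using B A by (metis carrier_matD(2) index_mult_mat(3) index_one_mat(3))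
  moreover have "dim_col B = n"
    using B(1) by (metis index_mult_mat(3) index_one_mat(3))
  ultimately show ?thesis using B that[of B] by auto
qed

lemma invertible_mat_kernel:
  fixes A :: "'a::field mat"
  assumes A: "A \<in> carrier_mat n n" and inv: "invertible_mat A"
    and v: "v \<in> carrier_vec n" "A *\<^sub>v v = 0\<^sub>v n"
  shows "v = 0\<^sub>v n"
proof -
  obtain B where B: "B \<in> carrier_mat n n" "B * A = 1\<^sub>m n"
    using invertible_mat_obtain_inverse[OF A inv] by metis
  have "v = B *\<^sub>v (A *\<^sub>v v)" using assoc_mult_mat_vec[OF B(1) A v(1)] B v by simp
  also have "\<dots> = 0\<^sub>v n" using B(1) unfolding v(2) by (intro eq_vecI) auto
  finally show ?thesis .
qed

lemma mat_inv_invertible: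
  fixes A :: "'a::field mat"
  assumes A: "A \<in> carrier_mat n n" and inv: "invertible_mat A"
  shows "mat_inv A \<in> carrier_mat n n" "A * mat_inv A = 1\<^sub>m n" "mat_inv A * A = 1\<^sub>m n"
proof -
  obtain B where "B \<in> carrier_mat n n" "A * B = 1\<^sub>m n" "B * A = 1\<^sub>m n"
    using invertible_mat_obtain_inverse[OF A inv] by metis
  then have "A \<in> Units (ring_mat TYPE('a) n ())"
    using A by (auto simp: Units_def ring_mat_def)
  then obtain D where D: "mat_inverse A = Some D"
    using mat_inverse(1)[OF A, where b = "()"] by (cases "mat_inverse A") auto
  show "mat_inv A \<in> carrier_mat n n" "A * mat_inv A = 1\<^sub>m n" "mat_inv A * A = 1\<^sub>m n"
    using mat_inverse(2)[OF A D] by (auto simp: D mat_inv_def)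
qed

text \<open>Row s is x_s minus \<gamma> times the expected next feature under the target policy,
  that is, the mean of \<delta> from state s. Both off-diagonal blocks of \<open>mean_G\<close> are
  built from it.\<close>

definition feat_diff :: "'a::finite gtd \<Rightarrow> real mat" where
  "feat_diff g = bellman_mat g * feat g"

text \<open>The diagonal of \<open>mix_visit_mat\<close>, with the weights left open because both
  \<tau> and the Perron vector are inserted.\<close>

definition mix_visit :: "'a gtd \<Rightarrow> real vec \<Rightarrow> nat \<Rightarrow> real" where
  "mix_visit g q s = (\<Sum>k<nagents g. q $ k * visit g k $ s)"

section \<open>Entries of the mean matrices and the spectrum of their average\<close>

locale gtd_jordan =
  fixes g :: "'a::finite gtd" and J :: jordan_data
  assumes gtd: "gtd_setting g" and jordan: "jordan_setting g J"
begin

abbreviation "X \<equiv> feat g"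
abbreviation "Z \<equiv> feat_diff g"
abbreviation "S \<equiv> nstates g"
abbreviation "M \<equiv> nfeats g"
abbreviation "N \<equiv> nagents g"
abbreviation "p \<equiv> perron J"

lemma pos: "0 < S" "0 < M" "0 < N" "0 < eta g" "0 < discount g"
  using gtd by (simp_all add: gtd_setting_def mdp_setting_def agents_setting_def global_setting_def)

lemma X_carrier [simp, intro]: "X \<in> carrier_mat S M"
  by (rule setting_carriers[OF gtd])

lemma bellman_carrier [simp, intro]: "bellman_mat g \<in> carrier_mat S S"
  by (rule setting_carriers[OF gtd])

lemma Z_carrier [simp, intro]: "Z \<in> carrier_mat S M"
  unfolding feat_diff_def by (rule mult_carrier_mat[OF bellman_carrier X_carrier])

lemmas XZ_dims [simp] = carrier_matD[OF X_carrier] carrier_matD[OF Z_carrier]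

lemma index_Z:
  assumes "s < S" "j < M"
  shows "Z $$ (s, j) = X $$ (s, j) - discount g * (\<Sum>s'<S. chain_mat g (target g) $$ (s, s') * X $$ (s', j))"
proof -
  have "Z $$ (s, j) = (\<Sum>s'<S. ((if s = s' then 1 else 0) - discount g * chain_mat g (target g) $$ (s, s')) * X $$ (s', j))"
    using assms carrier_matD[OF bellman_carrier]
    by (simp add: feat_diff_def scalar_prod_def atLeast0LessThan)
      (auto simp: bellman_mat_def chain_mat_def intro!: sum.cong)
  also have "\<dots> = (\<Sum>s'<S. (if s = s' then X $$ (s', j) else 0) - discount g * (chain_mat g (target g) $$ (s, s') * X $$ (s', j)))"
    by (intro sum.cong) (auto simp: algebra_simps)
  finally show ?thesis using assms by (simp add: sum_subtractf sum_distrib_left)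
qed

lemma index_key_mat:
  assumes "i < M" "j < M"
  shows "key_mat g q $$ (i, j) = (\<Sum>s<S. X $$ (s, i) * mix_visit g q s * Z $$ (s, j))"
proof -
  have "key_mat g q = X\<^sup>T * mix_visit_mat g q * Z"
    unfolding key_mat_def feat_diff_def mix_visit_mat_def
    by (rule assoc_mult_mat[of _ M S _ S _ M]) (auto intro!: mult_carrier_mat[of _ M S])
  then show ?thesis
    using index_trans_diag_mult[OF X_carrier Z_carrier assms] by (simp add: mix_visit_mat_def mix_visit_def)
qed

text \<open>In terms of \<open>Z\<close> the off-diagonal blocks are \<eta> X^T D Z and the negative
  transpose of X^T D Z, the skew structure behind the positive real parts.\<close>

lemma mean_G_blocks:
  "mean_G g k = four_block_mat
     (eta g \<cdot>\<^sub>m (X\<^sup>T * visit_mat g k * X)) (eta g \<cdot>\<^sub>m (X\<^sup>T * visit_mat g k * Z))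
     (- (Z\<^sup>T * visit_mat g k * X)) (0\<^sub>m M M)"
proof -
  have "X\<^sup>T * visit_mat g k * bellman_mat g * X = X\<^sup>T * visit_mat g k * Z"
    unfolding feat_diff_def visit_mat_def
    by (rule assoc_mult_mat[of _ M S _ S _ M]) (auto intro!: mult_carrier_mat[of _ M S])
  moreover have "X\<^sup>T * (bellman_mat g)\<^sup>T = Z\<^sup>T"
    unfolding feat_diff_def by (rule transpose_mult[symmetric, OF bellman_carrier X_carrier])
  ultimately show ?thesis by (simp add: mean_G_def)
qed

lemma visit_mat_carrier [simp, intro]: "visit_mat g k \<in> carrier_mat S S"
  by (simp add: visit_mat_def)

lemma mean_G_carrier [simp, intro]: "mean_G g k \<in> carrier_mat (2 * M) (2 * M)"
proof -
  have "eta g \<cdot>\<^sub>m (X\<^sup>T * visit_mat g k * X) \<in> carrier_mat M M"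
    by (auto intro!: mult_carrier_mat[of _ M S])
  from four_block_carrier_mat[OF this, of "0\<^sub>m M M"] show ?thesis
    unfolding mean_G_blocks by (simp add: mult_2)
qed

lemma index_mean_G:
  assumes "i < M" "j < M"
  shows "mean_G g k $$ (i, j) = eta g * (\<Sum>s<S. X $$ (s, i) * visit g k $ s * X $$ (s, j))"
    and "mean_G g k $$ (i, M + j) = eta g * (\<Sum>s<S. X $$ (s, i) * visit g k $ s * Z $$ (s, j))"
    and "mean_G g k $$ (M + i, j) = - (\<Sum>s<S. Z $$ (s, i) * visit g k $ s * X $$ (s, j))"
    and "mean_G g k $$ (M + i, M + j) = 0"
proof -
  have c: "X\<^sup>T * visit_mat g k * X \<in> carrier_mat M M" "X\<^sup>T * visit_mat g k * Z \<in> carrier_mat M M"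
    "Z\<^sup>T * visit_mat g k * X \<in> carrier_mat M M"
    by (auto intro!: mult_carrier_mat[of _ M S])
  note d = carrier_matD[OF c(1)] carrier_matD[OF c(2)] carrier_matD[OF c(3)]
  show "mean_G g k $$ (i, j) = eta g * (\<Sum>s<S. X $$ (s, i) * visit g k $ s * X $$ (s, j))"
    unfolding mean_G_blocks using assms index_trans_diag_mult[OF X_carrier X_carrier assms]
    by (simp add: d del: index_mult_mat) (simp add: visit_mat_def)
  show "mean_G g k $$ (i, M + j) = eta g * (\<Sum>s<S. X $$ (s, i) * visit g k $ s * Z $$ (s, j))"
    unfolding mean_G_blocks using assms index_trans_diag_mult[OF X_carrier Z_carrier assms]
    by (simp add: d del: index_mult_mat) (simp add: visit_mat_def)
  show "mean_G g k $$ (M + i, j) = - (\<Sum>s<S. Z $$ (s, i) * visit g k $ s * X $$ (s, j))"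
    unfolding mean_G_blocks using assms index_trans_diag_mult[OF Z_carrier X_carrier assms]
    by (simp add: d del: index_mult_mat) (simp add: visit_mat_def)
  show "mean_G g k $$ (M + i, M + j) = 0"
    unfolding mean_G_blocks using assms by (simp add: d del: index_mult_mat)
qed

lemma mix_visit_sum:
  "(\<Sum>k<N. q $ k * (\<Sum>s<S. f s * visit g k $ s * h s)) = (\<Sum>s<S. f s * mix_visit g q s * h s)"
  unfolding mix_visit_def sum_distrib_left sum_distrib_right
  by (subst sum.swap) (simp add: mult_ac)

lemma G_bar_carrier [simp, intro]: "G_bar g J \<in> carrier_mat (2 * M) (2 * M)"
  by (simp add: G_bar_def)

lemma index_G_bar:
  assumes "i < M" "j < M"
  shows "G_bar g J $$ (i, j) = eta g * (\<Sum>s<S. X $$ (s, i) * mix_visit g p s * X $$ (s, j))"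
    and "G_bar g J $$ (i, M + j) = eta g * (\<Sum>s<S. X $$ (s, i) * mix_visit g p s * Z $$ (s, j))"
    and "G_bar g J $$ (M + i, j) = - (\<Sum>s<S. Z $$ (s, i) * mix_visit g p s * X $$ (s, j))"
    and "G_bar g J $$ (M + i, M + j) = 0"
  unfolding mix_visit_sum[symmetric] using assms
  by (simp_all add: G_bar_def index_mean_G sum_distrib_left mult_ac sum_negf)

lemma p_pos: "k < N \<Longrightarrow> 0 < p $ k" and p_sum: "(\<Sum>k<N. p $ k) = 1" and p_carrier: "p \<in> carrier_vec N"
  using jordan by (auto simp: jordan_setting_def)

lemma weight_pos_def: "pos_def (mix_visit_mat g (weight g))"
  using gtd by (simp add: gtd_setting_def global_setting_def)

lemma visit_nonneg: "k < N \<Longrightarrow> s < S \<Longrightarrow> 0 \<le> visit g k $ s"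
  using gtd by (simp add: gtd_setting_def agents_setting_def)

lemma rank_X: "vec_space.rank S X = M"
  using gtd by (simp add: gtd_setting_def mdp_setting_def)

text \<open>Positive definiteness of the \<tau>-mixture, tested on a unit vector, shows that some
  agent visits s. All entries of p are positive, so the same agent contributes to the
  p-mixture.\<close>

lemma mix_visit_pos:
  assumes s: "s < S"
  shows "0 < mix_visit g p s"
proof -
  let ?D = "mix_visit_mat g (weight g)"
  have D: "?D *\<^sub>v unit_vec S s = mix_visit g (weight g) s \<cdot>\<^sub>v unit_vec S s"
    using s by (intro eq_vecI) (auto simp: mix_visit_mat_def mix_visit_def mat_diag_def)
  have "0 < unit_vec S s \<bullet> (?D *\<^sub>v unit_vec S s)"
  proof -
    have "unit_vec S s \<noteq> (0\<^sub>v S :: real vec)"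
      using arg_cong[of "unit_vec S s" "0\<^sub>v S :: real vec" "\<lambda>v. v $ s"] s by auto
    moreover have "dim_row ?D = S" by (simp add: mix_visit_mat_def mat_diag_def)
    ultimately show ?thesis using weight_pos_def by (simp add: pos_def_def)
  qed
  then have "0 < mix_visit g (weight g) s" using s by (simp add: D)
  then have "(\<Sum>k<N. weight g $ k * visit g k $ s) \<noteq> 0" by (simp add: mix_visit_def)
  then obtain k where "k \<in> {..<N}" and kw: "weight g $ k * visit g k $ s \<noteq> 0"
    by (rule sum.not_neutral_contains_not_neutral)
  then have k: "k < N" "weight g $ k * visit g k $ s \<noteq> 0" by simp_all
  have nn: "0 \<le> visit g l $ s" if "l < N" for l using visit_nonneg s that by simp
  have "0 < p $ k * visit g k $ s"
    using p_pos[OF k(1)] k nn[OF k(1)] by (simp add: order_less_le)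
  then show ?thesis unfolding mix_visit_def
    using k nn p_pos by (intro sum_pos2[of _ k]) (auto intro!: mult_nonneg_nonneg less_imp_le[OF p_pos])
qed

text \<open>The identity for Re z gives a strict sign only if X u does not vanish. Otherwise full
  rank forces u = 0, the first block row reduces to X^T D Z v = 0, and invertibility of
  \<open>key_mat\<close> at p forces v = 0, so there would be no eigenvector.\<close>

lemma G_bar_eigenvalue_Re_pos:
  assumes inv: "invertible_mat (key_mat g p)" and ev: "eigenvalue (cmat (G_bar g J)) z"
  shows "0 < Re z"
proof -
  obtain w where w: "w \<in> carrier_vec (2 * M)" "w \<noteq> 0\<^sub>v (2 * M)" "cmat (G_bar g J) *\<^sub>v w = z \<cdot>\<^sub>v w"
    using ev by (auto simp: eigenvalue_def eigenvector_def G_bar_def)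
  define u v where "u i = w $ i" and "v i = w $ (M + i)" for i
  define D where "D s = complex_of_real (mix_visit g p s)" for s
  define x where "x s = (\<Sum>j<M. complex_of_real (X $$ (s, j)) * u j)" for s
  define y where "y s = (\<Sum>j<M. complex_of_real (Z $$ (s, j)) * v j)" for s
  let ?e = "complex_of_real (eta g)"
  have row: "z * w $ i = (\<Sum>j<M. complex_of_real (G_bar g J $$ (i, j)) * u j)
      + (\<Sum>j<M. complex_of_real (G_bar g J $$ (i, M + j)) * v j)" if "i < 2 * M" for i
  proof -
    have "z * w $ i = (cmat (G_bar g J) *\<^sub>v w) $ i" using w that by simp
    also have "\<dots> = (\<Sum>j<2 * M. complex_of_real (G_bar g J $$ (i, j)) * w $ j)"
      using w(1) that by (auto simp: G_bar_def scalar_prod_def atLeast0LessThan intro!: sum.cong)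
    finally show ?thesis by (simp add: sum_double u_def v_def)
  qed
  have row1: "z * u i = ?e * (\<Sum>s<S. complex_of_real (X $$ (s, i)) * D s * (x s + y s))" if i: "i < M" for i
  proof -
    have "z * u i = (\<Sum>j<M. \<Sum>s<S. ?e * complex_of_real (X $$ (s, i)) * D s * (complex_of_real (X $$ (s, j)) * u j))
        + (\<Sum>j<M. \<Sum>s<S. ?e * complex_of_real (X $$ (s, i)) * D s * (complex_of_real (Z $$ (s, j)) * v j))"
      using row[of i] i by (simp add: u_def index_G_bar sum_distrib_left sum_distrib_right D_def mult_ac)
    also have "\<dots> = (\<Sum>s<S. ?e * complex_of_real (X $$ (s, i)) * D s * x s) + (\<Sum>s<S. ?e * complex_of_real (X $$ (s, i)) * D s * y s)"
      unfolding x_def y_def by (subst (1 2) sum.swap) (simp add: sum_distrib_left)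
    finally show ?thesis by (simp add: sum_distrib_left algebra_simps sum.distrib)
  qed
  have row2: "z * v i = - (\<Sum>s<S. complex_of_real (Z $$ (s, i)) * D s * x s)" if i: "i < M" for i
  proof -
    have "z * v i = - (\<Sum>j<M. \<Sum>s<S. complex_of_real (Z $$ (s, i)) * D s * (complex_of_real (X $$ (s, j)) * u j))"
      using row[of "M + i"] i
      by (simp add: v_def index_G_bar sum_distrib_left sum_distrib_right D_def mult_ac sum_negf)
    then show ?thesis unfolding x_def by (subst (asm) sum.swap) (simp add: sum_distrib_left)
  qed
  \<comment> \<open>U and V are the squared norms of the two halves, Q is the visitation-weighted
    squared norm of X u, and T is the cross term of X u and Z v.\<close>
  define U V where "U = (\<Sum>i<M. (cmod (u i))\<^sup>2)" and "V = (\<Sum>i<M. (cmod (v i))\<^sup>2)"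
  define Q where "Q = (\<Sum>s<S. mix_visit g p s * (cmod (x s))\<^sup>2)"
  define T where "T = (\<Sum>s<S. cnj (x s) * D s * y s)"
  have cx: "cnj (x s) = (\<Sum>j<M. complex_of_real (X $$ (s, j)) * cnj (u j))"
    and cy: "cnj (y s) = (\<Sum>j<M. complex_of_real (Z $$ (s, j)) * cnj (v j))" for s
    by (simp_all add: x_def y_def)
  have cn: "(complex_of_real (cmod c))\<^sup>2 = cnj c * c" for c
    by (metis complex_norm_square mult.commute of_real_power)
  have 1: "z * of_real U = ?e * (of_real Q + T)"
  proof -
    have "z * of_real U = (\<Sum>i<M. cnj (u i) * (z * u i))"
      unfolding U_def by (simp add: sum_distrib_left cn mult_ac)
    also have "\<dots> = (\<Sum>i<M. \<Sum>s<S. ?e * (complex_of_real (X $$ (s, i)) * cnj (u i)) * D s * (x s + y s))"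
      by (intro sum.cong refl) (simp add: row1 sum_distrib_left mult_ac)
    also have "\<dots> = (\<Sum>s<S. ?e * cnj (x s) * D s * (x s + y s))"
      unfolding cx by (subst sum.swap) (simp add: sum_distrib_left sum_distrib_right)
    also have "\<dots> = ?e * (of_real Q + T)"
      unfolding Q_def T_def D_def
      by (simp add: sum_distrib_left cn algebra_simps sum.distrib)
    finally show ?thesis .
  qed
  have 2: "z * of_real V = - cnj T"
  proof -
    have "z * of_real V = (\<Sum>i<M. cnj (v i) * (z * v i))"
      unfolding V_def by (simp add: sum_distrib_left cn mult_ac)
    also have "\<dots> = - (\<Sum>i<M. \<Sum>s<S. (complex_of_real (Z $$ (s, i)) * cnj (v i)) * D s * x s)"
      unfolding sum_negf[symmetric] by (intro sum.cong refl) (simp add: row2 sum_distrib_left mult_ac sum_negf)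
    also have "\<dots> = - (\<Sum>s<S. cnj (y s) * D s * x s)"
      unfolding cy by (subst sum.swap) (simp add: sum_distrib_right)
    also have "\<dots> = - cnj T" unfolding T_def D_def by (simp add: mult_ac)
    finally show ?thesis .
  qed
  \<comment> \<open>After conjugation and scaling by \<eta> the lower identity cancels T; as z and
    cnj z have the same real part, taking Re leaves an energy balance.\<close>
  have "cnj z * of_real V = - T" using arg_cong[OF 2, of cnj] by simp
  then have "z * of_real U + ?e * (cnj z * of_real V) = ?e * of_real Q"
    unfolding 1 by (simp add: algebra_simps)
  from arg_cong[OF this, of Re] have key: "Re z * (U + eta g * V) = eta g * Q"
    by (simp add: algebra_simps)
  have "0 \<le> U" "0 \<le> V" unfolding U_def V_def by (auto intro: sum_nonneg)
  have "0 < Q"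
  proof (rule ccontr)
    assume "\<not> 0 < Q"
    moreover have "0 \<le> mix_visit g p s * (cmod (x s))\<^sup>2" if "s < S" for s
      using mix_visit_pos[OF that] by simp
    ultimately have "mix_visit g p s * (cmod (x s))\<^sup>2 = 0" if "s < S" for s
      using sum_nonneg_0[of "{..<S}" "\<lambda>s. mix_visit g p s * (cmod (x s))\<^sup>2" s] that
        sum_nonneg[of "{..<S}" "\<lambda>s. mix_visit g p s * (cmod (x s))\<^sup>2"] by (force simp: Q_def)
    then have x0: "x s = 0" if "s < S" for s using mix_visit_pos[of s] that by fastforce
    from real_kernel_complex[OF X_carrier full_rank_kernel[OF X_carrier rank_X]]
    have u0: "u j = 0" if "j < M" for j using x0 that unfolding x_def by blast
    have "(\<Sum>j<M. complex_of_real (key_mat g p $$ (i, j)) * v j) = 0" if i: "i < M" for i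
    proof -
      have "(\<Sum>s<S. complex_of_real (X $$ (s, i)) * D s * y s) = 0"
        using row1[OF i] u0[OF i] x0 pos by simp
      moreover have "(\<Sum>s<S. complex_of_real (X $$ (s, i)) * D s * y s)
          = (\<Sum>j<M. \<Sum>s<S. complex_of_real (X $$ (s, i)) * D s * (complex_of_real (Z $$ (s, j)) * v j))"
        unfolding y_def sum_distrib_left by (rule sum.swap)
      ultimately show ?thesis
        using i by (simp add: index_key_mat sum_distrib_right D_def mult.assoc)
    qed
    from real_kernel_complex[OF setting_carriers(6)[OF gtd] invertible_mat_kernel[OF setting_carriers(6)[OF gtd] inv] this]
    have v0: "v j = 0" if "j < M" for j using that by blast
    have "w $ i = 0" if "i < 2 * M" for i
      using u0[of i] v0[of "i - M"] that by (cases "i < M") (auto simp: u_def v_def)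
    then have "w = 0\<^sub>v (2 * M)" using w(1) by (intro eq_vecI) auto
    then show False using w by simp
  qed
  then have "0 < Re z * (U + eta g * V)" using pos by (simp add: key)
  then show ?thesis using \<open>0 \<le> U\<close> \<open>0 \<le> V\<close> pos
    by (smt (verit, best) mult_nonneg_nonneg zero_less_mult_iff)
qed

lemma blocksG_sum: "sum_list (map fst (blocksG J)) = 2 * M"
  and similar_G: "similar_mat_wit (cmat (G_bar g J)) (jordan_matrix (blocksG J)) (YG J) (YGi J)"
proof -
  show *: "similar_mat_wit (cmat (G_bar g J)) (jordan_matrix (blocksG J)) (YG J) (YGi J)"
    using jordan by (auto simp: jordan_setting_def)
  have "cmat (G_bar g J) \<in> carrier_mat (2 * M) (2 * M)" by (simp add: G_bar_def)
  from similar_mat_witD2(5)[OF this *] show "sum_list (map fst (blocksG J)) = 2 * M"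
    by (metis carrier_matD(1) jordan_matrix_dim(1))
qed

lemma lamG_Re_pos:
  assumes inv: "invertible_mat (key_mat g p)" and m: "m < 2 * M"
  shows "0 < Re (lamG J m)"
proof (rule G_bar_eigenvalue_Re_pos[OF inv])
  let ?A = "cmat (G_bar g J)" and ?J = "jordan_matrix (blocksG J)"
  have A: "?A \<in> carrier_mat (2 * M) (2 * M)" by (simp add: G_bar_def)
  note s = similar_mat_witD2[OF A similar_G]
  obtain y where y: "y \<in> carrier_vec (2 * M)" "y \<noteq> 0\<^sub>v (2 * M)" "?J *\<^sub>v y = lamG J m \<cdot>\<^sub>v y"
    using jordan_matrix_eigenvector[of m "blocksG J"] m by (auto simp: blocksG_sum lamG_def)
  have "eigenvalue ?J (lamG J m)"
    using y blocksG_sum unfolding eigenvalue_def eigenvector_def by auto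
  then have "poly (char_poly ?J) (lamG J m) = 0" using eigenvalue_root_char_poly[OF s(5)] by simp
  moreover have "char_poly ?A = char_poly ?J"
    using similar_G by (intro char_poly_similar) (auto simp: similar_mat_def)
  ultimately show "eigenvalue ?A (lamG J m)" using eigenvalue_root_char_poly[OF A] by simp
qed

end


section \<open>The combination matrix\<close>

text \<open>Here and in the next lemmas the side conditions are equations between dimensions instead
  of carrier memberships, so that the simplifier can discharge them and use the laws for
  rewriting.\<close>

lemma mult_mat_vec_assoc:
  "dim_col A = dim_row B \<Longrightarrow> dim_col B = dim_vec v \<Longrightarrow> (A * B) *\<^sub>v v = A *\<^sub>v (B *\<^sub>v (v::'a::comm_semiring_0 vec))"
  by (rule assoc_mult_mat_vec[of _ "dim_row A" "dim_row B" _ "dim_vec v"]) auto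

lemma mult_mat_vec_smult:
  "dim_vec v = dim_col A \<Longrightarrow> A *\<^sub>v (c \<cdot>\<^sub>v v) = c \<cdot>\<^sub>v (A *\<^sub>v (v::'a::comm_ring vec))"
  by (intro eq_vecI) (auto simp: scalar_prod_def sum_distrib_left mult_ac)

lemma mult_mat_vec_add:
  "dim_vec u = dim_col A \<Longrightarrow> dim_vec v = dim_col A \<Longrightarrow> A *\<^sub>v (u + v) = A *\<^sub>v u + A *\<^sub>v (v::'a::comm_ring vec)"
  by (rule mult_add_distrib_mat_vec[OF carrier_matI[OF refl refl] carrier_vecI carrier_vecI])

lemma mult_mat_vec_diff:
  "dim_vec u = dim_col A \<Longrightarrow> dim_vec v = dim_col A \<Longrightarrow> A *\<^sub>v (u - v) = A *\<^sub>v u - A *\<^sub>v (v::'a::comm_ring vec)"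
  by (rule mult_minus_distrib_mat_vec[OF carrier_matI[OF refl refl] carrier_vecI carrier_vecI])

text \<open>Over the reals, with v = 1 and z = 1, this keeps the column sums of powers at 1; over
  the complex numbers it transports an eigenvector to powers. Hence the general
  \<open>real_field\<close>.\<close>

lemma left_eigenvector_pow:
  fixes A :: "real mat" and v :: "nat \<Rightarrow> 'a::real_field"
  assumes A: "A \<in> carrier_mat n n"
    and ev: "\<And>k. k < n \<Longrightarrow> (\<Sum>l<n. of_real (A $$ (l, k)) * v l) = z * v k" and k: "k < n"
  shows "(\<Sum>l<n. of_real ((A ^\<^sub>m m) $$ (l, k)) * v l) = z ^ m * v k"
  using k
proof (induction m arbitrary: k)
  case 0
  have "(\<Sum>l<n. of_real ((A ^\<^sub>m 0) $$ (l, k)) * v l) = (\<Sum>l<n. if l = k then v l else 0)"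
    using A 0 by (intro sum.cong) auto
  then show ?case using 0 by simp
next
  case (Suc m)
  have Am: "A ^\<^sub>m m \<in> carrier_mat n n" using A by simp
  have "(\<Sum>l<n. of_real ((A ^\<^sub>m Suc m) $$ (l, k)) * v l) =
      (\<Sum>l<n. \<Sum>j<n. of_real (A $$ (j, k)) * (of_real ((A ^\<^sub>m m) $$ (l, j)) * v l))"
    using A Am Suc.prems
    by (intro sum.cong) (auto simp: scalar_prod_def atLeast0LessThan sum_distrib_left sum_distrib_right mult_ac intro!: sum.cong)
  also have "\<dots> = (\<Sum>j<n. of_real (A $$ (j, k)) * (z ^ m * v j))"
    using Suc.IH by (subst sum.swap) (simp flip: sum_distrib_left)
  also have "\<dots> = z ^ m * (\<Sum>j<n. of_real (A $$ (j, k)) * v j)"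
    by (simp add: sum_distrib_left mult_ac)
  finally show ?case using ev[OF Suc.prems] by (simp add: mult_ac)
qed


text \<open>The coefficients of column \<open>k\<close> form a probability vector, and the variance of the
  \<open>v l\<close> under it vanishes when \<open>\<bar>v k\<bar>\<close> is maximal.\<close>

lemma positive_column_stochastic_eigenvector:
  fixes a :: "nat \<Rightarrow> nat \<Rightarrow> real" and v :: "nat \<Rightarrow> complex"
  assumes pos: "\<And>l k. l < n \<Longrightarrow> k < n \<Longrightarrow> 0 < a l k"
    and one: "\<And>k. k < n \<Longrightarrow> (\<Sum>l<n. a l k) = 1"
    and ev: "\<And>k. k < n \<Longrightarrow> (\<Sum>l<n. of_real (a l k) * v l) = z * v k"
    and z: "1 \<le> cmod z" and n: "0 < n"
  obtains c where "\<And>l. l < n \<Longrightarrow> v l = c"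
proof -
  obtain k where k: "k < n" "\<And>l. l < n \<Longrightarrow> cmod (v l) \<le> cmod (v k)"
  proof -
    have "Max ((\<lambda>l. cmod (v l)) ` {..<n}) \<in> (\<lambda>l. cmod (v l)) ` {..<n}"
      using n by (intro Max_in) auto
    then obtain k where "k < n" "Max ((\<lambda>l. cmod (v l)) ` {..<n}) = cmod (v k)" by auto
    moreover have "cmod (v l) \<le> Max ((\<lambda>l. cmod (v l)) ` {..<n})" if "l < n" for l
      using that by (intro Max_ge) auto
    ultimately show ?thesis using that by metis
  qed
  define c where "c = z * v k"
  have c: "(\<Sum>l<n. of_real (a l k) * v l) = c" using ev[OF k(1)] by (simp add: c_def)
  have sq: "complex_of_real ((cmod w)\<^sup>2) = w * cnj w" for w by (rule complex_norm_square)
  have "complex_of_real (\<Sum>l<n. a l k * (cmod (v l - c))\<^sup>2) =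
      (\<Sum>l<n. of_real (a l k) * ((v l - c) * cnj (v l - c)))"
    unfolding of_real_sum of_real_mult sq ..
  also have "\<dots> = (\<Sum>l<n. of_real (a l k) * (v l * cnj (v l))) - (\<Sum>l<n. of_real (a l k) * v l) * cnj c
      - c * (\<Sum>l<n. of_real (a l k) * cnj (v l)) + of_real (\<Sum>l<n. a l k) * (c * cnj c)"
    by (simp add: sum_distrib_left sum_distrib_right sum_subtractf sum.distrib algebra_simps)
  also have "(\<Sum>l<n. of_real (a l k) * cnj (v l)) = cnj c"
    unfolding c[symmetric] by simp
  also have "(\<Sum>l<n. of_real (a l k) * (v l * cnj (v l))) - (\<Sum>l<n. of_real (a l k) * v l) * cnj c
      - c * cnj c + of_real (\<Sum>l<n. a l k) * (c * cnj c) =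
      complex_of_real ((\<Sum>l<n. a l k * (cmod (v l))\<^sup>2) - (cmod c)\<^sup>2)"
    unfolding of_real_diff of_real_sum of_real_mult sq c using one[OF k(1)]
    by (simp flip: of_real_sum)
  finally have var: "(\<Sum>l<n. a l k * (cmod (v l - c))\<^sup>2) = (\<Sum>l<n. a l k * (cmod (v l))\<^sup>2) - (cmod c)\<^sup>2"
    by (simp only: of_real_eq_iff)
  have "(\<Sum>l<n. a l k * (cmod (v l))\<^sup>2) \<le> (\<Sum>l<n. a l k * (cmod (v k))\<^sup>2)"
    using k pos by (intro sum_mono mult_left_mono power_mono) (auto intro: less_imp_le)
  also have "\<dots> = (cmod (v k))\<^sup>2" using one[OF k(1)] by (simp flip: sum_distrib_right)
  \<comment> \<open>Here 1 \<le> |z| enters: the weighted mean c = z v_k has at least the maximal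
    modulus |v_k|, which leaves no room for variance.\<close>
  also have "\<dots> \<le> (cmod c)\<^sup>2"
    using z mult_right_mono[OF z, of "cmod (v k)"] by (intro power_mono) (auto simp: c_def norm_mult)
  finally have "(\<Sum>l<n. a l k * (cmod (v l - c))\<^sup>2) \<le> 0" using var by simp
  moreover have nn: "0 \<le> a l k * (cmod (v l - c))\<^sup>2" if "l < n" for l
    using pos[OF that k(1)] by simp
  ultimately have "a l k * (cmod (v l - c))\<^sup>2 = 0" if "l < n" for l
    using sum_nonneg_eq_0_iff[of "{..<n}" "\<lambda>l. a l k * (cmod (v l - c))\<^sup>2"] that
      sum_nonneg[of "{..<n}" "\<lambda>l. a l k * (cmod (v l - c))\<^sup>2"] by force
  then have "v l = c" if "l < n" for l using pos[OF that k(1)] that by fastforce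
  then show ?thesis using that by blast
qed

lemma kron_transpose:
  "(A \<otimes>\<^sub>k B)\<^sup>T = A\<^sup>T \<otimes>\<^sub>k B\<^sup>T"
proof (rule eq_matI)
  fix i j assume "i < dim_row (A\<^sup>T \<otimes>\<^sub>k B\<^sup>T)" "j < dim_col (A\<^sup>T \<otimes>\<^sub>k B\<^sup>T)"
  then have ij: "i < dim_col A * dim_col B" "j < dim_row A * dim_row B" by simp_all
  then have "0 < dim_col B" "0 < dim_row B" by (auto intro: gr0I)
  then show "(A \<otimes>\<^sub>k B)\<^sup>T $$ (i, j) = (A\<^sup>T \<otimes>\<^sub>k B\<^sup>T) $$ (i, j)"
    using ij by (simp add: kron_def less_mult_imp_div_less)
qed auto

lemma cmat_kron: "cmat (A \<otimes>\<^sub>k B) = cmat A \<otimes>\<^sub>k cmat B"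
proof (rule eq_matI)
  fix i j assume "i < dim_row (cmat A \<otimes>\<^sub>k cmat B)" "j < dim_col (cmat A \<otimes>\<^sub>k cmat B)"
  then have ij: "i < dim_row A * dim_row B" "j < dim_col A * dim_col B" by simp_all
  then have "0 < dim_col B" "0 < dim_row B" by (auto intro: gr0I)
  then show "cmat (A \<otimes>\<^sub>k B) $$ (i, j) = (cmat A \<otimes>\<^sub>k cmat B) $$ (i, j)"
    using ij by (simp add: kron_def less_mult_imp_div_less)
qed auto

section \<open>Consensus and disagreement coordinates\<close>

context gtd_jordan
begin

text \<open>Dimension of the disagreement space; for a single agent it is 0 and everything indexed
  by it is empty.\<close>

definition "N' = N - 1"

abbreviation "Ct \<equiv> cmat ((comb g)\<^sup>T)"
abbreviation "prow \<equiv> cmat (mat_of_rows N [p])"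
abbreviation "ones \<equiv> mat_of_cols N [vec N (\<lambda>_. 1 :: complex)]"

lemma comb_carrier [simp, intro]: "comb g \<in> carrier_mat N N"
  using gtd by (simp add: gtd_setting_def network_setting_def)

lemma comb_zero: "k < N \<Longrightarrow> l < N \<Longrightarrow> l \<notin> nbhd g k \<Longrightarrow> comb g $$ (l, k) = 0"
  and nbhd_subset: "k < N \<Longrightarrow> nbhd g k \<subseteq> {..<N}"
  and comb_nbhd_sum: "k < N \<Longrightarrow> (\<Sum>l\<in>nbhd g k. comb g $$ (l, k)) = 1"
  and comb_primitive: "primitive (comb g)"
  using gtd by (simp_all add: gtd_setting_def network_setting_def)

lemma sum_nbhd:
  assumes k: "k < N"
  shows "(\<Sum>l\<in>nbhd g k. comb g $$ (l, k) * f l) = (\<Sum>l<N. comb g $$ (l, k) * f l)"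
  using comb_zero[OF k] nbhd_subset[OF k] by (intro sum.mono_neutral_left) auto

lemma comb_sum: "k < N \<Longrightarrow> (\<Sum>l<N. comb g $$ (l, k)) = 1"
  using sum_nbhd[of k "\<lambda>_. 1"] comb_nbhd_sum by simp

lemma YC_similar: "similar_mat_wit Ct (jordan_matrix ((1, 1) # blocksC J)) (YC J) (YCi J)"
  using jordan by (simp add: jordan_setting_def)

lemma YC_col_0: "col (YC J) 0 = vec N (\<lambda>_. 1)"
  and YCi_row_0: "row (YCi J) 0 = map_vec complex_of_real p"
  using jordan by (simp_all add: jordan_setting_def)

lemma Ct_carrier: "Ct \<in> carrier_mat N N"
  by simp

lemma YC_carrier [simp, intro]: "YC J \<in> carrier_mat N N" "YCi J \<in> carrier_mat N N"
  and YC_inverse: "YC J * YCi J = 1\<^sub>m N" "YCi J * YC J = 1\<^sub>m N"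
  and Ct_YC: "Ct = YC J * jordan_matrix ((1, 1) # blocksC J) * YCi J"
  and JC_carrier: "jordan_matrix ((1, 1) # blocksC J) \<in> carrier_mat N N"
  using similar_mat_witD2[OF Ct_carrier YC_similar] by auto

lemmas YC_dims [simp] = carrier_matD[OF YC_carrier(1)] carrier_matD[OF YC_carrier(2)] carrier_matD[OF comb_carrier]

lemma Suc_N': "Suc N' = N" using pos by (simp add: N'_def)

lemma sum_N: "(\<Sum>k<N. f k) = f 0 + (\<Sum>k<N'. f (Suc k))"
  unfolding Suc_N'[symmetric] by (rule sum.lessThan_Suc_shift)

lemma blocksC_sum: "sum_list (map fst (blocksC J)) = N'"
  using carrier_matD(1)[OF JC_carrier] Suc_N' by simp

lemma J0_carrier [simp, intro]: "J0 J \<in> carrier_mat N' N'"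
  unfolding J0_def using jordan_matrix_carrier[of "blocksC J"] by (simp add: blocksC_sum)

lemmas J0_dims [simp] = carrier_matD[OF J0_carrier]

lemma index_JC:
  "jordan_matrix ((1, 1) # blocksC J) $$ (0, 0) = 1"
  "j < N' \<Longrightarrow> jordan_matrix ((1, 1) # blocksC J) $$ (0, Suc j) = 0"
  "i < N' \<Longrightarrow> jordan_matrix ((1, 1) # blocksC J) $$ (Suc i, 0) = 0"
  "i < N' \<Longrightarrow> j < N' \<Longrightarrow> jordan_matrix ((1, 1) # blocksC J) $$ (Suc i, Suc j) = J0 J $$ (i, j)"
  by (simp_all add: jordan_matrix_Cons J0_def blocksC_sum)

lemma YC_0: "k < N \<Longrightarrow> YC J $$ (k, 0) = 1"
  using arg_cong[OF YC_col_0, of "\<lambda>v. v $ k"] pos by simp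

lemma YCi_0: "k < N \<Longrightarrow> YCi J $$ (0, k) = complex_of_real (p $ k)"
  using arg_cong[OF YCi_row_0, of "\<lambda>v. v $ k"] pos p_carrier by simp

lemma YCr_carrier [simp, intro]: "YCr g J \<in> carrier_mat N N'"
  and YCl_carrier [simp, intro]: "YCl g J \<in> carrier_mat N' N"
  by (simp_all add: YCr_def YCl_def N'_def)

lemmas YC_split_dims [simp] = carrier_matD[OF YCr_carrier] carrier_matD[OF YCl_carrier]

lemma index_YCr: "i < N \<Longrightarrow> j < N' \<Longrightarrow> YCr g J $$ (i, j) = YC J $$ (i, Suc j)"
  and index_YCl: "i < N' \<Longrightarrow> j < N \<Longrightarrow> YCl g J $$ (i, j) = YCi J $$ (Suc i, j)"
  by (simp_all add: YCr_def YCl_def N'_def)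

lemma prow_carrier: "prow \<in> carrier_mat 1 N"
  and ones_carrier: "ones \<in> carrier_mat N 1"
  by (simp_all add: mat_of_rows_def mat_of_cols_def)

lemma index_prow: "k < N \<Longrightarrow> mat_of_rows N [p] $$ (0, k) = p $ k"
  and index_ones: "k < N \<Longrightarrow> ones $$ (k, 0) = 1"
  by (simp_all add: mat_of_rows_def mat_of_cols_def)

lemma index_mult:
  "A \<in> carrier_mat m n \<Longrightarrow> B \<in> carrier_mat n q \<Longrightarrow> i < m \<Longrightarrow> j < q \<Longrightarrow>
    (A * B) $$ (i, j) = (\<Sum>k<n. A $$ (i, k) * B $$ (k, j))"
  by (auto simp: scalar_prod_def atLeast0LessThan)

lemma YC_JC: "Ct * YC J = YC J * jordan_matrix ((1, 1) # blocksC J)" (is "_ = _ * ?J")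
proof -
  have "Ct * YC J = YC J * ?J * (YCi J * YC J)"
    unfolding Ct_YC by (rule assoc_mult_mat[of _ N N _ N _ N]) (use JC_carrier in \<open>auto intro!: mult_carrier_mat\<close>)
  then show ?thesis
    unfolding YC_inverse right_mult_one_mat[OF mult_carrier_mat[OF YC_carrier(1) JC_carrier]] .
qed

lemma YCi_JC: "YCi J * Ct = jordan_matrix ((1, 1) # blocksC J) * YCi J" (is "_ = ?J * _")
proof -
  have "YCi J * Ct = YCi J * (YC J * (?J * YCi J))"
    unfolding Ct_YC by (subst assoc_mult_mat[OF YC_carrier(1) JC_carrier YC_carrier(2)]) simp
  also have "\<dots> = (YCi J * YC J) * (?J * YCi J)"
    by (rule assoc_mult_mat[symmetric, of _ N N _ N _ N]) (use JC_carrier in auto)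
  finally show ?thesis
    unfolding YC_inverse left_mult_one_mat[OF mult_carrier_mat[OF JC_carrier YC_carrier(2)]] .
qed

lemma YCl_YCr: "YCl g J * YCr g J = 1\<^sub>m N'"
proof (rule eq_matI)
  fix i j assume "i < dim_row (1\<^sub>m N' :: complex mat)" "j < dim_col (1\<^sub>m N' :: complex mat)"
  then have ij: "i < N'" "j < N'" "Suc i < N" "Suc j < N" using Suc_N' by auto
  have "(YCl g J * YCr g J) $$ (i, j) = (YCi J * YC J) $$ (Suc i, Suc j)"
    using ij by (simp add: index_mult[OF YCl_carrier YCr_carrier] index_mult[OF YC_carrier(2,1)] index_YCl index_YCr del: index_mult_mat(1))
  then show "(YCl g J * YCr g J) $$ (i, j) = 1\<^sub>m N' $$ (i, j)"
    using ij by (simp add: YC_inverse)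
qed auto

lemma p_YCr:
  assumes j: "j < N'"
  shows "(\<Sum>k<N. complex_of_real (p $ k) * YCr g J $$ (k, j)) = 0"
proof -
  have j': "Suc j < N" using j Suc_N' by auto
  have "(\<Sum>k<N. complex_of_real (p $ k) * YCr g J $$ (k, j)) = (YCi J * YC J) $$ (0, Suc j)"
    unfolding index_mult[OF YC_carrier(2,1) pos(3) j'] using j by (simp add: YCi_0 index_YCr)
  then show ?thesis using j' pos by (simp add: YC_inverse)
qed

text \<open>Resolution of the identity into the consensus projection 1 p^T and the projection onto
  the disagreement space, so a stacked vector can be rebuilt from its average and its
  disagreement.\<close>

lemma ones_prow: "ones * prow + YCr g J * YCl g J = 1\<^sub>m N"
proof (rule eq_matI)
  fix i j assume "i < dim_row (1\<^sub>m N :: complex mat)" "j < dim_col (1\<^sub>m N :: complex mat)"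
  then have ij: "i < N" "j < N" by auto
  have "(ones * prow + YCr g J * YCl g J) $$ (i, j) = (ones * prow) $$ (i, j) + (YCr g J * YCl g J) $$ (i, j)"
    using ij by (simp del: index_mult_mat(1))
  also have "\<dots> = (YC J * YCi J) $$ (i, j)"
    using ij
    by (simp add: index_mult[OF ones_carrier prow_carrier] index_mult[OF YCr_carrier YCl_carrier]
        index_mult[OF YC_carrier] sum_N YC_0 YCi_0 index_YCl index_YCr index_prow index_ones del: index_mult_mat(1))
  finally show "(ones * prow + YCr g J * YCl g J) $$ (i, j) = 1\<^sub>m N $$ (i, j)"
    using ij by (simp add: YC_inverse)
qed auto

text \<open>The Jordan matrix has no entries linking its first index with the others, so dropping
  the first row of the inverse basis leaves an intertwining relation with \<open>J0\<close>
  alone.\<close>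

lemma YCl_Ct: "YCl g J * Ct = J0 J * YCl g J"
proof (rule eq_matI)
  fix i j assume "i < dim_row (J0 J * YCl g J)" "j < dim_col (J0 J * YCl g J)"
  then have ij: "i < N'" "j < N" "Suc i < N" using Suc_N' by auto
  have "(YCl g J * Ct) $$ (i, j) = (YCi J * Ct) $$ (Suc i, j)"
    using ij by (simp add: index_mult[OF YCl_carrier Ct_carrier] index_mult[OF YC_carrier(2) Ct_carrier] index_YCl del: index_mult_mat(1))
  also have "\<dots> = (J0 J * YCl g J) $$ (i, j)"
    unfolding YCi_JC using ij
    by (simp add: index_mult[OF JC_carrier YC_carrier(2)] index_mult[OF J0_carrier YCl_carrier] sum_N index_JC
        index_YCl del: index_mult_mat(1) One_nat_def)
  finally show "(YCl g J * Ct) $$ (i, j) = (J0 J * YCl g J) $$ (i, j)" .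
qed auto

lemma Ct_YCr: "Ct * YCr g J = YCr g J * J0 J"
proof (rule eq_matI)
  fix i j assume "i < dim_row (YCr g J * J0 J)" "j < dim_col (YCr g J * J0 J)"
  then have ij: "i < N" "j < N'" "Suc j < N" using Suc_N' by auto
  have "(Ct * YCr g J) $$ (i, j) = (Ct * YC J) $$ (i, Suc j)"
    using ij by (simp add: index_mult[OF Ct_carrier YCr_carrier] index_mult[OF Ct_carrier YC_carrier(1)] index_YCr del: index_mult_mat(1))
  also have "\<dots> = (YCr g J * J0 J) $$ (i, j)"
    unfolding YC_JC using ij
    by (simp add: index_mult[OF YC_carrier(1) JC_carrier] index_mult[OF YCr_carrier J0_carrier] sum_N index_JC
        index_YCr del: index_mult_mat(1) One_nat_def)
  finally show "(Ct * YCr g J) $$ (i, j) = (YCr g J * J0 J) $$ (i, j)" .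
qed auto

text \<open>The transposed form of C p = p: combining does not change the Perron average.\<close>

lemma prow_Ct: "prow * Ct = prow"
proof (rule eq_matI)
  fix i j assume "i < dim_row prow" "j < dim_col prow"
  then have ij: "i = 0" "j < N" by auto
  have "comb g *\<^sub>v p = p" using jordan by (simp add: jordan_setting_def)
  from arg_cong[OF this, of "\<lambda>v. v $ j"] have *: "(\<Sum>k<N. comb g $$ (j, k) * p $ k) = p $ j"
    using ij p_carrier by (simp add: scalar_prod_def atLeast0LessThan)
  have "(prow * Ct) $$ (i, j) = complex_of_real (\<Sum>k<N. comb g $$ (j, k) * p $ k)"
    using ij by (simp add: index_mult[OF prow_carrier Ct_carrier] index_prow mult.commute del: index_mult_mat(1))
  then show "(prow * Ct) $$ (i, j) = prow $$ (i, j)"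
    unfolding * using ij by (simp add: index_prow del: index_mult_mat(1))
qed auto

text \<open>An eigenvector y of \<open>J0\<close> with |\<lambda>| \<ge> 1 would lift to an
  eigenvector v of C^T. A positive power of C makes v constant, but p^T v = 0 by biorthogonality of
  the Jordan bases, so v = 0 and y = 0. This covers \<lambda> = 1, where constancy alone would be no
  contradiction.\<close>

lemma lamC_less_1:
  assumes k: "k < N'"
  shows "cmod (lamC J k) < 1"
proof (rule ccontr)
  assume "\<not> cmod (lamC J k) < 1"
  then have ge: "1 \<le> cmod (lamC J k)" by simp
  obtain y where y: "y \<in> carrier_vec N'" "y \<noteq> 0\<^sub>v N'" "J0 J *\<^sub>v y = lamC J k \<cdot>\<^sub>v y"
    using jordan_matrix_eigenvector[of k "blocksC J"] k by (auto simp: blocksC_sum lamC_def J0_def)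
  define v where "v = YCr g J *\<^sub>v y"
  have v: "v \<in> carrier_vec N" unfolding v_def using YCr_carrier by (rule mult_mat_vec_carrier) (rule y)
  have Cv: "Ct *\<^sub>v v = lamC J k \<cdot>\<^sub>v v"
  proof -
    have "Ct *\<^sub>v v = (Ct * YCr g J) *\<^sub>v y"
      unfolding v_def by (rule assoc_mult_mat_vec[symmetric, OF Ct_carrier YCr_carrier y(1)])
    also have "\<dots> = YCr g J *\<^sub>v (J0 J *\<^sub>v y)"
      unfolding Ct_YCr by (rule assoc_mult_mat_vec[OF YCr_carrier J0_carrier y(1)])
    finally show ?thesis unfolding y(3) v_def using mult_mat_vec[OF YCr_carrier y(1)] by simp
  qed
  have ev: "(\<Sum>l<N. of_real (comb g $$ (l, j)) * v $ l) = lamC J k * v $ j" if "j < N" for j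
    using arg_cong[OF Cv, of "\<lambda>v. v $ j"] that v by (simp add: scalar_prod_def atLeast0LessThan)
  obtain m where m: "\<And>i j. i < N \<Longrightarrow> j < N \<Longrightarrow> 0 < (comb g ^\<^sub>m m) $$ (i, j)"
    using comb_primitive by (auto simp: primitive_def)
  obtain c where c: "\<And>l. l < N \<Longrightarrow> v $ l = c"
  proof (rule positive_column_stochastic_eigenvector[of N "\<lambda>l k. (comb g ^\<^sub>m m) $$ (l, k)" "\<lambda>l. v $ l" "lamC J k ^ m"])
    show "(\<Sum>l<N. (comb g ^\<^sub>m m) $$ (l, j)) = 1" if "j < N" for j
      using left_eigenvector_pow[OF comb_carrier, of "\<lambda>_. 1::real" 1 j m] comb_sum that by simp
    show "(\<Sum>l<N. of_real ((comb g ^\<^sub>m m) $$ (l, j)) * v $ l) = lamC J k ^ m * v $ j" if "j < N" for j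
      by (rule left_eigenvector_pow[OF comb_carrier ev that])
    show "1 \<le> cmod (lamC J k ^ m)" using ge by (simp add: norm_power one_le_power)
  qed (use m pos in auto)
  \<comment> \<open>The entries of p sum to 1, so the constant equals p^T v, and p annihilates the
    columns of \<open>YCr\<close>.\<close>
  have "c = (\<Sum>l<N. of_real (p $ l) * v $ l)"
    using p_sum by (simp add: c flip: sum_distrib_right of_real_sum)
  also have "\<dots> = (\<Sum>j<N'. (\<Sum>l<N. of_real (p $ l) * YCr g J $$ (l, j)) * y $ j)"
  proof -
    have "v $ l = (\<Sum>j<N'. YCr g J $$ (l, j) * y $ j)" if "l < N" for l
      using that y carrier_matD[OF YCr_carrier] by (simp add: v_def scalar_prod_def atLeast0LessThan)
    then show ?thesis
      unfolding sum_distrib_right by (subst sum.swap) (simp add: sum_distrib_left mult.assoc)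
  qed
  also have "\<dots> = 0" by (simp add: p_YCr)
  finally have "v = 0\<^sub>v N" using c v by (intro eq_vecI) auto
  then have "YCl g J *\<^sub>v v = 0\<^sub>v N'"
    by (intro eq_vecI) auto
  moreover have "YCl g J *\<^sub>v v = y"
    unfolding v_def using assoc_mult_mat_vec[OF YCl_carrier YCr_carrier y(1)] y(1) by (simp add: YCl_YCr)
  ultimately show False using y(2) by simp
qed

text \<open>The order of choice matters: \<open>chi21\<close> depends on \<epsilon> and \<beta>, so
  \<sigma> comes last. Its denominator is the sum of all \<open>chi21\<close>, plus 1 to stay
  positive if they all vanish.\<close>

lemma admissible_exists:
  assumes inv: "invertible_mat (key_mat g p)"
  shows "\<exists>\<epsilon> \<beta> \<sigma>. admissible g J \<epsilon> \<beta> \<sigma>"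
proof -
  obtain \<epsilon> where \<epsilon>: "0 < \<epsilon>" "\<And>m. m < 2 * M \<Longrightarrow> \<epsilon> < Re (lamG J m)"
  proof -
    \<comment> \<open>A positive lower bound of finitely many positive numbers, by induction on how
      many; used again for \<beta>, the scheme also covers an empty family.\<close>
    have "\<exists>\<epsilon>>0. \<forall>m<n. \<epsilon> < Re (lamG J m)" if "n \<le> 2 * M" for n
      using that
    proof (induction n)
      case (Suc n)
      then obtain \<epsilon> where \<epsilon>: "\<epsilon> > 0" "\<forall>m<n. \<epsilon> < Re (lamG J m)" by auto
      have "0 < Re (lamG J n)" using lamG_Re_pos[OF inv] Suc.prems by simp
      with \<epsilon> show ?case
        by (intro exI[of _ "min \<epsilon> (Re (lamG J n) / 2)"]) (auto simp: less_Suc_eq min_less_iff_disj)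
    qed (auto intro: exI[of _ 1])
    then show ?thesis using that by blast
  qed
  obtain \<beta> where \<beta>: "0 < \<beta>" "\<And>k. k < N' \<Longrightarrow> \<beta> < 1 - cmod (lamC J k)"
  proof -
    have "\<exists>\<beta>>0. \<forall>k<n. \<beta> < 1 - cmod (lamC J k)" if "n \<le> N'" for n
      using that
    proof (induction n)
      case (Suc n)
      then obtain \<beta> where \<beta>: "\<beta> > 0" "\<forall>k<n. \<beta> < 1 - cmod (lamC J k)" by auto
      have "cmod (lamC J n) < 1" using lamC_less_1 Suc.prems by simp
      with \<beta> show ?case
        by (intro exI[of _ "min \<beta> ((1 - cmod (lamC J n)) / 2)"])
          (auto simp: less_Suc_eq min_less_iff_disj simp del: norm_ge_zero)
    qed (auto intro: exI[of _ 1])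
    then show ?thesis using that by blast
  qed
  define T where "T = (\<Sum>j<Ldim g. chi21 g J \<epsilon> \<beta> j)"
  have nn: "0 \<le> chi21 g J \<epsilon> \<beta> j" for j unfolding chi21_def by (rule sum_nonneg) simp
  then have T: "0 \<le> T" unfolding T_def by (rule sum_nonneg)
  have "1 / (1 + T) * chi21 g J \<epsilon> \<beta> j < 1" if "j < Ldim g" for j
  proof -
    have "chi21 g J \<epsilon> \<beta> j \<le> T" unfolding T_def using nn that by (intro member_le_sum) auto
    then show ?thesis using T by (simp add: field_simps)
  qed
  then have "admissible g J \<epsilon> \<beta> (1 / (1 + T))"
    using \<epsilon> \<beta> T by (simp add: admissible_def N'_def)
  then show ?thesis by blast
qed

end


section \<open>Stability of the error matrix\<close>

lemma index_mult_vec: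
  "dim_vec v = dim_col A \<Longrightarrow> i < dim_row A \<Longrightarrow> (A *\<^sub>v v) $ i = (\<Sum>j<dim_col A. A $$ (i, j) * v $ j)"
  by (simp add: scalar_prod_def atLeast0LessThan)

lemma one_mult_mat_vec_dim: "dim_vec v = n \<Longrightarrow> 1\<^sub>m n *\<^sub>v v = (v::'a::semiring_1 vec)"
  by (rule one_mult_mat_vec) (rule carrier_vecI)

section \<open>Rescaled Jordan blocks and scalar inequalities\<close>

lemma Omega_dims [simp]: "dim_row (Omega n \<epsilon>) = n" "dim_col (Omega n \<epsilon>) = n"
  by (auto simp: Omega_def mat_diag_def)

text \<open>\<open>mat_inv\<close> comes from Gauss-Jordan elimination; uniqueness of inverses
  identifies its value with the diagonal matrix that entrywise computations need.\<close>

lemma mat_inv_Omega: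
  assumes "0 < \<epsilon>"
  shows "mat_inv (Omega n \<epsilon>) = mat_diag n (\<lambda>i. complex_of_real (1 / \<epsilon> ^ (i + 1)))" (is "_ = ?D")
proof -
  let ?O = "Omega n \<epsilon>"
  have c: "?O \<in> carrier_mat n n" "?D \<in> carrier_mat n n" by (auto simp: Omega_def mat_diag_def)
  have f: "complex_of_real (\<epsilon> ^ (i + 1)) * complex_of_real (1 / \<epsilon> ^ (i + 1)) = 1"
    "complex_of_real (1 / \<epsilon> ^ (i + 1)) * complex_of_real (\<epsilon> ^ (i + 1)) = 1" for i
    using assms by (simp_all flip: of_real_mult)
  have 1: "?O * ?D = 1\<^sub>m n" "?D * ?O = 1\<^sub>m n"
    unfolding Omega_def mat_diag_diag f by simp_all
  have "invertible_mat ?O"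
    unfolding invertible_mat_def inverts_mat_def using 1 carrier_matD[OF c(1)] carrier_matD[OF c(2)]
    by (metis square_mat.simps)
  note I = mat_inv_invertible[OF c(1) this]
  have "mat_inv ?O = mat_inv ?O * (?O * ?D)" unfolding 1 using I by simp
  also have "\<dots> = ?D"
    unfolding assoc_mult_mat[OF I(1) c, symmetric] I by (rule left_mult_one_mat[OF c(2)])
  finally show ?thesis .
qed

lemma mat_inv_Omega_dims [simp]:
  "0 < \<epsilon> \<Longrightarrow> dim_row (mat_inv (Omega n \<epsilon>)) = n" "0 < \<epsilon> \<Longrightarrow> dim_col (mat_inv (Omega n \<epsilon>)) = n"
  by (simp_all add: mat_inv_Omega mat_diag_def)

lemma Omega_inverse:
  assumes "0 < \<epsilon>"
  shows "Omega n \<epsilon> * mat_inv (Omega n \<epsilon>) = 1\<^sub>m n"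
proof -
  have f: "complex_of_real (\<epsilon> ^ (i + 1)) * complex_of_real (1 / \<epsilon> ^ (i + 1)) = 1" for i
    using assms by (simp flip: of_real_mult)
  show ?thesis unfolding mat_inv_Omega[OF assms] unfolding Omega_def mat_diag_diag f by simp
qed

lemma index_Omega_conj:
  assumes \<epsilon>: "0 < \<epsilon>" and A: "A \<in> carrier_mat n n" and "i < n" "j < n"
  shows "(mat_inv (Omega n \<epsilon>) * A * Omega n \<epsilon>) $$ (i, j) =
    A $$ (i, j) * complex_of_real (\<epsilon> ^ (j + 1) / \<epsilon> ^ (i + 1))"
proof -
  have "mat_inv (Omega n \<epsilon>) * A = mat n n (\<lambda>(i, j). complex_of_real (1 / \<epsilon> ^ (i + 1)) * A $$ (i, j))"
    unfolding mat_inv_Omega[OF \<epsilon>] using A by (rule mat_diag_mult_left)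
  then show ?thesis
    using assms by (simp add: Omega_def mat_diag_mult_right[of _ n n])
qed

text \<open>The superdiagonal ones become \<open>\<epsilon>\<close>.\<close>

lemma Omega_conj_jordan_row_sum:
  assumes \<epsilon>: "0 < \<epsilon>" and n: "sum_list (map fst nas) = n" and i: "i < n"
  shows "(\<Sum>j\<in>{..<n} - {i}. cmod ((mat_inv (Omega n \<epsilon>) * jordan_matrix nas * Omega n \<epsilon>) $$ (i, j))) \<le> \<epsilon>"
    and "(mat_inv (Omega n \<epsilon>) * jordan_matrix nas * Omega n \<epsilon>) $$ (i, i) = jordan_matrix nas $$ (i, i)"
proof -
  let ?T = "mat_inv (Omega n \<epsilon>) * jordan_matrix nas * Omega n \<epsilon>"
  have J: "jordan_matrix nas \<in> carrier_mat n n" using n by (metis jordan_matrix_carrier)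
  note T = index_Omega_conj[OF \<epsilon> J i]
  show "?T $$ (i, i) = jordan_matrix nas $$ (i, i)" using T[OF i] \<epsilon> by simp
  have "(\<Sum>j\<in>{..<n} - {i}. cmod (?T $$ (i, j))) \<le> (\<Sum>j\<in>{..<n} - {i}. if j = Suc i then \<epsilon> else 0)"
  proof (rule sum_mono)
    fix j assume j: "j \<in> {..<n} - {i}"
    show "cmod (?T $$ (i, j)) \<le> (if j = Suc i then \<epsilon> else 0)"
    proof (cases "j = Suc i")
      case True
      have "\<epsilon> ^ (j + 1) / \<epsilon> ^ (i + 1) = \<epsilon>" using \<epsilon> True by simp
      moreover have "cmod (jordan_matrix nas $$ (i, j)) * \<epsilon> \<le> 1 * \<epsilon>"
        using jordan_matrix_superdiag_le[of i nas] True j n \<epsilon> by (intro mult_right_mono) auto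
      ultimately show ?thesis using T[of j] j \<epsilon> True by (simp add: norm_mult del: of_real_divide of_real_power)
    next
      case False
      then have "jordan_matrix nas $$ (i, j) = 0"
        using j i n by (intro jordan_matrix_index_0) auto
      then show ?thesis using T[of j] j False by simp
    qed
  qed
  also have "\<dots> \<le> \<epsilon>" using \<epsilon> by (simp add: sum.delta)
  finally show "(\<Sum>j\<in>{..<n} - {i}. cmod (?T $$ (i, j))) \<le> \<epsilon>" .
qed

text \<open>By 2 x \<le> 1 + x^2. Replacing the modulus by a polynomial in \<mu> loses nothing to
  first order and makes the row condition solvable in closed form.\<close>

lemma cmod_one_minus_le:
  "cmod (1 - complex_of_real \<mu> * c) \<le> 1 - \<mu> * Re c + \<mu>\<^sup>2 * (cmod c)\<^sup>2 / 2"
proof -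
  let ?x = "cmod (1 - complex_of_real \<mu> * c)"
  have "?x\<^sup>2 = 1 - 2 * \<mu> * Re c + \<mu>\<^sup>2 * (cmod c)\<^sup>2"
    unfolding cmod_power2 by (simp add: power2_eq_square algebra_simps)
  moreover have "0 \<le> (?x - 1)\<^sup>2" by simp
  then have "2 * ?x \<le> 1 + ?x\<^sup>2" by (simp add: power2_eq_square algebra_simps)
  ultimately show ?thesis by simp
qed

text \<open>The bound on t is the positive root of t^2 L / 2 + t c = x. It is used with t = sqrt
  \<mu>, c = \<open>chi12\<close> / \<sigma>, L = |\<lambda>|^2 and x = Re \<lambda> - \<epsilon>,
  which is the third family.\<close>

lemma step_bound_row:
  fixes t c L x :: real
  assumes t: "0 < t" and c: "0 \<le> c" and L: "0 < L" and x: "0 < x"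
    and less: "t < (- c + sqrt (c\<^sup>2 + 2 * L * x)) / L"
  shows "t\<^sup>2 * L / 2 + t * c < x"
proof -
  have "t * L + c < sqrt (c\<^sup>2 + 2 * L * x)" using less L by (simp add: pos_less_divide_eq)
  moreover have "0 \<le> t * L + c" using t L c by simp
  ultimately have "(t * L + c)\<^sup>2 < (sqrt (c\<^sup>2 + 2 * L * x))\<^sup>2" by (intro power_strict_mono) auto
  also have "\<dots> = c\<^sup>2 + 2 * L * x" using L x by (intro real_sqrt_pow2) (simp add: add_nonneg_nonneg)
  finally have "(2 * L) * (t\<^sup>2 * L / 2 + t * c) < (2 * L) * x"
    by (simp add: power2_eq_square algebra_simps)
  then show ?thesis using L by (simp only: mult_less_cancel_left_pos)
qed

lemma sqrt_less_of_less_square: "\<mu> < y\<^sup>2 \<Longrightarrow> 0 < y \<Longrightarrow> sqrt \<mu> < (y::real)"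
  using real_sqrt_less_mono[of \<mu> "y\<^sup>2"] by simp

section \<open>The error matrix in Jordan coordinates and its row sums\<close>

context gtd_jordan
begin

definition "n = 2 * M"

abbreviation "K A \<equiv> (A :: complex mat) \<otimes>\<^sub>k 1\<^sub>m n"
abbreviation "Rc \<equiv> cmat (big_R g)"
abbreviation "Oe \<epsilon> \<equiv> Omega n \<epsilon>"
abbreviation "Ob \<beta> \<equiv> Omega N' \<beta>"
abbreviation "JG \<equiv> jordan_matrix (blocksG J)"

lemma mean_G_carrier' [simp, intro]: "mean_G g k \<in> carrier_mat n n"
  and G_bar_carrier' [simp, intro]: "G_bar g J \<in> carrier_mat n n"
  unfolding n_def by auto

lemma n_pos: "0 < n" using pos by (simp add: n_def)

lemma big_R_carrier [simp, intro]: "big_R g \<in> carrier_mat (N * n) (N * n)"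
  unfolding big_R_def by (rule diag_block_carrier) (rule mean_G_carrier')

lemma index_big_R:
  "k < N \<Longrightarrow> l < N \<Longrightarrow> i < n \<Longrightarrow> j < n \<Longrightarrow>
    big_R g $$ (k * n + i, l * n + j) = (if k = l then mean_G g k $$ (i, j) else 0)"
  unfolding big_R_def by (rule index_diag_block) auto

lemma big_R_dims [simp]: "dim_row (big_R g) = N * n" "dim_col (big_R g) = N * n"
  by (rule carrier_matD[OF big_R_carrier])+

lemma prow_dims [simp]: "dim_row prow = 1" "dim_col prow = N" "dim_row ones = N" "dim_col ones = 1"
  by (rule carrier_matD[OF prow_carrier] carrier_matD[OF ones_carrier])+

lemma YG_carrier [simp, intro]: "YG J \<in> carrier_mat n n" "YGi J \<in> carrier_mat n n"
  and YG_inverse: "YG J * YGi J = 1\<^sub>m n" "YGi J * YG J = 1\<^sub>m n"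
  and G_bar_YG: "cmat (G_bar g J) = YG J * JG * YGi J"
  and JG_carrier [simp, intro]: "JG \<in> carrier_mat n n"
proof -
  have "cmat (G_bar g J) \<in> carrier_mat n n" by simp
  from similar_mat_witD2[OF this similar_G]
  show "YG J \<in> carrier_mat n n" "YGi J \<in> carrier_mat n n" "YG J * YGi J = 1\<^sub>m n" "YGi J * YG J = 1\<^sub>m n"
    "cmat (G_bar g J) = YG J * JG * YGi J" "JG \<in> carrier_mat n n" by auto
qed

lemma blocksG_sum_n [simp]: "sum_list (map fst (blocksG J)) = n"
  by (simp add: blocksG_sum n_def)

lemmas YG_dims [simp] = carrier_matD[OF YG_carrier(1)] carrier_matD[OF YG_carrier(2)]

lemma G_bar_dims [simp]: "dim_row (G_bar g J) = n" "dim_col (G_bar g J) = n"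
  by (rule carrier_matD[OF G_bar_carrier'])+

lemma K_mult_vec:
  assumes "dim_col A = dim_row B" "dim_vec v = dim_col B * n"
  shows "K (A * B) *\<^sub>v v = K A *\<^sub>v (K B *\<^sub>v v)"
proof -
  have "K (A * B) = K A * K B"
    by (rule kron_mult_one[symmetric, OF carrier_matI[OF refl refl] carrier_matI[OF _ refl]]) (simp add: assms)
  then show ?thesis using assms by (simp add: mult_mat_vec_assoc)
qed

text \<open>The consensus corner of \<open>big_R\<close>, companion of \<open>E12\<close>,
  \<open>E21\<close> and \<open>E22\<close>; here the Perron-weighted sum of the
  \<open>mean_G\<close> arises.\<close>

lemma K_prow_R_ones: "K prow * Rc * K ones = cmat (G_bar g J)"
proof (rule eq_matI)
  fix i j assume "i < dim_row (cmat (G_bar g J))" "j < dim_col (cmat (G_bar g J))"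
  then have ij: "i < n" "j < n" by auto
  have p: "(K prow) $$ (i, l * n + i') = (if i = i' then complex_of_real (p $ l) else 0)"
    if "l < N" "i' < n" for l i'
    using index_kron_one[of 0 prow i n l i'] ij that by (simp add: index_prow)
  have o: "(K ones) $$ (l * n + i', j) = (if i' = j then 1 else 0)"
    if "l < N" "i' < n" for l i'
    using index_kron_one[of l ones i' n 0 j] ij that by (simp add: index_ones)
  have pR: "(K prow * Rc) $$ (i, l * n + j') = complex_of_real (p $ l * mean_G g l $$ (i, j'))"
    if l: "l < N" "j' < n" for l j'
  proof -
    have "(K prow * Rc) $$ (i, l * n + j') = (\<Sum>x<N * n. K prow $$ (i, x) * Rc $$ (x, l * n + j'))"
      using ij l block_index_less[OF l] by (intro index_mult[of _ n "N * n"]) auto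
    also have "\<dots> = (\<Sum>k<N. \<Sum>i'<n. if i' = i then (if k = l then complex_of_real (p $ k * mean_G g k $$ (i', j')) else 0) else 0)"
      unfolding sum_blocks
      by (intro sum.cong refl) (simp add: p block_index_less l index_big_R)
    finally show ?thesis using l ij by simp
  qed
  have "(K prow * Rc * K ones) $$ (i, j) = (\<Sum>x<N * n. (K prow * Rc) $$ (i, x) * K ones $$ (x, j))"
    using ij by (intro index_mult[of _ n "N * n" _ n]) (auto intro!: mult_carrier_mat)
  also have "\<dots> = (\<Sum>k<N. \<Sum>i'<n. if i' = j then complex_of_real (p $ k * mean_G g k $$ (i, i')) else 0)"
    unfolding sum_blocks by (intro sum.cong refl) (simp add: pR o del: index_mult_mat)
  finally show "(K prow * Rc * K ones) $$ (i, j) = cmat (G_bar g J) $$ (i, j)"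
    using ij by (simp add: G_bar_def n_def)
qed auto

lemma cmat_error_mat:
  "cmat (error_mat g \<mu>) = K Ct * (1\<^sub>m (N * n) - complex_of_real \<mu> \<cdot>\<^sub>m Rc)"
proof -
  have c: "(big_C g)\<^sup>T \<in> carrier_mat (N * n) (N * n)"
    by (auto simp: big_C_def kron_transpose n_def)
  have c2: "1\<^sub>m (N * n) - \<mu> \<cdot>\<^sub>m big_R g \<in> carrier_mat (N * n) (N * n)" by auto
  have "cmat (error_mat g \<mu>) = cmat ((big_C g)\<^sup>T) * cmat (1\<^sub>m (N * n) - \<mu> \<cdot>\<^sub>m big_R g)"
    unfolding error_mat_def big_dim_def n_def[symmetric] by (rule of_real_hom.mat_hom_mult[OF c c2])
  also have "cmat ((big_C g)\<^sup>T) = K Ct"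
    by (simp add: big_C_def kron_transpose cmat_kron of_real_hom.mat_hom_one n_def)
  also have "cmat (1\<^sub>m (N * n) - \<mu> \<cdot>\<^sub>m big_R g) = 1\<^sub>m (N * n) - complex_of_real \<mu> \<cdot>\<^sub>m Rc"
    by (intro eq_matI) auto
  finally show ?thesis .
qed

lemma error_mat_carrier [simp, intro]: "error_mat g \<mu> \<in> carrier_mat (big_dim g) (big_dim g)"
    unfolding error_mat_def big_dim_def n_def[symmetric]
  by (rule mult_carrier_mat[of _ _ "N * n"]) (auto simp: big_C_def n_def[symmetric])

lemma E_dims [simp]:
  "dim_row (E12 g J) = n" "dim_col (E12 g J) = N' * n"
  "dim_row (E21 g J) = N' * n" "dim_col (E21 g J) = n"
  "dim_row (E22 g J) = N' * n" "dim_col (E22 g J) = N' * n"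
  by (simp_all add: E12_def E21_def E22_def n_def)

lemma S_dims [simp]:
  assumes "0 < \<epsilon>" "0 < \<beta>"
  shows "dim_row (S12 g J \<epsilon> \<beta>) = n" "dim_col (S12 g J \<epsilon> \<beta>) = N' * n"
  "dim_row (S21 g J \<epsilon> \<beta>) = N' * n" "dim_col (S21 g J \<epsilon> \<beta>) = n"
  "dim_row (S22 g J \<beta>) = N' * n" "dim_col (S22 g J \<beta>) = N' * n"
  using assms unfolding S12_def S21_def S22_def N'_def[symmetric] n_def[symmetric] by simp_all

text \<open>Up to a change of basis, \<open>a\<close> is the network average of \<open>v\<close> with the Perron weights, and \<open>b\<close>
  is its disagreement component.\<close>

lemma error_mat_eigenvector_coordinates:
  assumes \<epsilon>: "0 < \<epsilon>" and \<beta>: "0 < \<beta>"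
    and v: "v \<in> carrier_vec (N * n)" "v \<noteq> 0\<^sub>v (N * n)" "cmat (error_mat g \<mu>) *\<^sub>v v = z \<cdot>\<^sub>v v"
  obtains a b where "a \<in> carrier_vec n" "b \<in> carrier_vec (N' * n)"
    "a \<noteq> 0\<^sub>v n \<or> b \<noteq> 0\<^sub>v (N' * n)"
    "z \<cdot>\<^sub>v a = a - complex_of_real \<mu> \<cdot>\<^sub>v ((mat_inv (Oe \<epsilon>) * JG * Oe \<epsilon>) *\<^sub>v a + S12 g J \<epsilon> \<beta> *\<^sub>v b)"
    "z \<cdot>\<^sub>v b = K (mat_inv (Ob \<beta>) * J0 J * Ob \<beta>) *\<^sub>v b
       - complex_of_real \<mu> \<cdot>\<^sub>v (S21 g J \<epsilon> \<beta> *\<^sub>v a + S22 g J \<beta> *\<^sub>v b)"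
proof -
  let ?Oei = "mat_inv (Oe \<epsilon>)" and ?Obi = "mat_inv (Ob \<beta>)" and ?m = "complex_of_real \<mu>"
  note dims [simp] = mat_inv_Omega_dims[OF \<epsilon>] mat_inv_Omega_dims[OF \<beta>]
  have dv [simp]: "dim_vec v = N * n" using v by simp
  define r where "r = Rc *\<^sub>v v"
  have dr [simp]: "dim_vec r = N * n" by (simp add: r_def)
  define a0 b0 where "a0 = K prow *\<^sub>v v" and "b0 = K (YCl g J) *\<^sub>v v"
  have d0 [simp]: "dim_vec a0 = n" "dim_vec b0 = N' * n" by (simp_all add: a0_def b0_def)
  define a b where "a = ?Oei *\<^sub>v (YGi J *\<^sub>v a0)" and "b = K ?Obi *\<^sub>v b0"
  have d [simp]: "dim_vec a = n" "dim_vec b = N' * n" by (simp_all add: a_def b_def)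
  have a0: "a0 = YG J *\<^sub>v (Oe \<epsilon> *\<^sub>v a)"
  proof -
    have "YG J *\<^sub>v (Oe \<epsilon> *\<^sub>v a) = YG J *\<^sub>v ((Oe \<epsilon> * ?Oei) *\<^sub>v (YGi J *\<^sub>v a0))"
      unfolding a_def by (subst mult_mat_vec_assoc) simp_all
    also have "\<dots> = (YG J * YGi J) *\<^sub>v a0"
      unfolding Omega_inverse[OF \<epsilon>] by (subst mult_mat_vec_assoc) (simp_all add: one_mult_mat_vec_dim)
    finally show ?thesis by (simp add: YG_inverse one_mult_mat_vec_dim)
  qed
  have b0: "b0 = K (Ob \<beta>) *\<^sub>v b"
  proof -
    have "K (Ob \<beta>) *\<^sub>v b = K (Ob \<beta> * ?Obi) *\<^sub>v b0"
      unfolding b_def by (subst K_mult_vec) simp_all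
    then show ?thesis unfolding Omega_inverse[OF \<beta>] kron_one_one by (simp add: one_mult_mat_vec_dim)
  qed
  \<comment> \<open>\<open>ones_prow\<close> tensored with the identity. Inserting this split into R
    v produces the four corners of R.\<close>
  have v_split: "v = K ones *\<^sub>v a0 + K (YCr g J) *\<^sub>v b0"
  proof -
    have "v = K (ones * prow + YCr g J * YCl g J) *\<^sub>v v"
      unfolding ones_prow kron_one_one using v by simp
    also have "\<dots> = (K (ones * prow) + K (YCr g J * YCl g J)) *\<^sub>v v"
      by (subst kron_add_one[of _ N N]) (auto intro!: mult_carrier_mat[of _ N] prow_carrier ones_carrier)
    also have "\<dots> = K (ones * prow) *\<^sub>v v + K (YCr g J * YCl g J) *\<^sub>v v"
      using v by (intro add_mult_distrib_mat_vec[of _ "N * n" "N * n"]) auto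
    finally show ?thesis unfolding a0_def b0_def by (simp add: K_mult_vec)
  qed
  have r_split: "r = Rc *\<^sub>v (K ones *\<^sub>v a0) + Rc *\<^sub>v (K (YCr g J) *\<^sub>v b0)"
    unfolding r_def by (subst v_split) (simp add: mult_mat_vec_add)
  have Mv: "z \<cdot>\<^sub>v v = K Ct *\<^sub>v (v - ?m \<cdot>\<^sub>v r)"
  proof -
    have "(1\<^sub>m (N * n) - ?m \<cdot>\<^sub>m Rc) *\<^sub>v v = 1\<^sub>m (N * n) *\<^sub>v v - (?m \<cdot>\<^sub>m Rc) *\<^sub>v v"
      using v by (intro minus_mult_distrib_mat_vec[of _ "N * n" "N * n"]) auto
    also have "(?m \<cdot>\<^sub>m Rc) *\<^sub>v v = ?m \<cdot>\<^sub>v r"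
      unfolding r_def using v by (intro smult_mat_mult_vec[of _ "N * n" "N * n"]) auto
    finally have "(1\<^sub>m (N * n) - ?m \<cdot>\<^sub>m Rc) *\<^sub>v v = v - ?m \<cdot>\<^sub>v r" using v by simp
    then show ?thesis
      unfolding v(3)[symmetric] cmat_error_mat by (subst mult_mat_vec_assoc) simp_all
  qed
  \<comment> \<open>Since p^T C^T = p^T, the combination matrix disappears from the average.\<close>
  have za0: "z \<cdot>\<^sub>v a0 = a0 - ?m \<cdot>\<^sub>v (K prow *\<^sub>v r)"
  proof -
    have "z \<cdot>\<^sub>v a0 = K prow *\<^sub>v (K Ct *\<^sub>v (v - ?m \<cdot>\<^sub>v r))"
      unfolding Mv[symmetric] a0_def by (simp add: mult_mat_vec_smult)
    also have "\<dots> = K (prow * Ct) *\<^sub>v (v - ?m \<cdot>\<^sub>v r)"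
      by (subst K_mult_vec) simp_all
    finally show ?thesis
      unfolding prow_Ct a0_def by (simp add: mult_mat_vec_diff mult_mat_vec_smult)
  qed
  \<comment> \<open>\<open>J0\<close> also multiplies the perturbation, which is why it is a factor
    of \<open>S21\<close> and \<open>S22\<close> but not of \<open>S12\<close>.\<close>
  have zb0: "z \<cdot>\<^sub>v b0 = K (J0 J) *\<^sub>v (b0 - ?m \<cdot>\<^sub>v (K (YCl g J) *\<^sub>v r))"
  proof -
    have "z \<cdot>\<^sub>v b0 = K (YCl g J) *\<^sub>v (K Ct *\<^sub>v (v - ?m \<cdot>\<^sub>v r))"
      unfolding Mv[symmetric] b0_def by (simp add: mult_mat_vec_smult)
    also have "\<dots> = K (YCl g J * Ct) *\<^sub>v (v - ?m \<cdot>\<^sub>v r)"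
      by (subst K_mult_vec) simp_all
    also have "\<dots> = K (J0 J) *\<^sub>v (K (YCl g J) *\<^sub>v (v - ?m \<cdot>\<^sub>v r))"
      unfolding YCl_Ct by (subst K_mult_vec) simp_all
    finally show ?thesis
      unfolding b0_def by (simp add: mult_mat_vec_diff mult_mat_vec_smult)
  qed
  have r1: "K prow *\<^sub>v r = cmat (G_bar g J) *\<^sub>v a0 + E12 g J *\<^sub>v b0"
    unfolding r_split K_prow_R_ones[symmetric] E12_def n_def[symmetric]
    by (simp add: mult_mat_vec_add mult_mat_vec_assoc)
  have r2: "K (YCl g J) *\<^sub>v r = E21 g J *\<^sub>v a0 + E22 g J *\<^sub>v b0"
    unfolding r_split E21_def E22_def n_def[symmetric]
    by (simp add: mult_mat_vec_add mult_mat_vec_assoc)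
  have "z \<cdot>\<^sub>v a = a - ?m \<cdot>\<^sub>v ((?Oei * JG * Oe \<epsilon>) *\<^sub>v a + S12 g J \<epsilon> \<beta> *\<^sub>v b)"
  proof -
    have G: "YGi J *\<^sub>v (cmat (G_bar g J) *\<^sub>v a0) = JG *\<^sub>v (Oe \<epsilon> *\<^sub>v a)"
    proof -
      have cancel: "YGi J *\<^sub>v (YG J *\<^sub>v w) = w" if "dim_vec w = n" for w
        using that mult_mat_vec_assoc[of "YGi J" "YG J" w] by (simp add: YG_inverse one_mult_mat_vec_dim)
      show ?thesis unfolding a0 G_bar_YG by (simp add: mult_mat_vec_assoc cancel)
    qed
    have "z \<cdot>\<^sub>v a = ?Oei *\<^sub>v (YGi J *\<^sub>v (z \<cdot>\<^sub>v a0))"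
      unfolding a_def by (simp add: mult_mat_vec_smult)
    also have "\<dots> = a - ?m \<cdot>\<^sub>v (?Oei *\<^sub>v (YGi J *\<^sub>v (cmat (G_bar g J) *\<^sub>v a0)) + ?Oei *\<^sub>v (YGi J *\<^sub>v (E12 g J *\<^sub>v b0)))"
      unfolding za0 r1 a_def by (simp add: mult_mat_vec_smult mult_mat_vec_diff mult_mat_vec_add)
    finally show ?thesis
      unfolding G b0 S12_def N'_def[symmetric] n_def[symmetric] by (simp add: mult_mat_vec_assoc)
  qed
  moreover have "z \<cdot>\<^sub>v b = K (?Obi * J0 J * Ob \<beta>) *\<^sub>v b - ?m \<cdot>\<^sub>v (S21 g J \<epsilon> \<beta> *\<^sub>v a + S22 g J \<beta> *\<^sub>v b)"
  proof -
    have "z \<cdot>\<^sub>v b = K ?Obi *\<^sub>v (z \<cdot>\<^sub>v b0)"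
      unfolding b_def by (simp add: mult_mat_vec_smult)
    also have "\<dots> = K ?Obi *\<^sub>v (K (J0 J) *\<^sub>v b0) - ?m \<cdot>\<^sub>v (K ?Obi *\<^sub>v (K (J0 J) *\<^sub>v (E21 g J *\<^sub>v a0))
       + K ?Obi *\<^sub>v (K (J0 J) *\<^sub>v (E22 g J *\<^sub>v b0)))"
      unfolding zb0 r2 by (simp add: mult_mat_vec_smult mult_mat_vec_diff mult_mat_vec_add)
    finally show ?thesis
      unfolding a0 b0 S21_def S22_def N'_def[symmetric] n_def[symmetric] by (simp add: mult_mat_vec_assoc K_mult_vec)
  qed
  \<comment> \<open>v is rebuilt linearly from a and b, so they cannot both vanish.\<close>
  moreover have "a \<noteq> 0\<^sub>v n \<or> b \<noteq> 0\<^sub>v (N' * n)"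
  proof (rule ccontr)
    assume "\<not> ?thesis"
    then have 0: "a = 0\<^sub>v n" "b = 0\<^sub>v (N' * n)" by auto
    have z: "A *\<^sub>v 0\<^sub>v q = 0\<^sub>v (dim_row A)" if "dim_col A = q" for A :: "complex mat" and q
      using that by (intro eq_vecI) auto
    have "v = 0\<^sub>v (N * n)"
      using v_split unfolding a0 b0 0 by (simp add: z)
    then show False using v by simp
  qed
  ultimately show ?thesis using that[of a b] by (simp add: carrier_vecI)
qed

text \<open>The row contains row k of A spread over the columns with the same position i inside
  their block, and zeros elsewhere. Tensoring thus costs nothing in the disagreement rows.\<close>

lemma K_row_sum:
  assumes A: "A \<in> carrier_mat m q" and k: "k < m" "i < n"
  shows "(\<Sum>x<q * n. cmod (K A $$ (k * n + i, x))) = (\<Sum>l<q. cmod (A $$ (k, l)))"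
proof -
  have "(\<Sum>x<q * n. cmod (K A $$ (k * n + i, x))) = (\<Sum>l<q. \<Sum>j<n. if j = i then cmod (A $$ (k, l)) else 0)"
    unfolding sum_blocks using A k by (intro sum.cong refl) (simp add: index_kron_one)
  then show ?thesis using k by simp
qed

lemma Ldim_eq: "Ldim g = N' * n"
  by (simp add: Ldim_def N'_def n_def)

lemma chi22_total:
  assumes "j < N' * n"
  shows "(\<Sum>q<N' * n. cmod (S22 g J \<beta> $$ (j, q))) = chi22 g J \<beta> j + cmod (S22 g J \<beta> $$ (j, j))"
  unfolding chi22_def Ldim_eq using assms by (subst sum.remove[of _ j]) auto

lemma chi_nonneg: "0 \<le> chi12 g J \<epsilon> \<beta> m" "0 \<le> chi21 g J \<epsilon> \<beta> m" "0 \<le> chi22 g J \<beta> m"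
  unfolding chi12_def chi21_def chi22_def by (auto intro: sum_nonneg)

text \<open>The hypotheses are the three families after square roots: \<open>b2\<close> is
  multiplied out, so a zero denominator is harmless, and \<open>b3\<close> is the quadratic
  inequality behind the third family. \<open>b3\<close> controls the rows of the average,
  \<open>b1\<close> and \<open>b2\<close> together those of the disagreement.\<close>

lemma eigenvalue_bound:
  assumes adm: "admissible g J \<epsilon> \<beta> \<sigma>" and \<mu>: "0 < \<mu>"
    and b1: "\<And>k. k < N' \<Longrightarrow> sqrt \<mu> < 1 - cmod (lamC J k) - \<beta>"
    and b2: "\<And>j. j < N' * n \<Longrightarrow> sqrt \<mu> * (chi22 g J \<beta> j + cmod (S22 g J \<beta> $$ (j, j))) < 1 - \<sigma> * chi21 g J \<epsilon> \<beta> j"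
    and b3: "\<And>m. m < n \<Longrightarrow> \<mu> * (cmod (lamG J m))\<^sup>2 / 2 + sqrt \<mu> * (chi12 g J \<epsilon> \<beta> m / \<sigma>) < Re (lamG J m) - \<epsilon>"
    and ev: "eigenvalue (cmat (error_mat g \<mu>)) z"
  shows "cmod z < 1"
proof -
  have \<epsilon>: "0 < \<epsilon>" and \<beta>: "0 < \<beta>" and \<sigma>: "0 < \<sigma>" using adm by (auto simp: admissible_def)
  obtain v where "v \<in> carrier_vec (N * n)" "v \<noteq> 0\<^sub>v (N * n)" "cmat (error_mat g \<mu>) *\<^sub>v v = z \<cdot>\<^sub>v v"
    using ev carrier_matD[OF error_mat_carrier[of \<mu>]]
    unfolding eigenvalue_def eigenvector_def big_dim_def n_def[symmetric] by auto
  from error_mat_eigenvector_coordinates[OF \<epsilon> \<beta> this]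
  obtain a b where ab: "a \<in> carrier_vec n" "b \<in> carrier_vec (N' * n)"
    "a \<noteq> 0\<^sub>v n \<or> b \<noteq> 0\<^sub>v (N' * n)"
    and ea: "z \<cdot>\<^sub>v a = a - complex_of_real \<mu> \<cdot>\<^sub>v ((mat_inv (Oe \<epsilon>) * JG * Oe \<epsilon>) *\<^sub>v a + S12 g J \<epsilon> \<beta> *\<^sub>v b)"
    and eb: "z \<cdot>\<^sub>v b = K (mat_inv (Ob \<beta>) * J0 J * Ob \<beta>) *\<^sub>v b
       - complex_of_real \<mu> \<cdot>\<^sub>v (S21 g J \<epsilon> \<beta> *\<^sub>v a + S22 g J \<beta> *\<^sub>v b)" by blast
  define TG TC where "TG = mat_inv (Oe \<epsilon>) * JG * Oe \<epsilon>" and "TC = mat_inv (Ob \<beta>) * J0 J * Ob \<beta>"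
  have T: "TG \<in> carrier_mat n n" "TC \<in> carrier_mat N' N'"
    using mat_inv_Omega_dims[OF \<epsilon>] mat_inv_Omega_dims[OF \<beta>] by (auto simp: TG_def TC_def)
  note dT [simp] = carrier_matD[OF T(1)] carrier_matD[OF T(2)] carrier_vecD[OF ab(1)] carrier_vecD[OF ab(2)]
    S_dims[OF \<epsilon> \<beta>]
  let ?m = "complex_of_real \<mu>"
  \<comment> \<open>The relative weight of the two blocks; it turns the first-order terms \<open>S12\<close>, \<open>S21\<close> into terms
    of order \<open>\<mu>\<^sup>3\<^sup>/\<^sup>2\<close> and \<open>\<mu>\<^sup>1\<^sup>/\<^sup>2\<close>.\<close>
  define s where "s = \<sigma> / sqrt \<mu>"
  have s: "0 < s" using \<sigma> \<mu> by (simp add: s_def)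
  show ?thesis
  proof (rule block_diag_dominant[of n "\<lambda>i. a $ i" "N' * n" "\<lambda>i. b $ i" s z
        "\<lambda>i j. (if i = j then 1 else 0) - ?m * TG $$ (i, j)" "\<lambda>i j. - ?m * S12 g J \<epsilon> \<beta> $$ (i, j)"
        "\<lambda>i j. - ?m * S21 g J \<epsilon> \<beta> $$ (i, j)" "\<lambda>i j. K TC $$ (i, j) - ?m * S22 g J \<beta> $$ (i, j)"])
    show "(\<exists>i<n. a $ i \<noteq> 0) \<or> (\<exists>j<N' * n. b $ j \<noteq> 0)"
    proof (rule ccontr)
      assume "\<not> ?thesis"
      then have "a = 0\<^sub>v n" "b = 0\<^sub>v (N' * n)" by (auto intro!: eq_vecI)
      then show False using ab(3) by simp
    qed
    show "0 < s" by (rule s)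
  next
    fix i assume i: "i < n"
    have "z * a $ i = a $ i - ?m * ((TG *\<^sub>v a) $ i + (S12 g J \<epsilon> \<beta> *\<^sub>v b) $ i)"
      using arg_cong[OF ea, of "\<lambda>v. v $ i"] i by (simp flip: TG_def del: index_mult_mat_vec)
    also have "\<dots> = (\<Sum>j<n. (if i = j then 1 else 0) * a $ j) - ?m * ((\<Sum>j<n. TG $$ (i, j) * a $ j) + (\<Sum>j<N' * n. S12 g J \<epsilon> \<beta> $$ (i, j) * b $ j))"
    proof -
      have "(\<Sum>j<n. (if i = j then 1 else 0) * a $ j) = (\<Sum>j<n. if i = j then a $ j else 0)"
        by (intro sum.cong) auto
      then show ?thesis using i by (simp add: index_mult_vec del: index_mult_mat_vec)
    qed
    also have "\<dots> = (\<Sum>j<n. ((if i = j then 1 else 0) - ?m * TG $$ (i, j)) * a $ j) + (\<Sum>j<N' * n. (- ?m * S12 g J \<epsilon> \<beta> $$ (i, j)) * b $ j)"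
      by (simp add: left_diff_distrib sum_subtractf sum_distrib_left sum_negf algebra_simps)
    finally show "z * a $ i = \<dots>" .
    \<comment> \<open>Scaling keeps the eigenvalue on the diagonal and shrinks the rest of the row
      to at most \<epsilon>, so after multiplication by \<mu> it stays behind \<mu> Re
      \<lambda>.\<close>
    have lam: "TG $$ (i, i) = lamG J i" and off: "(\<Sum>j\<in>{..<n} - {i}. cmod (TG $$ (i, j))) \<le> \<epsilon>"
      using Omega_conj_jordan_row_sum[OF \<epsilon> blocksG_sum_n i] by (simp_all add: TG_def lamG_def)
    have "(\<Sum>j<n. cmod ((if i = j then 1 else 0) - ?m * TG $$ (i, j))) =
        cmod (1 - ?m * lamG J i) + (\<Sum>j\<in>{..<n} - {i}. cmod ((if i = j then 1 else 0) - ?m * TG $$ (i, j)))"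
      using i by (subst sum.remove[of _ i]) (auto simp: lam)
    also have "(\<Sum>j\<in>{..<n} - {i}. cmod ((if i = j then 1 else 0) - ?m * TG $$ (i, j))) =
        \<mu> * (\<Sum>j\<in>{..<n} - {i}. cmod (TG $$ (i, j)))"
      unfolding sum_distrib_left using \<mu> by (intro sum.cong) (auto simp: norm_mult)
    finally have A: "(\<Sum>j<n. cmod ((if i = j then 1 else 0) - ?m * TG $$ (i, j))) \<le> cmod (1 - ?m * lamG J i) + \<mu> * \<epsilon>"
      using mult_left_mono[OF off, of \<mu>] \<mu> by simp
    have B: "(\<Sum>j<N' * n. cmod (- ?m * S12 g J \<epsilon> \<beta> $$ (i, j))) = \<mu> * chi12 g J \<epsilon> \<beta> i"
      unfolding chi12_def Ldim_eq using \<mu> by (simp add: norm_mult sum_distrib_left)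
    \<comment> \<open>Uses that s times sqrt \<mu> is \<sigma>.\<close>
    have Bs: "\<mu> * chi12 g J \<epsilon> \<beta> i = s * (\<mu> * (sqrt \<mu> * (chi12 g J \<epsilon> \<beta> i / \<sigma>)))"
      unfolding s_def using \<sigma> \<mu> by simp
    have "cmod (1 - ?m * lamG J i) + \<mu> * \<epsilon> + \<mu> * (sqrt \<mu> * (chi12 g J \<epsilon> \<beta> i / \<sigma>))
        \<le> 1 + \<mu> * (\<mu> * (cmod (lamG J i))\<^sup>2 / 2 + sqrt \<mu> * (chi12 g J \<epsilon> \<beta> i / \<sigma>) - (Re (lamG J i) - \<epsilon>))"
      using cmod_one_minus_le[of \<mu> "lamG J i"] by (simp add: power2_eq_square algebra_simps)
    also have "\<dots> < 1" using b3[OF i] \<mu> by (simp add: mult_pos_neg)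
    finally have "s * (cmod (1 - ?m * lamG J i) + \<mu> * \<epsilon> + \<mu> * (sqrt \<mu> * (chi12 g J \<epsilon> \<beta> i / \<sigma>))) < s * 1"
      using s by (intro mult_strict_left_mono)
    then show "s * (\<Sum>j<n. cmod ((if i = j then 1 else 0) - ?m * TG $$ (i, j))) +
        (\<Sum>j<N' * n. cmod (- ?m * S12 g J \<epsilon> \<beta> $$ (i, j))) < s"
      unfolding B Bs using mult_left_mono[OF A, of s] s by (simp add: algebra_simps)
  next
    fix i assume i: "i < N' * n"
    obtain k i' where k: "k < N'" "i' < n" "i = k * n + i'" using block_index_cases[OF i] by blast
    have "z * b $ i = (K TC *\<^sub>v b) $ i - ?m * ((S21 g J \<epsilon> \<beta> *\<^sub>v a) $ i + (S22 g J \<beta> *\<^sub>v b) $ i)"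
      using arg_cong[OF eb, of "\<lambda>v. v $ i"] i by (simp flip: TC_def del: index_mult_mat_vec)
    also have "\<dots> = (\<Sum>j<N' * n. K TC $$ (i, j) * b $ j) - ?m * ((\<Sum>j<n. S21 g J \<epsilon> \<beta> $$ (i, j) * a $ j) + (\<Sum>j<N' * n. S22 g J \<beta> $$ (i, j) * b $ j))"
      using i by (simp add: index_mult_vec del: index_mult_mat_vec)
    also have "\<dots> = (\<Sum>j<n. (- ?m * S21 g J \<epsilon> \<beta> $$ (i, j)) * a $ j) + (\<Sum>j<N' * n. (K TC $$ (i, j) - ?m * S22 g J \<beta> $$ (i, j)) * b $ j)"
      by (simp add: left_diff_distrib sum_subtractf sum_distrib_left sum_negf algebra_simps)
    finally show "z * b $ i = \<dots>" .
    have lam: "TC $$ (k, k) = lamC J k" and off: "(\<Sum>j\<in>{..<N'} - {k}. cmod (TC $$ (k, j))) \<le> \<beta>"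
      using Omega_conj_jordan_row_sum[OF \<beta> blocksC_sum k(1)] by (simp_all add: TC_def lamC_def J0_def)
    \<comment> \<open>The diagonal of the perturbation is not merged with the eigenvalue here:
      |\<lambda>| keeps a fixed distance from 1, so the triangle inequality suffices.\<close>
    have "(\<Sum>j<N' * n. cmod (K TC $$ (i, j) - ?m * S22 g J \<beta> $$ (i, j)))
        \<le> (\<Sum>j<N' * n. cmod (K TC $$ (i, j)) + \<mu> * cmod (S22 g J \<beta> $$ (i, j)))"
      using \<mu> by (intro sum_mono order_trans[OF norm_triangle_ineq4]) (simp add: norm_mult)
    also have "\<dots> = (\<Sum>l<N'. cmod (TC $$ (k, l))) + \<mu> * (chi22 g J \<beta> i + cmod (S22 g J \<beta> $$ (i, i)))"
      unfolding sum.distrib sum_distrib_left[symmetric] chi22_total[OF i] using K_row_sum[OF T(2) k(1,2)] k(3) by simp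
    also have "(\<Sum>l<N'. cmod (TC $$ (k, l))) = cmod (lamC J k) + (\<Sum>j\<in>{..<N'} - {k}. cmod (TC $$ (k, j)))"
      using k by (subst sum.remove[of _ k]) (auto simp: lam)
    finally have D: "(\<Sum>j<N' * n. cmod (K TC $$ (i, j) - ?m * S22 g J \<beta> $$ (i, j)))
        \<le> cmod (lamC J k) + \<beta> + \<mu> * (chi22 g J \<beta> i + cmod (S22 g J \<beta> $$ (i, i)))" using off by linarith
    have sq: "sqrt \<mu> * sqrt \<mu> = \<mu>" using \<mu> by simp
    have "s * (\<Sum>j<n. cmod (- ?m * S21 g J \<epsilon> \<beta> $$ (i, j))) = s * \<mu> * chi21 g J \<epsilon> \<beta> i"
      unfolding chi21_def n_def[symmetric] using \<mu> by (simp add: norm_mult sum_distrib_left mult.assoc)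
    also have "s * \<mu> = sqrt \<mu> * \<sigma>" unfolding s_def using \<mu> sq by (simp add: field_simps)
    finally have C: "s * (\<Sum>j<n. cmod (- ?m * S21 g J \<epsilon> \<beta> $$ (i, j))) = sqrt \<mu> * (\<sigma> * chi21 g J \<epsilon> \<beta> i)"
      by simp
    \<comment> \<open>\<open>b2\<close> times sqrt \<mu>: both perturbations together stay below
      sqrt \<mu>, the part of the gap that \<open>b1\<close> sets aside.\<close>
    have "sqrt \<mu> * (sqrt \<mu> * (chi22 g J \<beta> i + cmod (S22 g J \<beta> $$ (i, i)))) < sqrt \<mu> * (1 - \<sigma> * chi21 g J \<epsilon> \<beta> i)"
      using b2[OF i] \<mu> by (intro mult_strict_left_mono) auto
    then have "\<mu> * (chi22 g J \<beta> i + cmod (S22 g J \<beta> $$ (i, i))) + sqrt \<mu> * (\<sigma> * chi21 g J \<epsilon> \<beta> i) < sqrt \<mu>"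
      unfolding mult.assoc[symmetric] sq by (simp add: algebra_simps)
    then show "s * (\<Sum>j<n. cmod (- ?m * S21 g J \<epsilon> \<beta> $$ (i, j))) +
        (\<Sum>j<N' * n. cmod (K TC $$ (i, j) - ?m * S22 g J \<beta> $$ (i, j))) < 1"
      unfolding C using D b1[OF k(1)] by linarith
  qed
qed

lemma mu_bound_finite:
  "finite ({(1 - cmod (lamC J k) - \<beta>)\<^sup>2 | k. k < nagents g - 1} \<union>
     {((1 - \<sigma> * chi21 g J \<epsilon> \<beta> j) / (chi22 g J \<beta> j + cmod (S22 g J \<beta> $$ (j, j))))\<^sup>2 | j.
        j < Ldim g \<and> chi22 g J \<beta> j + cmod (S22 g J \<beta> $$ (j, j)) \<noteq> 0} \<union>
     {((- (chi12 g J \<epsilon> \<beta> m / \<sigma>) +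
         sqrt ((chi12 g J \<epsilon> \<beta> m / \<sigma>)\<^sup>2 + 2 * (cmod (lamG J m))\<^sup>2 * (Re (lamG J m) - \<epsilon>)))
        / (cmod (lamG J m))\<^sup>2)\<^sup>2 | m. m < 2 * nfeats g})" (is "finite (?A \<union> ?B \<union> ?C)")
proof -
  have "finite ?A" by (rule finite_image_set) simp
  moreover have "finite ?B" by (rule finite_image_set) (simp add: finite_subset[of _ "{..<Ldim g}"])
  moreover have "finite ?C" by (rule finite_image_set) simp
  ultimately show ?thesis by simp
qed

text \<open>Every term of the minimum is the square of a positive number. Besides making the bound
  positive, this allows passing from \<mu> < y^2 to sqrt \<mu> < y.\<close>

lemma admissible_terms_pos:
  assumes adm: "admissible g J \<epsilon> \<beta> \<sigma>"
  shows "k < N' \<Longrightarrow> 0 < 1 - cmod (lamC J k) - \<beta>"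
    and "j < Ldim g \<Longrightarrow> chi22 g J \<beta> j + cmod (S22 g J \<beta> $$ (j, j)) \<noteq> 0 \<Longrightarrow>
      0 < (1 - \<sigma> * chi21 g J \<epsilon> \<beta> j) / (chi22 g J \<beta> j + cmod (S22 g J \<beta> $$ (j, j)))"
    and "m < n \<Longrightarrow> 0 < (- (chi12 g J \<epsilon> \<beta> m / \<sigma>) +
         sqrt ((chi12 g J \<epsilon> \<beta> m / \<sigma>)\<^sup>2 + 2 * (cmod (lamG J m))\<^sup>2 * (Re (lamG J m) - \<epsilon>)))
        / (cmod (lamG J m))\<^sup>2"
    and "m < n \<Longrightarrow> 0 < (cmod (lamG J m))\<^sup>2"
proof -
  show "k < N' \<Longrightarrow> 0 < 1 - cmod (lamC J k) - \<beta>" using adm by (simp add: admissible_def N'_def)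
  show "j < Ldim g \<Longrightarrow> chi22 g J \<beta> j + cmod (S22 g J \<beta> $$ (j, j)) \<noteq> 0 \<Longrightarrow>
      0 < (1 - \<sigma> * chi21 g J \<epsilon> \<beta> j) / (chi22 g J \<beta> j + cmod (S22 g J \<beta> $$ (j, j)))"
    using adm chi_nonneg(3)[of \<beta> j] by (intro divide_pos_pos) (auto simp: admissible_def order_less_le)
  assume m: "m < n"
  have \<epsilon>: "0 < \<epsilon>" "\<epsilon> < Re (lamG J m)" "0 < \<sigma>" using adm m by (auto simp: admissible_def n_def)
  then have "lamG J m \<noteq> 0" by auto
  then show pos: "0 < (cmod (lamG J m))\<^sup>2" by simp
  define c where "c = chi12 g J \<epsilon> \<beta> m / \<sigma>"
  have c: "0 \<le> c" using chi_nonneg(1) \<epsilon> by (simp add: c_def)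
  have "c = sqrt (c\<^sup>2)" using c by simp
  also have "\<dots> < sqrt (c\<^sup>2 + 2 * (cmod (lamG J m))\<^sup>2 * (Re (lamG J m) - \<epsilon>))"
    using pos \<epsilon> by (intro real_sqrt_less_mono) simp
  finally show "0 < (- (chi12 g J \<epsilon> \<beta> m / \<sigma>) +
         sqrt ((chi12 g J \<epsilon> \<beta> m / \<sigma>)\<^sup>2 + 2 * (cmod (lamG J m))\<^sup>2 * (Re (lamG J m) - \<epsilon>)))
        / (cmod (lamG J m))\<^sup>2"
    unfolding c_def[symmetric] using pos by (intro divide_pos_pos) auto
qed

lemma mu_bound_pos:
  assumes adm: "admissible g J \<epsilon> \<beta> \<sigma>"
  shows "0 < mu_bound g J \<epsilon> \<beta> \<sigma>"
proof -
  note t = admissible_terms_pos[OF adm]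
  have 0: "0 < n" by (rule n_pos)
  show ?thesis
    unfolding mu_bound_def
  proof (subst Min_gr_iff[OF mu_bound_finite], goal_cases)
    \<comment> \<open>The third family is nonempty because there is at least one feature; the other
      two are empty for a single agent.\<close>
    case 1 then show ?case using 0 unfolding n_def by blast
  next
    case 2
    show ?case
      using t(1)[unfolded N'_def] t(2) t(3)[unfolded n_def]
      by (intro ballI) (elim UnE CollectE exE conjE; hypsubst; intro zero_less_power; assumption?; blast)
  qed
qed

lemma spectral_radius_error_mat:
  assumes adm: "admissible g J \<epsilon> \<beta> \<sigma>" and \<mu>: "0 < \<mu>" "\<mu> < mu_bound g J \<epsilon> \<beta> \<sigma>"
  shows "spectral_radius (cmat (error_mat g \<mu>)) < 1"
proof -
  note t = admissible_terms_pos[OF adm]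
  have \<mu>_less: "\<mu> < x" if "x \<in> {(1 - cmod (lamC J k) - \<beta>)\<^sup>2 | k. k < nagents g - 1} \<union>
     {((1 - \<sigma> * chi21 g J \<epsilon> \<beta> j) / (chi22 g J \<beta> j + cmod (S22 g J \<beta> $$ (j, j))))\<^sup>2 | j.
        j < Ldim g \<and> chi22 g J \<beta> j + cmod (S22 g J \<beta> $$ (j, j)) \<noteq> 0} \<union>
     {((- (chi12 g J \<epsilon> \<beta> m / \<sigma>) +
         sqrt ((chi12 g J \<epsilon> \<beta> m / \<sigma>)\<^sup>2 + 2 * (cmod (lamG J m))\<^sup>2 * (Re (lamG J m) - \<epsilon>)))
        / (cmod (lamG J m))\<^sup>2)\<^sup>2 | m. m < 2 * nfeats g}" for x
    using \<mu>(2) Min_le[OF mu_bound_finite that] unfolding mu_bound_def by linarith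
  have \<sigma>: "0 < \<sigma>" using adm by (simp add: admissible_def)
  have bound: "cmod z < 1" if "eigenvalue (cmat (error_mat g \<mu>)) z" for z
  proof (rule eigenvalue_bound[OF adm \<mu>(1) _ _ _ that])
    fix k assume k: "k < N'"
    have "\<mu> < (1 - cmod (lamC J k) - \<beta>)\<^sup>2" by (rule \<mu>_less) (use k[unfolded N'_def] in blast)
    then show "sqrt \<mu> < 1 - cmod (lamC J k) - \<beta>" using t(1)[OF k] by (rule sqrt_less_of_less_square)
  next
    fix j assume "j < N' * n"
    then have j: "j < Ldim g" by (simp add: Ldim_eq)
    let ?c = "chi22 g J \<beta> j + cmod (S22 g J \<beta> $$ (j, j))"
    show "sqrt \<mu> * ?c < 1 - \<sigma> * chi21 g J \<epsilon> \<beta> j"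
    \<comment> \<open>A zero denominator contributes no term to the minimum; the claim is then the
      admissibility of \<sigma>.\<close>
    proof (cases "?c = 0")
      case True
      then show ?thesis using adm j by (simp add: admissible_def)
    next
      case False
      have "\<mu> < ((1 - \<sigma> * chi21 g J \<epsilon> \<beta> j) / ?c)\<^sup>2" by (rule \<mu>_less) (use j False in blast)
      then have "sqrt \<mu> < (1 - \<sigma> * chi21 g J \<epsilon> \<beta> j) / ?c" using t(2)[OF j False] by (rule sqrt_less_of_less_square)
      moreover have "0 < ?c" using False chi_nonneg(3)[of \<beta> j] by (simp add: order_less_le)
      ultimately show ?thesis by (simp add: pos_less_divide_eq)
    qed
  next
    fix m assume m: "m < n"
    have x: "0 < Re (lamG J m) - \<epsilon>" using adm m by (simp add: admissible_def n_def)
    have "\<mu> < ((- (chi12 g J \<epsilon> \<beta> m / \<sigma>) +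
         sqrt ((chi12 g J \<epsilon> \<beta> m / \<sigma>)\<^sup>2 + 2 * (cmod (lamG J m))\<^sup>2 * (Re (lamG J m) - \<epsilon>)))
        / (cmod (lamG J m))\<^sup>2)\<^sup>2" by (rule \<mu>_less) (use m[unfolded n_def] in blast)
    then have "sqrt \<mu> < (- (chi12 g J \<epsilon> \<beta> m / \<sigma>) +
         sqrt ((chi12 g J \<epsilon> \<beta> m / \<sigma>)\<^sup>2 + 2 * (cmod (lamG J m))\<^sup>2 * (Re (lamG J m) - \<epsilon>)))
        / (cmod (lamG J m))\<^sup>2" using t(3)[OF m] by (rule sqrt_less_of_less_square)
    from step_bound_row[OF _ _ t(4)[OF m] x this]
    show "\<mu> * (cmod (lamG J m))\<^sup>2 / 2 + sqrt \<mu> * (chi12 g J \<epsilon> \<beta> m / \<sigma>) < Re (lamG J m) - \<epsilon>"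
      using \<mu>(1) \<sigma> chi_nonneg(1)[of \<epsilon> \<beta> m] by simp
  qed
  have c: "cmat (error_mat g \<mu>) \<in> carrier_mat (big_dim g) (big_dim g)" by simp
  have "0 < big_dim g" using pos by (simp add: big_dim_def)
  from spectral_radius_mem_max(1)[OF c this] obtain z
    where "eigenvalue (cmat (error_mat g \<mu>)) z" "spectral_radius (cmat (error_mat g \<mu>)) = cmod z"
    by (metis imageE spectrum_def mem_Collect_eq)
  then show ?thesis using bound by simp
qed

end


section \<open>Affine recursions and sample means\<close>

lemma det_nonzero_invertible_mat:
  fixes A :: "'a::field mat"
  assumes A: "A \<in> carrier_mat n n" and det: "det A \<noteq> 0"
  shows "invertible_mat A"
proof -
  obtain B where "B \<in> carrier_mat n n" "A * B = 1\<^sub>m n" "B * A = 1\<^sub>m n"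
    using det_non_zero_imp_unit[OF A det, of "()"] by (auto simp: Units_def ring_mat_def)
  then show ?thesis
    using A by (auto simp: invertible_mat_def inverts_mat_def intro!: exI[of _ B])
qed

text \<open>A real kernel vector of 1 - A would be an eigenvector for the eigenvalue 1, and
  complexification preserves it.\<close>

lemma spectral_radius_less_1_invertible:
  fixes A :: "real mat"
  assumes A: "A \<in> carrier_mat n n" and n: "0 < n" and sr: "spectral_radius (cmat A) < 1"
  shows "invertible_mat (1\<^sub>m n - A)"
proof (rule ccontr)
  assume ni: "\<not> invertible_mat (1\<^sub>m n - A)"
  have c: "1\<^sub>m n - A \<in> carrier_mat n n" using A by auto
  then have "det (1\<^sub>m n - A) = 0" using ni det_nonzero_invertible_mat by blast
  then obtain v where v: "v \<in> carrier_vec n" "v \<noteq> 0\<^sub>v n" "(1\<^sub>m n - A) *\<^sub>v v = 0\<^sub>v n"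
    using det_0_iff_vec_prod_zero[OF c] by auto
  have d: "v - A *\<^sub>v v = 0\<^sub>v n"
    using minus_mult_distrib_mat_vec[OF one_carrier_mat A v(1)] v by simp
  have Av: "A *\<^sub>v v = v"
  proof (rule eq_vecI)
    show "(A *\<^sub>v v) $ i = v $ i" if "i < dim_vec v" for i
      using arg_cong[OF d, of "\<lambda>u. u $ i"] that v A by (simp del: index_mult_mat_vec)
  qed (use v A in auto)
  let ?v = "map_vec complex_of_real v"
  have "cmat A *\<^sub>v ?v = ?v"
    using of_real_hom.mult_mat_vec_hom[OF A v(1), where ?'a = complex] by (simp add: Av)
  moreover have "?v \<noteq> 0\<^sub>v n" using v by (metis of_real_hom.vec_hom_zero_iff)
  ultimately have "eigenvalue (cmat A) 1"
    using A v by (auto simp: eigenvalue_def eigenvector_def intro!: exI[of _ ?v])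
  then have "cmod 1 \<le> spectral_radius (cmat A)"
    using A n unfolding spectrum_def by (intro spectral_radius_mem_max(2)[of _ n] imageI) (auto simp: spectrum_def)
  then show False using sr by simp
qed

text \<open>Subtracting the fixed point leaves a difference that evolves by pure powers of A, whose
  entries tend to 0.\<close>

lemma affine_recursion_tendsto:
  fixes A :: "real mat"
  assumes A: "A \<in> carrier_mat n n" and n: "0 < n" and sr: "spectral_radius (cmat A) < 1"
    and d: "d \<in> carrier_vec n" and x0: "x 0 \<in> carrier_vec n"
    and rec: "\<And>i. x (Suc i) = A *\<^sub>v x i + d" and j: "j < n"
  shows "(\<lambda>i. x i $ j) \<longlonglongrightarrow> (mat_inv (1\<^sub>m n - A) *\<^sub>v d) $ j"
proof -
  define xx where "xx = mat_inv (1\<^sub>m n - A) *\<^sub>v d"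
  have c: "1\<^sub>m n - A \<in> carrier_mat n n" using A by auto
  note I = mat_inv_invertible[OF c spectral_radius_less_1_invertible[OF A n sr]]
  have xx: "xx \<in> carrier_vec n" unfolding xx_def by (rule mult_mat_vec_carrier[OF I(1) d])
  have "(1\<^sub>m n - A) *\<^sub>v xx = d"
    unfolding xx_def using assoc_mult_mat_vec[OF c I(1) d] d by (simp add: I)
  then have fix_xx: "xx - A *\<^sub>v xx = d"
    using minus_mult_distrib_mat_vec[OF one_carrier_mat A xx] xx by simp
  have xc: "x i \<in> carrier_vec n" for i
  proof (induction i)
    case (Suc i)
    show ?case unfolding rec by (rule add_carrier_vec[OF mult_mat_vec_carrier[OF A Suc] d])
  qed (rule x0)
  have diff: "x i - xx = A ^\<^sub>m i *\<^sub>v (x 0 - xx)" for i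
  proof (induction i)
    case 0
    have "x 0 - xx \<in> carrier_vec n" using x0 xx by simp
    then show ?case using A by simp
  next
    case (Suc i)
    have Ai: "A ^\<^sub>m i \<in> carrier_mat n n" using A by simp
    have c0: "x 0 - xx \<in> carrier_vec n" using x0 xx by simp
    have "x (Suc i) - xx = A *\<^sub>v x i - A *\<^sub>v xx"
    proof (rule eq_vecI)
      fix k assume "k < dim_vec (A *\<^sub>v x i - A *\<^sub>v xx)"
      then have k: "k < n" using A by simp
      have "xx $ k - (A *\<^sub>v xx) $ k = d $ k"
        using arg_cong[OF fix_xx, of "\<lambda>u. u $ k"] k A by (simp del: index_mult_mat_vec)
      then show "(x (Suc i) - xx) $ k = (A *\<^sub>v x i - A *\<^sub>v xx) $ k"
        unfolding rec using k A d xx by (simp del: index_mult_mat_vec)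
    qed (use xx A in auto)
    also have "\<dots> = A *\<^sub>v (A ^\<^sub>m i *\<^sub>v (x 0 - xx))"
      unfolding Suc[symmetric] by (rule mult_minus_distrib_mat_vec[symmetric, OF A xc xx])
    also have "\<dots> = (A * A ^\<^sub>m i) *\<^sub>v (x 0 - xx)"
      by (rule assoc_mult_mat_vec[symmetric, OF A Ai c0])
    \<comment> \<open>Powers are built by multiplication on the right, whereas the recursion
      multiplies on the left.\<close>
    also have "A * A ^\<^sub>m i = A ^\<^sub>m Suc i"
    proof (induction i)
      case (Suc i)
      have Ai: "A ^\<^sub>m i \<in> carrier_mat n n" using A by simp
      show ?case using assoc_mult_mat[OF A Ai A] Suc by simp
    qed (use A in simp)
    finally show ?case .
  qed
  have pow0: "(\<lambda>i. (A ^\<^sub>m i) $$ (j, k)) \<longlonglongrightarrow> 0" if k: "k < n" for k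
  proof -
    have cA: "cmat A \<in> carrier_mat n n" using A by simp
    have "(\<lambda>i. Re ((cmat A ^\<^sub>m i) $$ (j, k))) \<longlonglongrightarrow> Re 0"
      by (intro tendsto_Re spectral_radius_less_1_pow_tendsto_0[OF cA n sr j k])
    moreover have "Re ((cmat A ^\<^sub>m i) $$ (j, k)) = (A ^\<^sub>m i) $$ (j, k)" for i
      using j k carrier_matD[OF pow_carrier_mat[OF A, of i]]
      by (simp flip: of_real_hom.mat_hom_pow[OF A])
    ultimately show ?thesis by simp
  qed
  have "x i $ j = xx $ j + (\<Sum>k<n. (A ^\<^sub>m i) $$ (j, k) * (x 0 - xx) $ k)" for i
  proof -
    have "(A ^\<^sub>m i *\<^sub>v (x 0 - xx)) $ j = (\<Sum>k<n. (A ^\<^sub>m i) $$ (j, k) * (x 0 - xx) $ k)"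
      using carrier_matD[OF pow_carrier_mat[OF A, of i]] j xx
      by (simp add: index_mult_vec del: index_mult_mat_vec index_minus_vec(1))
    then show ?thesis using arg_cong[OF diff[of i], of "\<lambda>u. u $ j"] xx j by simp
  qed
  moreover have "(\<lambda>i. xx $ j + (\<Sum>k<n. (A ^\<^sub>m i) $$ (j, k) * (x 0 - xx) $ k))
      \<longlonglongrightarrow> xx $ j + (\<Sum>k<n. 0 * (x 0 - xx) $ k)"
    by (intro tendsto_intros pow0) auto
  ultimately show ?thesis by (simp add: xx_def)
qed

section \<open>Importance-weighted means of a single sample\<close>

context gtd_jordan
begin

text \<open>The law of a sample whose state is visited as by agent k but whose action is drawn from
  the target policy.\<close>

definition target_prob :: "nat \<Rightarrow> nat \<times> 'a \<times> nat \<Rightarrow> real" where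
  "target_prob k = (\<lambda>(s, a, s'). visit g k $ s * target g s a * trans_prob g s a s')"

definition sample_prob :: "nat \<Rightarrow> nat \<times> 'a \<times> nat \<Rightarrow> real" where
  "sample_prob k = (\<lambda>(s, a, s'). visit g k $ s * behavior g k s a * trans_prob g s a s')"

text \<open>States are plain naturals; data outside this finite set occur with probability 0
  only.\<close>

definition samples :: "(nat \<times> 'a \<times> nat) set" where
  "samples = {..<S} \<times> UNIV \<times> {..<S}"

lemma finite_samples [simp]: "finite samples"
  by (simp add: samples_def)

lemma sum_samples: "(\<Sum>z\<in>samples. f z) = (\<Sum>s<S. \<Sum>a\<in>UNIV. \<Sum>s'<S. f (s, a, s'))"
  unfolding samples_def by (simp add: sum.cartesian_product case_prod_unfold)

lemma policy_facts:
  "s < S \<Longrightarrow> (\<Sum>s'<S. trans_prob g s a s') = 1"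
  "s < S \<Longrightarrow> 0 \<le> target g s a" "s < S \<Longrightarrow> (\<Sum>a\<in>UNIV. target g s a) = 1"
  "k < N \<Longrightarrow> s < S \<Longrightarrow> 0 \<le> behavior g k s a" "k < N \<Longrightarrow> s < S \<Longrightarrow> (\<Sum>a\<in>UNIV. behavior g k s a) = 1"
  "k < N \<Longrightarrow> (\<Sum>s<S. visit g k $ s) = 1"
  "k < N \<Longrightarrow> s < S \<Longrightarrow> 0 < visit g k $ s \<Longrightarrow> 0 < target g s a \<Longrightarrow> 0 < behavior g k s a"
  using gtd by (auto simp: gtd_setting_def mdp_setting_def agents_setting_def is_policy_def)

text \<open>If the behavior policy never takes action \<open>a\<close>, the left-hand side is \<open>0\<close> because of
  \<open>x / 0 = 0\<close>, and coverage makes the right-hand side vanish as well.\<close>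

lemma sample_prob_ratio:
  assumes k: "k < N" and s: "s < S"
  shows "sample_prob k (s, a, s') * (target g s a / behavior g k s a) = target_prob k (s, a, s')"
proof (cases "behavior g k s a = 0")
  case True
  then have "\<not> (0 < visit g k $ s \<and> 0 < target g s a)" using policy_facts(7)[OF k s, of a] by auto
  then have "visit g k $ s = 0 \<or> target g s a = 0"
    using visit_nonneg[OF k s] policy_facts(2)[OF s, of a] by (auto simp: order_less_le)
  then show ?thesis using True by (auto simp: sample_prob_def target_prob_def)
qed (simp add: sample_prob_def target_prob_def)

lemma sample_prob_sum:
  assumes k: "k < N"
  shows "(\<Sum>z\<in>samples. sample_prob k z) = 1"
proof -
  have "(\<Sum>z\<in>samples. sample_prob k z) = (\<Sum>s<S. \<Sum>a\<in>UNIV. visit g k $ s * behavior g k s a * (\<Sum>s'<S. trans_prob g s a s'))"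
    unfolding sum_samples by (simp add: sample_prob_def sum_distrib_left)
  also have "\<dots> = (\<Sum>s<S. visit g k $ s * (\<Sum>a\<in>UNIV. behavior g k s a))"
    by (simp add: policy_facts sum_distrib_left)
  finally show ?thesis using k by (simp add: policy_facts)
qed

lemma target_prob_sum:
  assumes s: "s < S"
  shows "(\<Sum>a\<in>UNIV. \<Sum>s'<S. target_prob k (s, a, s')) = visit g k $ s"
proof -
  have "(\<Sum>a\<in>UNIV. \<Sum>s'<S. target_prob k (s, a, s')) = visit g k $ s * (\<Sum>a\<in>UNIV. target g s a * (\<Sum>s'<S. trans_prob g s a s'))"
    by (simp add: target_prob_def sum_distrib_left mult.assoc)
  then show ?thesis using s by (simp add: policy_facts)
qed

lemma target_prob_chain_sum:
  assumes s: "s < S"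
  shows "(\<Sum>a\<in>UNIV. \<Sum>s'<S. target_prob k (s, a, s') * h s') =
    visit g k $ s * (\<Sum>s'<S. chain_mat g (target g) $$ (s, s') * h s')"
proof -
  have "(\<Sum>a\<in>UNIV. \<Sum>s'<S. target_prob k (s, a, s') * h s') =
      (\<Sum>s'<S. \<Sum>a\<in>UNIV. target_prob k (s, a, s') * h s')" by (rule sum.swap)
  also have "\<dots> = visit g k $ s * (\<Sum>s'<S. chain_mat g (target g) $$ (s, s') * h s')"
    using s by (simp add: target_prob_def chain_mat_def sum_distrib_left sum_distrib_right mult_ac)
  finally show ?thesis .
qed

text \<open>Averaging over action and destination replaces the next feature by row s of P^\<pi> X
  and so turns \<delta> into row s of \<open>Z\<close>.\<close>

lemma target_prob_Z_sum:
  assumes s: "s < S" and j: "j < M"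
  shows "(\<Sum>a\<in>UNIV. \<Sum>s'<S. target_prob k (s, a, s') * (X $$ (s, j) - discount g * X $$ (s', j))) =
    visit g k $ s * Z $$ (s, j)"
proof -
  have "(\<Sum>a\<in>UNIV. \<Sum>s'<S. target_prob k (s, a, s') * (X $$ (s, j) - discount g * X $$ (s', j))) =
      (\<Sum>a\<in>UNIV. \<Sum>s'<S. target_prob k (s, a, s')) * X $$ (s, j) -
      discount g * (\<Sum>a\<in>UNIV. \<Sum>s'<S. target_prob k (s, a, s') * X $$ (s', j))"
    by (simp add: sum_distrib_left sum_distrib_right sum_subtractf right_diff_distrib mult_ac)
  then show ?thesis
    unfolding target_prob_sum[OF s] target_prob_chain_sum[OF s, of k "\<lambda>s'. X $$ (s', j)"]
    using s j by (simp add: index_Z algebra_simps)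
qed

lemma index_sample_G:
  assumes s: "s < S" "s' < S" and ij: "i < M" "j < M"
  shows "sample_G g k (s, a, s') $$ (i, j) =
      target g s a / behavior g k s a * (eta g * X $$ (s, i) * X $$ (s, j))"
    and "sample_G g k (s, a, s') $$ (i, M + j) =
      target g s a / behavior g k s a * (eta g * X $$ (s, i) * (X $$ (s, j) - discount g * X $$ (s', j)))"
    and "sample_G g k (s, a, s') $$ (M + i, j) =
      target g s a / behavior g k s a * (- ((X $$ (s, i) - discount g * X $$ (s', i)) * X $$ (s, j)))"
    and "sample_G g k (s, a, s') $$ (M + i, M + j) = 0"
  using assms by (simp_all add: Let_def outer_def)

lemma sample_G_carrier: "sample_G g k z \<in> carrier_mat n n"
proof -
  obtain s a s' where z: "z = (s, a, s')" by (cases z)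
  show ?thesis unfolding z n_def mult_2 by (auto simp: Let_def outer_def intro!: four_block_carrier_mat carrier_vecI)
qed

lemma sample_g_carrier: "sample_g g k z \<in> carrier_vec n"
  by (cases z) (auto simp: n_def mult_2 Let_def intro!: append_carrier_vec carrier_vecI)

text \<open>Change of measure: the ratio of the policies turns the behavior law into the target
  law.\<close>

lemma weighted_sample_sum:
  assumes k: "k < N"
    and f: "\<And>s a s'. s < S \<Longrightarrow> s' < S \<Longrightarrow> f (s, a, s') = target g s a / behavior g k s a * h s a s'"
  shows "(\<Sum>z\<in>samples. sample_prob k z * f z) = (\<Sum>s<S. \<Sum>a\<in>UNIV. \<Sum>s'<S. target_prob k (s, a, s') * h s a s')"
  unfolding sum_samples using k
  by (intro sum.cong refl) (simp add: f flip: sample_prob_ratio mult.assoc)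

text \<open>The destination does not enter the upper left block and enters the off-diagonal blocks
  linearly through \<delta>; the remaining feature factor depends on s only and is pulled out of the
  average.\<close>

lemma sum_sample_G:
  assumes k: "k < N" and ij: "i < n" "j < n"
  shows "(\<Sum>z\<in>samples. sample_prob k z * sample_G g k z $$ (i, j)) = mean_G g k $$ (i, j)"
proof -
  have 1: "(\<Sum>z\<in>samples. sample_prob k z * sample_G g k z $$ (i, j)) = mean_G g k $$ (i, j)"
    if "i < M" "j < M" for i j
  proof -
    have "(\<Sum>z\<in>samples. sample_prob k z * sample_G g k z $$ (i, j)) =
        (\<Sum>s<S. \<Sum>a\<in>UNIV. \<Sum>s'<S. target_prob k (s, a, s') * (eta g * X $$ (s, i) * X $$ (s, j)))"
      by (rule weighted_sample_sum[OF k index_sample_G(1)[OF _ _ that]])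
    also have "\<dots> = (\<Sum>s<S. visit g k $ s * (eta g * X $$ (s, i) * X $$ (s, j)))"
      by (simp add: target_prob_sum flip: sum_distrib_right)
    finally show ?thesis using that by (simp add: index_mean_G sum_distrib_left mult_ac)
  qed
  have 2: "(\<Sum>z\<in>samples. sample_prob k z * sample_G g k z $$ (i, M + j)) = mean_G g k $$ (i, M + j)"
    if ij: "i < M" "j < M" for i j
  proof -
    have "(\<Sum>z\<in>samples. sample_prob k z * sample_G g k z $$ (i, M + j)) =
        (\<Sum>s<S. eta g * X $$ (s, i) * (\<Sum>a\<in>UNIV. \<Sum>s'<S. target_prob k (s, a, s') * (X $$ (s, j) - discount g * X $$ (s', j))))"
      by (subst weighted_sample_sum[OF k index_sample_G(2)[OF _ _ ij]], assumption, assumption)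
        (simp add: sum_distrib_left mult_ac)
    then show ?thesis
      using ij by (simp add: target_prob_Z_sum index_mean_G sum_distrib_left mult_ac)
  qed
  have 3: "(\<Sum>z\<in>samples. sample_prob k z * sample_G g k z $$ (M + i, j)) = mean_G g k $$ (M + i, j)"
    if ij: "i < M" "j < M" for i j
  proof -
    have "(\<Sum>z\<in>samples. sample_prob k z * sample_G g k z $$ (M + i, j)) =
        (\<Sum>s<S. - X $$ (s, j) * (\<Sum>a\<in>UNIV. \<Sum>s'<S. target_prob k (s, a, s') * (X $$ (s, i) - discount g * X $$ (s', i))))"
      by (subst weighted_sample_sum[OF k index_sample_G(3)[OF _ _ ij]], assumption, assumption)
        (simp add: sum_distrib_left algebra_simps)
    then show ?thesis
      using ij by (simp add: target_prob_Z_sum index_mean_G sum_negf mult_ac)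
  qed
  have 4: "(\<Sum>z\<in>samples. sample_prob k z * sample_G g k z $$ (M + i, M + j)) = mean_G g k $$ (M + i, M + j)"
    if ij: "i < M" "j < M" for i j
    using weighted_sample_sum[OF k, of "\<lambda>z. sample_G g k z $$ (M + i, M + j)" "\<lambda>_ _ _. 0"]
      index_sample_G(4)[OF _ _ ij] index_mean_G(4)[OF ij] by simp
  have "i < M \<or> (\<exists>i'<M. i = M + i')" if "i < n" for i
  proof (cases "i < M")
    case False
    then have "i - M < M" "i = M + (i - M)" using that by (auto simp: n_def)
    then show ?thesis by blast
  qed simp
  note c = this[OF ij(1)] this[OF ij(2)]
  then show ?thesis using 1 2 3 4 by blast
qed

lemma sum_sample_g:
  assumes k: "k < N" and j: "j < n"
  shows "(\<Sum>z\<in>samples. sample_prob k z * sample_g g k z $ j) = mean_g g k $ j"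
proof (cases "j < M")
  case True
  have sg: "sample_g g k (s, a, s') $ j =
      target g s a / behavior g k s a * (- (eta g * reward g s a s') * X $$ (s, j))" if "s < S" "s' < S" for s a s'
    using that True by (simp add: Let_def)
  have rew: "(\<Sum>a\<in>UNIV. \<Sum>s'<S. target_prob k (s, a, s') * reward g s a s') = visit g k $ s * reward_vec g $ s"
    if "s < S" for s
    using that by (simp add: target_prob_def reward_vec_def sum_distrib_left mult_ac)
  have "(\<Sum>z\<in>samples. sample_prob k z * sample_g g k z $ j) =
      (\<Sum>s<S. - eta g * X $$ (s, j) * (\<Sum>a\<in>UNIV. \<Sum>s'<S. target_prob k (s, a, s') * reward g s a s'))"
    by (subst weighted_sample_sum[OF k sg], assumption, assumption) (simp add: sum_distrib_left mult_ac)
  also have "\<dots> = mean_g g k $ j"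
  proof -
    have D: "(visit_mat g k *\<^sub>v reward_vec g) $ s = visit g k $ s * reward_vec g $ s" if "s < S" for s
    proof -
      have "(visit_mat g k *\<^sub>v reward_vec g) $ s = (\<Sum>i<S. if s = i then visit g k $ i * reward_vec g $ i else 0)"
      proof -
        have "(visit_mat g k *\<^sub>v reward_vec g) $ s = (\<Sum>i<S. (if s = i then visit g k $ i else 0) * reward_vec g $ i)"
          using that setting_carriers(5)[OF gtd] by (simp add: visit_mat_def mat_diag_def scalar_prod_def atLeast0LessThan)
        also have "\<dots> = (\<Sum>i<S. if s = i then visit g k $ i * reward_vec g $ i else 0)"
          by (intro sum.cong) auto
        finally show ?thesis .
      qed
      then show ?thesis using that by simp
    qed
    have c: "visit_mat g k *\<^sub>v reward_vec g \<in> carrier_vec S"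
      by (rule mult_mat_vec_carrier[OF visit_mat_carrier]) (simp add: reward_vec_def)
    have "mean_g g k $ j = - eta g * (\<Sum>s<S. X $$ (s, j) * (visit_mat g k *\<^sub>v reward_vec g) $ s)"
    proof -
      define u where "u = visit_mat g k *\<^sub>v reward_vec g"
      have "dim_vec u = S" using c unfolding u_def by (rule carrier_vecD)
      then show ?thesis
        unfolding mean_g_def u_def[symmetric] using True by (simp add: scalar_prod_def atLeast0LessThan)
    qed
    also have "\<dots> = (\<Sum>s<S. - eta g * X $$ (s, j) * (visit g k $ s * reward_vec g $ s))"
      by (simp add: D sum_distrib_left mult.assoc del: index_mult_mat_vec)
    finally show ?thesis by (simp add: rew)
  qed
  finally show ?thesis .
next
  case False
  then have "j - M < M" using j by (simp add: n_def)
  then show ?thesis using False by (simp add: mean_g_def sum_samples Let_def)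
qed

end


section \<open>The mean-error recursion\<close>

locale gtd_run = gtd_jordan g J + prob_space \<Omega>
  for g :: "'a::finite gtd" and J :: jordan_data and \<Omega> :: "'w measure" +
  fixes \<mu> :: real and data :: "nat \<Rightarrow> nat \<Rightarrow> 'w \<Rightarrow> nat \<times> 'a \<times> nat"
    and est :: "nat \<Rightarrow> nat \<Rightarrow> 'w \<Rightarrow> real vec"
  assumes run: "diffusion_gtd g \<mu> \<Omega> data est"
begin

abbreviation "D q \<equiv> data (fst q) (snd q)"

lemma est_Suc:
  "k < N \<Longrightarrow> \<omega> \<in> space \<Omega> \<Longrightarrow> est k (Suc i) \<omega> =
     vec n (\<lambda>j. \<Sum>l<N. comb g $$ (l, k) * adapt_step g \<mu> l (data l i \<omega>) (est l i \<omega>) $ j)"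
  using run sum_nbhd[of k] by (simp add: diffusion_gtd_def n_def)

lemma initial: "initial_model g \<Omega> data (\<lambda>k. est k 0)"
  and data_model: "data_model g \<Omega> data"
  using run by (simp_all add: diffusion_gtd_def)

lemma est_carrier: "k < N \<Longrightarrow> \<omega> \<in> space \<Omega> \<Longrightarrow> est k i \<omega> \<in> carrier_vec n"
  using initial by (cases i) (simp_all add: est_Suc initial_model_def n_def)

lemma data_indep: "indep_vars (\<lambda>_. count_space UNIV) D ({..<N} \<times> UNIV)"
  using data_model by (simp add: data_model_def case_prod_unfold)

lemma data_measurable: "k < N \<Longrightarrow> data k i \<in> measurable \<Omega> (count_space UNIV)"
  using data_indep unfolding indep_vars_def by force

lemma data_prob:
  "k < N \<Longrightarrow> z \<in> samples \<Longrightarrow> prob {\<omega> \<in> space \<Omega>. data k i \<omega> = z} = sample_prob k z"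
  using data_model by (cases z) (auto simp: data_model_def samples_def sample_prob_def)

lemma data_event: "k < N \<Longrightarrow> {\<omega> \<in> space \<Omega>. data k i \<omega> = z} \<in> events"
  using measurable_sets[OF data_measurable, of k "{z}" i]
  by (simp add: vimage_def Int_def conj_commute)

text \<open>The probabilities prescribed by \<open>data_model\<close> already sum to 1 over
  \<open>samples\<close>.\<close>

lemma AE_samples:
  assumes k: "k < N"
  shows "AE \<omega> in \<Omega>. data k i \<omega> \<in> samples"
proof -
  have "{\<omega> \<in> space \<Omega>. data k i \<omega> \<in> samples} = (\<Union>z\<in>samples. {\<omega> \<in> space \<Omega>. data k i \<omega> = z})" by auto
  then have "prob {\<omega> \<in> space \<Omega>. data k i \<omega> \<in> samples} = (\<Sum>z\<in>samples. prob {\<omega> \<in> space \<Omega>. data k i \<omega> = z})"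
    using data_event[OF k] by (simp only:) (intro finite_measure_finite_Union, auto simp: disjoint_family_on_def)
  then have 1: "prob {\<omega> \<in> space \<Omega>. data k i \<omega> \<in> samples} = 1"
    using k by (simp add: data_prob sample_prob_sum)
  have "AE \<omega> in \<Omega>. \<omega> \<in> {\<omega> \<in> space \<Omega>. data k i \<omega> \<in> samples}" by (rule AE_prob_1[OF 1])
  then show ?thesis by eventually_elim simp
qed

definition cyl :: "(nat \<times> nat) set \<Rightarrow> (nat \<times> nat \<Rightarrow> nat \<times> 'a \<times> nat) \<Rightarrow> 'w set" where
  "cyl F z = {\<omega> \<in> space \<Omega>. \<forall>q\<in>F. D q \<omega> = z q}"

text \<open>An empty \<open>F\<close> is allowed and gives the whole space, so plain expectations
  are a special case of integrals over cylinders.\<close>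

definition cyls :: "nat \<Rightarrow> 'w set set" where
  "cyls i = {cyl F z | F z. finite F \<and> F \<subseteq> {..<N} \<times> {i..}}"

lemma cyl_prob:
  assumes F: "finite F" "F \<subseteq> {..<N} \<times> UNIV"
  shows "cyl F z \<in> events" "prob (cyl F z) = (\<Prod>q\<in>F. prob {\<omega> \<in> space \<Omega>. D q \<omega> = z q})"
proof -
  \<comment> \<open>An intersection over no indices would be the universe instead of the sample
    space, so the empty case is treated apart.\<close>
  have eq: "cyl F z = (\<Inter>q\<in>F. {\<omega> \<in> space \<Omega>. D q \<omega> = z q})" if "F \<noteq> {}"
    using that by (auto simp: cyl_def)
  show "cyl F z \<in> events"
  proof (cases "F = {}")
    case False
    then show ?thesis
      unfolding eq[OF False] using F by (intro sets.finite_INT) (auto intro!: data_event)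
  qed (simp add: cyl_def)
  show "prob (cyl F z) = (\<Prod>q\<in>F. prob {\<omega> \<in> space \<Omega>. D q \<omega> = z q})"
  proof (cases "F = {}")
    case False
    have v: "D q -` {z q} \<inter> space \<Omega> = {\<omega> \<in> space \<Omega>. D q \<omega> = z q}" for q by auto
    show ?thesis
      unfolding eq[OF False] using indep_varsD[OF data_indep False F, of "\<lambda>q. {z q}"] by (simp add: v)
  qed (simp add: cyl_def prob_space)
qed

lemma cyls_event: "B \<in> cyls i \<Longrightarrow> B \<in> events"
  unfolding cyls_def using cyl_prob(1) by blast

lemma cyls_Suc: "cyls (Suc i) \<subseteq> cyls i"
  unfolding cyls_def by (force simp: subset_iff)

lemma space_cyls: "space \<Omega> \<in> cyls i"
  unfolding cyls_def by (auto simp: cyl_def intro!: exI[of _ "{}"])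

text \<open>A cylinder for times after i leaves the index (k, i) free. Prescribing the sample there
  gives a cylinder from time i on, and independence adds one factor to its probability.\<close>

lemma cyls_Int_data:
  assumes B: "B \<in> cyls (Suc i)" and k: "k < N" and w: "w \<in> samples"
  shows "B \<inter> {\<omega> \<in> space \<Omega>. data k i \<omega> = w} \<in> cyls i"
    "prob (B \<inter> {\<omega> \<in> space \<Omega>. data k i \<omega> = w}) = prob B * sample_prob k w"
proof -
  obtain F z where F: "finite F" "F \<subseteq> {..<N} \<times> {Suc i..}" and BF: "B = cyl F z"
    using B by (auto simp: cyls_def)
  define z' where "z' = z((k, i) := w)"
  have ki: "(k, i) \<notin> F" using F by auto
  then have z': "z' q = z q" if "q \<in> F" for q using that by (auto simp: z'_def)
  have eq: "B \<inter> {\<omega> \<in> space \<Omega>. data k i \<omega> = w} = cyl (insert (k, i) F) z'"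
    using z' by (auto simp: BF cyl_def z'_def)
  have F': "finite (insert (k, i) F)" "insert (k, i) F \<subseteq> {..<N} \<times> UNIV" "F \<subseteq> {..<N} \<times> UNIV"
    using F k by auto
  have "insert (k, i) F \<subseteq> {..<N} \<times> {i..}" using F k by fastforce
  then show "B \<inter> {\<omega> \<in> space \<Omega>. data k i \<omega> = w} \<in> cyls i"
    unfolding eq cyls_def using F'(1) by blast
  have "prob (cyl (insert (k, i) F) z') = prob {\<omega> \<in> space \<Omega>. data k i \<omega> = w} * (\<Prod>q\<in>F. prob {\<omega> \<in> space \<Omega>. D q \<omega> = z q})"
    unfolding cyl_prob(2)[OF F'(1,2)] using F(1) ki z' by (simp add: z'_def)
  then show "prob (B \<inter> {\<omega> \<in> space \<Omega>. data k i \<omega> = w}) = prob B * sample_prob k w"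
    unfolding eq unfolding BF cyl_prob(2)[OF F(1) F'(3)] using data_prob[OF k w] by simp
qed

text \<open>\<open>Y\<close> is uncorrelated with every cylinder event of the data used from time \<open>i\<close> on;
  this form of independence is stable under the recursion.\<close>

definition fresh :: "nat \<Rightarrow> ('w \<Rightarrow> real) \<Rightarrow> bool" where
  "fresh i Y \<longleftrightarrow> integrable \<Omega> Y \<and> (\<forall>B\<in>cyls i. (\<integral>\<omega>. Y \<omega> * indicator B \<omega> \<partial>\<Omega>) = expectation Y * prob B)"

lemma fresh_integrable: "fresh i Y \<Longrightarrow> integrable \<Omega> Y"
  by (simp add: fresh_def)

lemma fresh_mono: "fresh i Y \<Longrightarrow> fresh (Suc i) Y"
  using cyls_Suc by (auto simp: fresh_def)

lemma integrable_mult_event: "integrable \<Omega> Y \<Longrightarrow> B \<in> events \<Longrightarrow> integrable \<Omega> (\<lambda>\<omega>. Y \<omega> * indicator B \<omega>)"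
  for Y :: "'w \<Rightarrow> real"
  by (rule integrable_real_mult_indicator)

lemma fresh_const: "fresh i (\<lambda>_. c)"
  unfolding fresh_def using cyls_event by (auto simp: prob_space)

lemma fresh_add:
  assumes "fresh i Y" "fresh i Y'"
  shows "fresh i (\<lambda>\<omega>. Y \<omega> + Y' \<omega>)"
  using assms integrable_mult_event[OF _ cyls_event]
  by (auto simp: fresh_def distrib_right)

lemma fresh_cmult: "fresh i Y \<Longrightarrow> fresh i (\<lambda>\<omega>. c * Y \<omega>)"
  by (auto simp: fresh_def mult.assoc)

lemma fresh_sum: "finite A \<Longrightarrow> (\<And>a. a \<in> A \<Longrightarrow> fresh i (Y a)) \<Longrightarrow> fresh i (\<lambda>\<omega>. \<Sum>a\<in>A. Y a \<omega>)"
proof (induction A rule: finite_induct)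
  case empty then show ?case using fresh_const[of i 0] by simp
next
  case (insert a A)
  then have "fresh i (\<lambda>\<omega>. Y a \<omega> + (\<Sum>a\<in>A. Y a \<omega>))" by (intro fresh_add) auto
  then show ?case using insert by simp
qed

lemma fresh_cong: "fresh i Y \<Longrightarrow> (\<And>\<omega>. \<omega> \<in> space \<Omega> \<Longrightarrow> Y' \<omega> = Y \<omega>) \<Longrightarrow> fresh i Y'"
  by (simp add: fresh_def cong: Bochner_Integration.integrable_cong Bochner_Integration.integral_cong)

text \<open>Split by the value z of the sample. A cylinder B intersected with that event is a
  cylinder from time i on, where f is constant and Y factors by freshness. Summing over the finitely
  many z gives the formula for B; the whole space as B gives the mean.\<close>

lemma fresh_data_mult:
  assumes k: "k < N" and Y: "fresh i Y"
  shows "fresh (Suc i) (\<lambda>\<omega>. f (data k i \<omega>) * Y \<omega>)"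
    and "expectation (\<lambda>\<omega>. f (data k i \<omega>) * Y \<omega>) = (\<Sum>z\<in>samples. sample_prob k z * f z) * expectation Y"
proof -
  define E where "E z = {\<omega> \<in> space \<Omega>. data k i \<omega> = z}" for z
  have iY: "integrable \<Omega> Y" using Y by (rule fresh_integrable)
  have mY: "Y \<in> borel_measurable \<Omega>" using iY by simp
  have mf: "(\<lambda>\<omega>. f (data k i \<omega>)) \<in> borel_measurable \<Omega>"
    by (rule measurable_compose[OF data_measurable[OF k]]) simp
  have main: "integrable \<Omega> (\<lambda>\<omega>. f (data k i \<omega>) * Y \<omega> * indicator B \<omega>) \<and>
      (\<integral>\<omega>. f (data k i \<omega>) * Y \<omega> * indicator B \<omega> \<partial>\<Omega>) = (\<Sum>z\<in>samples. sample_prob k z * f z) * expectation Y * prob B"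
    if B: "B \<in> cyls (Suc i)" for B
  proof -
    have BE: "B \<inter> E z \<in> cyls i" "prob (B \<inter> E z) = prob B * sample_prob k z" if "z \<in> samples" for z
      using cyls_Int_data[OF B k that] by (simp_all add: E_def)
    \<comment> \<open>Only almost everywhere: outside \<open>samples\<close> the sum is 0, whereas f
      is arbitrary there. The same identity yields integrability of the product.\<close>
    have ae: "AE \<omega> in \<Omega>. (\<Sum>z\<in>samples. f z * (Y \<omega> * indicator (B \<inter> E z) \<omega>)) = f (data k i \<omega>) * Y \<omega> * indicator B \<omega>"
      using AE_samples[OF k, of i] AE_space
    proof eventually_elim
      case (elim \<omega>)
      have "(\<Sum>z\<in>samples. f z * (Y \<omega> * indicator (B \<inter> E z) \<omega>)) =
          (\<Sum>z\<in>samples. if data k i \<omega> = z then f z * (Y \<omega> * indicator B \<omega>) else 0)"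
        using elim by (intro sum.cong) (auto simp: E_def indicator_def)
      then show ?case using elim by simp
    qed
    have int: "integrable \<Omega> (\<lambda>\<omega>. f z * (Y \<omega> * indicator (B \<inter> E z) \<omega>))" if "z \<in> samples" for z
      using integrable_mult_event[OF iY cyls_event[OF BE(1)[OF that]]] by simp
    have mB: "(\<lambda>\<omega>. f (data k i \<omega>) * Y \<omega> * indicator B \<omega>) \<in> borel_measurable \<Omega>"
      using mf mY cyls_event[OF B] by simp
    have iS: "integrable \<Omega> (\<lambda>\<omega>. \<Sum>z\<in>samples. f z * (Y \<omega> * indicator (B \<inter> E z) \<omega>))"
      using int by (rule Bochner_Integration.integrable_sum)
    have "integrable \<Omega> (\<lambda>\<omega>. f (data k i \<omega>) * Y \<omega> * indicator B \<omega>)"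
      by (rule integrable_cong_AE_imp[OF iS mB]) (use ae in \<open>auto\<close>)
    moreover have "(\<integral>\<omega>. f (data k i \<omega>) * Y \<omega> * indicator B \<omega> \<partial>\<Omega>) =
        (\<integral>\<omega>. (\<Sum>z\<in>samples. f z * (Y \<omega> * indicator (B \<inter> E z) \<omega>)) \<partial>\<Omega>)"
      using ae by (intro integral_cong_AE mB borel_measurable_integrable[OF iS]) auto
    moreover have "\<dots> = (\<Sum>z\<in>samples. f z * (\<integral>\<omega>. Y \<omega> * indicator (B \<inter> E z) \<omega> \<partial>\<Omega>))"
      using int by (subst Bochner_Integration.integral_sum) auto
    moreover have "\<dots> = (\<Sum>z\<in>samples. f z * (expectation Y * (prob B * sample_prob k z)))"
      using Y BE unfolding fresh_def by (intro sum.cong refl) auto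
    ultimately show ?thesis by (simp add: sum_distrib_left sum_distrib_right mult_ac)
  qed
  have sp: "integrable \<Omega> (\<lambda>\<omega>. f (data k i \<omega>) * Y \<omega>) \<and>
      expectation (\<lambda>\<omega>. f (data k i \<omega>) * Y \<omega>) = (\<Sum>z\<in>samples. sample_prob k z * f z) * expectation Y"
    using main[OF space_cyls]
    by (simp add: prob_space indicator_def cong: Bochner_Integration.integrable_cong Bochner_Integration.integral_cong)
  then show "expectation (\<lambda>\<omega>. f (data k i \<omega>) * Y \<omega>) = (\<Sum>z\<in>samples. sample_prob k z * f z) * expectation Y" by simp
  show "fresh (Suc i) (\<lambda>\<omega>. f (data k i \<omega>) * Y \<omega>)"
    unfolding fresh_def using sp main by simp
qed

section \<open>Propagation of the means through one iteration\<close>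

lemma adapt_step_index:
  assumes "\<alpha> \<in> carrier_vec n" "j < n"
  shows "adapt_step g \<mu> k z \<alpha> $ j = \<alpha> $ j - \<mu> * ((\<Sum>j'<n. sample_G g k z $$ (j, j') * \<alpha> $ j') + sample_g g k z $ j)"
  using assms carrier_matD[OF sample_G_carrier[of k z]] carrier_vecD[OF sample_g_carrier[of k z]]
  by (simp add: adapt_step_def index_mult_vec del: index_mult_mat_vec sample_G.simps sample_g.simps)

text \<open>The initial model gives independence of two generated sigma-algebras. Coordinates of the
  estimate are measurable for the first, cylinders lie in the second, so the product formula for
  independent variables applies with the indicator of the cylinder.\<close>

lemma est_0_fresh:
  assumes k: "k < N" and j: "j < n"
  shows "fresh 0 (\<lambda>\<omega>. est k 0 \<omega> $ j)"
proof -
  define V1 where "V1 = vimage_algebra (space \<Omega>) (\<lambda>\<omega>. \<lambda>(k, j) \<in> {..<N} \<times> {..<n}. est k 0 \<omega> $ j)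
      (\<Pi>\<^sub>M kj \<in> {..<N} \<times> {..<n}. (borel :: real measure))"
  define V2 where "V2 = vimage_algebra (space \<Omega>) (\<lambda>\<omega>. \<lambda>(k, i) \<in> {..<N} \<times> UNIV. data k i \<omega>)
      (\<Pi>\<^sub>M ki \<in> {..<N} \<times> (UNIV :: nat set). count_space (UNIV :: (nat \<times> 'a \<times> nat) set))"
  have ind: "indep_set (sets V1) (sets V2)" and iY: "integrable \<Omega> (\<lambda>\<omega>. est k 0 \<omega> $ j)"
    using initial k j by (simp_all add: initial_model_def V1_def V2_def n_def)
  have m1: "(\<lambda>\<omega>. est k 0 \<omega> $ j) \<in> borel_measurable V1"
  proof -
    have "(\<lambda>\<omega>. (\<lambda>(k, j) \<in> {..<N} \<times> {..<n}. est k 0 \<omega> $ j) (k, j)) \<in> borel_measurable V1"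
      unfolding V1_def
      by (rule measurable_compose[OF measurable_vimage_algebra1 measurable_component_singleton])
        (use k j in \<open>simp_all add: space_PiM PiE_iff extensional_def Pi_iff\<close>)
    then show ?thesis using k j by simp
  qed
  have m2: "(\<lambda>\<omega>. D q \<omega>) \<in> measurable V2 (count_space UNIV)" if q: "q \<in> {..<N} \<times> UNIV" for q
  proof -
    have "(\<lambda>\<omega>. (\<lambda>(k, i) \<in> {..<N} \<times> UNIV. data k i \<omega>) q) \<in> measurable V2 (count_space UNIV)"
      unfolding V2_def
      by (rule measurable_compose[OF measurable_vimage_algebra1 measurable_component_singleton])
        (use q in \<open>simp_all add: space_PiM PiE_iff extensional_def Pi_iff\<close>)
    then show ?thesis using q by (simp add: case_prod_unfold)
  qed
  have sp: "space V1 = space \<Omega>" "space V2 = space \<Omega>" by (simp_all add: V1_def V2_def)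
  have BV: "B \<in> sets V2" if "B \<in> cyls 0" for B
  proof -
    obtain F z where F: "finite F" "F \<subseteq> {..<N} \<times> UNIV" and BF: "B = cyl F z"
      using \<open>B \<in> cyls 0\<close> by (auto simp: cyls_def)
    have "{\<omega> \<in> space V2. D q \<omega> = z q} \<in> sets V2" if "q \<in> F" for q
      using measurable_sets[OF m2, of q "{z q}"] F that by (auto simp: vimage_def Int_def conj_commute)
    then have "{\<omega> \<in> space V2. \<forall>q\<in>F. D q \<omega> = z q} \<in> sets V2"
      using F by (intro sets.sets_Collect_finite_All) auto
    then show ?thesis by (simp add: BF cyl_def sp)
  qed
  have "(\<integral>\<omega>. est k 0 \<omega> $ j * indicator B \<omega> \<partial>\<Omega>) = expectation (\<lambda>\<omega>. est k 0 \<omega> $ j) * prob B"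
    if B: "B \<in> cyls 0" for B
  proof -
    have mI: "(indicator B :: 'w \<Rightarrow> real) \<in> borel_measurable V2" using BV[OF B] by simp
    have iI: "integrable \<Omega> (indicator B :: 'w \<Rightarrow> real)"
      using integrable_mult_event[of "\<lambda>_. 1" B] cyls_event[OF B] by simp
    have "indep_var borel (\<lambda>\<omega>. est k 0 \<omega> $ j) borel (indicator B :: 'w \<Rightarrow> real)"
      unfolding indep_var_eq
    proof (intro conjI)
      show "random_variable borel (\<lambda>\<omega>. est k 0 \<omega> $ j)" "random_variable borel (indicator B :: 'w \<Rightarrow> real)"
        using iY iI by auto
      have s1: "sigma_sets (space \<Omega>) {(\<lambda>\<omega>. est k 0 \<omega> $ j) -` A \<inter> space \<Omega> |A. A \<in> sets borel} \<subseteq> sets V1"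
        using sets.sigma_sets_subset[of "{(\<lambda>\<omega>. est k 0 \<omega> $ j) -` A \<inter> space V1 |A. A \<in> sets borel}" V1]
          measurable_sets[OF m1] by (auto simp: sp)
      have s2: "sigma_sets (space \<Omega>) {(indicator B :: 'w \<Rightarrow> real) -` A \<inter> space \<Omega> |A. A \<in> sets borel} \<subseteq> sets V2"
        using sets.sigma_sets_subset[of "{(indicator B :: 'w \<Rightarrow> real) -` A \<inter> space V2 |A. A \<in> sets borel}" V2]
          measurable_sets[OF mI] by (auto simp: sp)
      show "indep_set (sigma_sets (space \<Omega>) {(\<lambda>\<omega>. est k 0 \<omega> $ j) -` A \<inter> space \<Omega> |A. A \<in> sets borel})
          (sigma_sets (space \<Omega>) {(indicator B :: 'w \<Rightarrow> real) -` A \<inter> space \<Omega> |A. A \<in> sets borel})"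
        using ind s1 s2 unfolding indep_set_def
        by (elim indep_sets_mono_sets) (auto split: bool.splits)
    qed
    from indep_var_lebesgue_integral[OF this iY iI] show ?thesis
      using cyls_event[OF B] by simp
  qed
  then show ?thesis using iY by (simp add: fresh_def)
qed

definition E :: "nat \<Rightarrow> nat \<Rightarrow> nat \<Rightarrow> real" where
  "E k i j = expectation (\<lambda>\<omega>. est k i \<omega> $ j)"

text \<open>The step consists of products of a sample entry with an estimate entry of the same
  agent; \<open>fresh_data_mult\<close> advances freshness by one time step and evaluates the mean
  of each.\<close>

lemma adapt_fresh:
  assumes k: "k < N" and fr: "\<And>j. j < n \<Longrightarrow> fresh i (\<lambda>\<omega>. est k i \<omega> $ j)" and j: "j < n"
  shows "fresh (Suc i) (\<lambda>\<omega>. adapt_step g \<mu> k (data k i \<omega>) (est k i \<omega>) $ j)"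
    and "expectation (\<lambda>\<omega>. adapt_step g \<mu> k (data k i \<omega>) (est k i \<omega>) $ j) =
      E k i j - \<mu> * ((\<Sum>j'<n. mean_G g k $$ (j, j') * E k i j') + mean_g g k $ j)"
proof -
  have fG: "fresh (Suc i) (\<lambda>\<omega>. sample_G g k (data k i \<omega>) $$ (j, j') * est k i \<omega> $ j')"
    and eG: "expectation (\<lambda>\<omega>. sample_G g k (data k i \<omega>) $$ (j, j') * est k i \<omega> $ j') = mean_G g k $$ (j, j') * E k i j'"
    if "j' < n" for j'
    using fresh_data_mult[OF k fr[OF that], of "\<lambda>z. sample_G g k z $$ (j, j')"] sum_sample_G[OF k j that]
    by (simp_all add: E_def)
  \<comment> \<open>The affine part is treated as a product with the constant 1, which is
    fresh.\<close>
  have fg: "fresh (Suc i) (\<lambda>\<omega>. sample_g g k (data k i \<omega>) $ j)"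
    and eg: "expectation (\<lambda>\<omega>. sample_g g k (data k i \<omega>) $ j) = mean_g g k $ j"
    using fresh_data_mult[OF k fresh_const[of i 1], of "\<lambda>z. sample_g g k z $ j"] sum_sample_g[OF k j]
    by (simp_all add: prob_space)
  have eq: "adapt_step g \<mu> k (data k i \<omega>) (est k i \<omega>) $ j = est k i \<omega> $ j
      + (- \<mu>) * ((\<Sum>j'<n. sample_G g k (data k i \<omega>) $$ (j, j') * est k i \<omega> $ j') + sample_g g k (data k i \<omega>) $ j)"
    if "\<omega> \<in> space \<Omega>" for \<omega>
    using adapt_step_index[OF est_carrier[OF k that] j] by simp
  show "fresh (Suc i) (\<lambda>\<omega>. adapt_step g \<mu> k (data k i \<omega>) (est k i \<omega>) $ j)"
    by (rule fresh_cong[OF _ eq])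
      (intro fresh_add fresh_cmult fresh_sum fresh_mono fr fG fg j finite_lessThan; simp)
  have iS: "integrable \<Omega> (\<lambda>\<omega>. \<Sum>j'<n. sample_G g k (data k i \<omega>) $$ (j, j') * est k i \<omega> $ j')"
    by (intro Bochner_Integration.integrable_sum fresh_integrable[OF fG]) simp
  have "expectation (\<lambda>\<omega>. adapt_step g \<mu> k (data k i \<omega>) (est k i \<omega>) $ j) =
      expectation (\<lambda>\<omega>. est k i \<omega> $ j
      + (- \<mu>) * ((\<Sum>j'<n. sample_G g k (data k i \<omega>) $$ (j, j') * est k i \<omega> $ j') + sample_g g k (data k i \<omega>) $ j))"
    by (rule Bochner_Integration.integral_cong[OF refl eq])
  also have "\<dots> = E k i j + (- \<mu>) * (expectation (\<lambda>\<omega>. \<Sum>j'<n. sample_G g k (data k i \<omega>) $$ (j, j') * est k i \<omega> $ j') +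
      expectation (\<lambda>\<omega>. sample_g g k (data k i \<omega>) $ j))"
    unfolding E_def using fresh_integrable[OF fg] fresh_integrable[OF fr[OF j]] iS
    by (subst Bochner_Integration.integral_add) (auto simp del: sample_G.simps sample_g.simps)
  also have "expectation (\<lambda>\<omega>. \<Sum>j'<n. sample_G g k (data k i \<omega>) $$ (j, j') * est k i \<omega> $ j') =
      (\<Sum>j'<n. mean_G g k $$ (j, j') * E k i j')"
    using fresh_integrable[OF fG] by (subst Bochner_Integration.integral_sum) (auto simp: eG)
  also note eg
  finally show "expectation (\<lambda>\<omega>. adapt_step g \<mu> k (data k i \<omega>) (est k i \<omega>) $ j) =
      E k i j - \<mu> * ((\<Sum>j'<n. mean_G g k $$ (j, j') * E k i j') + mean_g g k $ j)" by simp
qed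

lemma est_fresh: "k < N \<Longrightarrow> j < n \<Longrightarrow> fresh i (\<lambda>\<omega>. est k i \<omega> $ j)"
proof (induction i arbitrary: k j)
  case 0 then show ?case by (rule est_0_fresh)
next
  case (Suc i)
  have eq: "est k (Suc i) \<omega> $ j = (\<Sum>l<N. comb g $$ (l, k) * adapt_step g \<mu> l (data l i \<omega>) (est l i \<omega>) $ j)"
    if "\<omega> \<in> space \<Omega>" for \<omega>
    using est_Suc[OF Suc.prems(1) that] Suc.prems by simp
  show ?case
    by (rule fresh_cong[OF _ eq]) (intro fresh_sum fresh_cmult adapt_fresh Suc; simp add: Suc)
qed

lemma E_Suc:
  assumes k: "k < N" and j: "j < n"
  shows "E k (Suc i) j = (\<Sum>l<N. comb g $$ (l, k) *
    (E l i j - \<mu> * ((\<Sum>j'<n. mean_G g l $$ (j, j') * E l i j') + mean_g g l $ j)))"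
proof -
  have "E k (Suc i) j = expectation (\<lambda>\<omega>. \<Sum>l<N. comb g $$ (l, k) * adapt_step g \<mu> l (data l i \<omega>) (est l i \<omega>) $ j)"
    unfolding E_def using est_Suc[OF k] j by (intro Bochner_Integration.integral_cong) auto
  also have "\<dots> = (\<Sum>l<N. comb g $$ (l, k) * expectation (\<lambda>\<omega>. adapt_step g \<mu> l (data l i \<omega>) (est l i \<omega>) $ j))"
    using fresh_integrable[OF adapt_fresh(1)[OF _ est_fresh j]]
    by (subst Bochner_Integration.integral_sum) auto
  finally show ?thesis using adapt_fresh(2)[OF _ est_fresh j] by simp
qed

lemma alpha_opt_carrier: "alpha_opt g \<in> carrier_vec n"
proof -
  have K: "key_mat g (weight g) \<in> carrier_mat M M" by (rule setting_carriers[OF gtd])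
  have "invertible_mat (key_mat g (weight g))" using gtd by (simp add: gtd_setting_def global_setting_def)
  from mat_inv_invertible(1)[OF K this] have "w_opt g \<in> carrier_vec M"
    unfolding w_opt_def by (intro carrier_vecI) auto
  then show ?thesis by (simp add: alpha_opt_def n_def mult_2)
qed

lemma network_error_index:
  assumes "k < N" "j < n" "\<omega> \<in> space \<Omega>"
  shows "network_error g est i \<omega> $ (k * n + j) = alpha_opt g $ j - est k i \<omega> $ j"
  using assms est_carrier[of k \<omega> i] block_index_less[OF assms(1,2)]
  by (simp add: network_error_def col_vec_stack_def n_def[symmetric])

lemma network_error_integrable:
  assumes "q < big_dim g"
  shows "integrable \<Omega> (\<lambda>\<omega>. network_error g est i \<omega> $ q)"
proof -
  obtain k j where kj: "k < N" "j < n" "q = k * n + j"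
    using assms block_index_cases[of q N n] by (auto simp: big_dim_def n_def)
  have "integrable \<Omega> (\<lambda>\<omega>. alpha_opt g $ j - est k i \<omega> $ j)"
    using fresh_integrable[OF est_fresh[OF kj(1,2)]] by simp
  then show ?thesis
    using kj by (simp add: network_error_index cong: Bochner_Integration.integrable_cong)
qed

lemma mean_error_carrier: "mean_error g \<Omega> est i \<in> carrier_vec (N * n)"
  by (simp add: mean_error_def big_dim_def n_def)

lemma mean_error_index:
  assumes kj: "k < N" "j < n"
  shows "mean_error g \<Omega> est i $ (k * n + j) = alpha_opt g $ j - E k i j"
proof -
  have "mean_error g \<Omega> est i $ (k * n + j) = expectation (\<lambda>\<omega>. network_error g est i \<omega> $ (k * n + j))"
    using block_index_less[OF kj] by (simp add: mean_error_def big_dim_def n_def)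
  also have "\<dots> = expectation (\<lambda>\<omega>. alpha_opt g $ j - est k i \<omega> $ j)"
    using kj by (intro Bochner_Integration.integral_cong) (simp_all add: network_error_index)
  also have "\<dots> = alpha_opt g $ j - E k i j"
    unfolding E_def using fresh_integrable[OF est_fresh[OF kj]] by (simp add: prob_space)
  finally show ?thesis .
qed

lemma big_C_trans_mult:
  assumes "v \<in> carrier_vec (N * n)" "k < N" "j < n"
  shows "((big_C g)\<^sup>T *\<^sub>v v) $ (k * n + j) = (\<Sum>l<N. comb g $$ (l, k) * v $ (l * n + j))"
proof -
  have "(big_C g)\<^sup>T = (comb g)\<^sup>T \<otimes>\<^sub>k 1\<^sub>m n"
    by (simp add: big_C_def kron_transpose n_def)
  then show ?thesis
    using kron_one_mult_vec[of "(comb g)\<^sup>T" N N v n k j] assms by simp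
qed

lemma index_big_R_mult:
  assumes v: "v \<in> carrier_vec (N * n)" and l: "l < N" "j < n"
  shows "(big_R g *\<^sub>v v) $ (l * n + j) = (\<Sum>j'<n. mean_G g l $$ (j, j') * v $ (l * n + j'))"
proof -
  have "(big_R g *\<^sub>v v) $ (l * n + j) = (\<Sum>x<N * n. big_R g $$ (l * n + j, x) * v $ x)"
    using index_mult_vec[of v "big_R g" "l * n + j"] block_index_less[OF l] v by simp
  also have "\<dots> = (\<Sum>k<N. if l = k then (\<Sum>j'<n. mean_G g l $$ (j, j') * v $ (k * n + j')) else 0)"
    unfolding sum_blocks using l by (intro sum.cong refl) (simp add: index_big_R)
  finally show ?thesis using l by simp
qed

text \<open>Compared entry by entry. The weights that an agent gives to its neighbors sum to 1, so
  the \<open>alpha_opt\<close> terms on the right recombine to \<open>alpha_opt\<close>; what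
  remains is \<open>E_Suc\<close>.\<close>

lemma mean_error_Suc:
  "mean_error g \<Omega> est (Suc i) = error_mat g \<mu> *\<^sub>v mean_error g \<Omega> est i + drift_vec g \<mu>"
proof (rule eq_vecI)
  let ?e = "mean_error g \<Omega> est i"
  define u where "u = (1\<^sub>m (N * n) - \<mu> \<cdot>\<^sub>m big_R g) *\<^sub>v ?e"
  define d where "d = big_G g *\<^sub>v alpha_opt g + big_g g"
  have e: "?e \<in> carrier_vec (N * n)" by (rule mean_error_carrier)
  have u: "u \<in> carrier_vec (N * n)" and d: "d \<in> carrier_vec (N * n)"
    by (auto simp: u_def d_def big_g_def big_G_def col_vec_stack_def col_mat_stack_def n_def intro!: carrier_vecI)
  have CT: "(big_C g)\<^sup>T \<in> carrier_mat (N * n) (N * n)"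
    by (auto simp: big_C_def n_def)
  have eu: "error_mat g \<mu> *\<^sub>v ?e = (big_C g)\<^sup>T *\<^sub>v u"
    unfolding error_mat_def u_def big_dim_def n_def[symmetric]
    by (rule assoc_mult_mat_vec[OF CT _ e]) auto
  have ui: "u $ (l * n + j) = ?e $ (l * n + j) - \<mu> * (\<Sum>j'<n. mean_G g l $$ (j, j') * ?e $ (l * n + j'))"
    if l: "l < N" "j < n" for l j
  proof -
    have "u = ?e - \<mu> \<cdot>\<^sub>v (big_R g *\<^sub>v ?e)"
      unfolding u_def
      using minus_mult_distrib_mat_vec[OF one_carrier_mat smult_carrier_mat[OF big_R_carrier] e]
        smult_mat_mult_vec[OF big_R_carrier e] e by simp
    then show ?thesis
      using block_index_less[OF l] index_big_R_mult[OF e l] by (simp del: index_mult_mat_vec)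
  qed
  have di: "d $ (l * n + j) = (\<Sum>j'<n. mean_G g l $$ (j, j') * alpha_opt g $ j') + mean_g g l $ j"
    if l: "l < N" "j < n" for l j
  proof -
    have G: "big_G g \<in> carrier_mat (N * n) n" by (simp add: big_G_def col_mat_stack_def n_def)
    have "(big_G g *\<^sub>v alpha_opt g) $ (l * n + j) = (\<Sum>j'<n. big_G g $$ (l * n + j, j') * alpha_opt g $ j')"
      using index_mult_vec[of "alpha_opt g" "big_G g" "l * n + j"] block_index_less[OF l] alpha_opt_carrier
        carrier_matD[OF G] by simp
    moreover have "big_G g $$ (l * n + j, j') = mean_G g l $$ (j, j')" if "j' < n" for j'
      using l that block_index_less[OF l] by (simp add: big_G_def col_mat_stack_def n_def[symmetric])
    moreover have "big_g g $ (l * n + j) = mean_g g l $ j" "dim_vec (big_g g) = N * n"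
      using l block_index_less[OF l] by (simp_all add: big_g_def col_vec_stack_def n_def[symmetric])
    ultimately show ?thesis
      unfolding d_def using block_index_less[OF l] by (simp del: index_mult_mat_vec)
  qed
  have drift: "drift_vec g \<mu> = \<mu> \<cdot>\<^sub>v ((big_C g)\<^sup>T *\<^sub>v d)" by (simp add: drift_vec_def d_def)
  show "dim_vec (mean_error g \<Omega> est (Suc i)) = dim_vec (error_mat g \<mu> *\<^sub>v ?e + drift_vec g \<mu>)"
    using mean_error_carrier CT by (simp add: drift)
  fix q assume "q < dim_vec (error_mat g \<mu> *\<^sub>v ?e + drift_vec g \<mu>)"
  then have q: "q < N * n" using CT by (simp add: drift)
  then obtain k j where kj: "k < N" "j < n" "q = k * n + j" by (rule block_index_cases)
  let ?a = "alpha_opt g"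
  have "(error_mat g \<mu> *\<^sub>v ?e + drift_vec g \<mu>) $ q =
      (\<Sum>l<N. comb g $$ (l, k) * u $ (l * n + j)) + \<mu> * (\<Sum>l<N. comb g $$ (l, k) * d $ (l * n + j))"
    unfolding eu drift using q CT big_C_trans_mult[OF u kj(1,2)] big_C_trans_mult[OF d kj(1,2)]
    by (simp add: kj(3)[symmetric] del: index_mult_mat_vec)
  also have "\<dots> = (\<Sum>l<N. comb g $$ (l, k) * (?a $ j - (E l i j - \<mu> * ((\<Sum>j'<n. mean_G g l $$ (j, j') * E l i j') + mean_g g l $ j))))"
    unfolding sum_distrib_left[of \<mu>] sum.distrib[symmetric]
  proof (intro sum.cong refl)
    fix l assume "l \<in> {..<N}"
    then have l: "l < N" by simp
    \<comment> \<open>The \<open>alpha_opt\<close> part of R e cancels against the corresponding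
      part of the drift.\<close>
    have S: "(\<Sum>j'<n. mean_G g l $$ (j, j') * ?e $ (l * n + j')) =
        (\<Sum>j'<n. mean_G g l $$ (j, j') * ?a $ j') - (\<Sum>j'<n. mean_G g l $$ (j, j') * E l i j')"
      unfolding sum_subtractf[symmetric] using l
      by (intro sum.cong refl) (simp add: mean_error_index right_diff_distrib)
    show "comb g $$ (l, k) * u $ (l * n + j) + \<mu> * (comb g $$ (l, k) * d $ (l * n + j)) =
        comb g $$ (l, k) * (?a $ j - (E l i j - \<mu> * ((\<Sum>j'<n. mean_G g l $$ (j, j') * E l i j') + mean_g g l $ j)))"
      unfolding ui[OF l kj(2)] di[OF l kj(2)] S mean_error_index[OF l kj(2)] by (simp add: algebra_simps)
  qed
  also have "\<dots> = (\<Sum>l<N. comb g $$ (l, k)) * ?a $ j - E k (Suc i) j"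
    unfolding E_Suc[OF kj(1,2)] by (simp only: right_diff_distrib[of "comb g $$ _"] sum_subtractf sum_distrib_right)
  also have "\<dots> = mean_error g \<Omega> est (Suc i) $ q"
    using kj by (simp add: comb_sum mean_error_index)
  finally show "mean_error g \<Omega> est (Suc i) $ q = (error_mat g \<mu> *\<^sub>v ?e + drift_vec g \<mu>) $ q" by simp
qed

lemma mean_error_tendsto:
  assumes sr: "spectral_radius (cmat (error_mat g \<mu>)) < 1" and q: "q < big_dim g"
  shows "(\<lambda>i. mean_error g \<Omega> est i $ q) \<longlonglongrightarrow> bias_vec g \<mu> $ q"
  unfolding bias_vec_def
proof (rule affine_recursion_tendsto[OF error_mat_carrier _ sr])
  show "0 < big_dim g" using q by simp
  show "drift_vec g \<mu> \<in> carrier_vec (big_dim g)"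
    by (auto simp: drift_vec_def big_C_def big_dim_def intro!: carrier_vecI)
  show "mean_error g \<Omega> est 0 \<in> carrier_vec (big_dim g)"
    using mean_error_carrier by (simp add: big_dim_def n_def)
qed (rule mean_error_Suc, rule q)

end

text \<open>The first part makes the quantification over admissible parameters in the second one
  meaningful by supplying such parameters. Integrability is part of the claim because the integral
  of a non-integrable function defaults to 0, so the mean error would otherwise carry no
  information.\<close>

theorem theorem1:
  fixes g :: "'a::finite gtd" and J :: jordan_data
    and \<Omega> :: "'w measure"
  assumes "gtd_setting g" and "jordan_setting g J"
  shows
    "(invertible_mat (key_mat g (perron J)) \<longrightarrow>
        (\<forall>m < 2 * nfeats g. 0 < Re (lamG J m)) \<and> (\<exists>\<epsilon> \<beta> \<sigma>. admissible g J \<epsilon> \<beta> \<sigma>)) \<and>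
     (\<forall>\<epsilon> \<beta> \<sigma>. admissible g J \<epsilon> \<beta> \<sigma> \<longrightarrow>
        0 < mu_bound g J \<epsilon> \<beta> \<sigma> \<and>
        (\<forall>\<mu>. 0 < \<mu> \<and> \<mu> < mu_bound g J \<epsilon> \<beta> \<sigma> \<longrightarrow>
           spectral_radius (cmat (error_mat g \<mu>)) < 1 \<and>
           invertible_mat (1\<^sub>m (big_dim g) - error_mat g \<mu>) \<and>
           (\<forall>data est. diffusion_gtd g \<mu> \<Omega> data est \<longrightarrow>
              (\<forall>i. \<forall>j < big_dim g. integrable \<Omega> (\<lambda>\<omega>. network_error g est i \<omega> $ j)) \<and>
              (\<forall>i. mean_error g \<Omega> est (Suc i) =
                 error_mat g \<mu> *\<^sub>v mean_error g \<Omega> est i + drift_vec g \<mu>) \<and>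
              (\<forall>k < nagents g. \<forall>j < 2 * nfeats g.
                 (\<lambda>i. mean_error g \<Omega> est i $ (k * (2 * nfeats g) + j))
                   \<longlonglongrightarrow> bias_vec g \<mu> $ (k * (2 * nfeats g) + j)))))"
proof -
  interpret gtd_jordan g J by (rule gtd_jordan.intro) (fact assms)+
  have run: "(\<forall>i. \<forall>j < big_dim g. integrable \<Omega> (\<lambda>\<omega>. network_error g est i \<omega> $ j)) \<and>
      (\<forall>i. mean_error g \<Omega> est (Suc i) = error_mat g \<mu> *\<^sub>v mean_error g \<Omega> est i + drift_vec g \<mu>) \<and>
      (\<forall>k < nagents g. \<forall>j < 2 * nfeats g.
        (\<lambda>i. mean_error g \<Omega> est i $ (k * (2 * nfeats g) + j))
          \<longlonglongrightarrow> bias_vec g \<mu> $ (k * (2 * nfeats g) + j))"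
    if "diffusion_gtd g \<mu> \<Omega> data est" "spectral_radius (cmat (error_mat g \<mu>)) < 1" for \<mu> data est
  proof -
    have "prob_space \<Omega>" using that(1) by (simp add: diffusion_gtd_def data_model_def)
    then interpret gtd_run g J \<Omega> \<mu> data est
      using that(1) by (intro gtd_run.intro gtd_run_axioms.intro gtd_jordan_axioms)
    show ?thesis
      using network_error_integrable mean_error_Suc mean_error_tendsto[OF that(2)]
      by (simp add: big_dim_def block_index_less)
  qed
  have big_dim_pos: "0 < big_dim g" using pos by (simp add: big_dim_def)
  show ?thesis
    using lamG_Re_pos admissible_exists mu_bound_pos spectral_radius_error_mat
      spectral_radius_less_1_invertible[OF error_mat_carrier big_dim_pos] run
    by blast
qed

end
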